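(* Let $X$ be a non-trivial mixing subshift of finite type and let $f:X\to\mathbb{R}$ be H\"older continuous, with Gibbs measure $\mu$. Let $\gamma_0=\gamma_0(X,f)\in(0,1)$ be as defined in the context. Then for each $\alpha\in(\gamma_0,1]$ and each $\epsilon>0$ there exists $\rho>0$ such that for all sufficiently large $n$, $$\mathbb{P}_\alpha\Bigl(\bigl|P_{Y_n}(f)-\bigl(P_X(f)+\log\alpha\bigr)\bigr|\ge\epsilon\Bigr)<e^{-\rho n}.$$
   Context: $\mathcal{A}$ is a finite alphabet, $\sigma$ the left shift on $\mathcal{A}^{\mathbb{Z}}$. A subshift of finite type (SFT) $X\subset\mathcal{A}^{\mathbb{Z}}$ is non-trivial if it has at least two points, and mixing means topologically mixing. $B_m(X)$ is the set of words of length $m$ occurring in points of $X$; for a word $w$ of length $m$, $[w]=\{x\in X: x_0\dots x_{m-1}=w\}$ and $\mu(w):=\mu([w])$. For a subshift $Y\subset X$, a continuous $f$, and $w\in B_m(Y)$, let $S_mf(w)=\sup_{x\in Y\cap[w]}\sum_{i=0}^{m-1}f(\sigma^ix)$, and the pressure is $P_Y(f)=\lim_{m\to\infty}\frac1m\log\sum_{w\in B_m(Y)}e^{S_mf(w)}$ (with $P_\emptyset(f)=-\infty$). The Gibbs measure $\mu$ of $f$ is the unique equilibrium state of $f$ on $X$. Define $$\gamma_0(X,f)=\inf\{\gamma>0:\exists n_0\ \forall m\ge n_0\ \forall u\in B_m(X),\ \mu(u)\le\gamma^m\}.$$ Random SFT: fix $\alpha\in(0,1]$; for each $n\ge1$ let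 $\mathcal{F}_n\subset B_n(X)$ be the random set obtained by including each word of $B_n(X)$ independently with probability $1-\alpha$ (under the probability measure $\mathbb{P}_\alpha$), and let $Y_n=\{x\in X:$ no word of $\mathcal{F}_n$ occurs in $x\}$. *)

theory Defs
  imports "HOL-Probability.Probability"
begin

text \<open>Points of the full shift are maps int => 'a, where 'a is a finite type (the alphabet).\<close>

definition shift :: "(int \<Rightarrow> 'a) \<Rightarrow> (int \<Rightarrow> 'a)" where
  "shift x = (\<lambda>i. x (i + 1))"

definition word :: "(int \<Rightarrow> 'a) \<Rightarrow> int \<Rightarrow> nat \<Rightarrow> 'a list" where
  "word x i m = map (\<lambda>k. x (i + int k)) [0..<m]"

definition lang :: "(int \<Rightarrow> 'a) set \<Rightarrow> nat \<Rightarrow> 'a list set" where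
  "lang Y m = {word x i m | x i. x \<in> Y}"

definition cyl :: "(int \<Rightarrow> 'a) set \<Rightarrow> 'a list \<Rightarrow> (int \<Rightarrow> 'a) set" where
  "cyl Y w = {x \<in> Y. word x 0 (length w) = w}"

definition is_SFT :: "(int \<Rightarrow> 'a) set \<Rightarrow> bool" where
  "is_SFT X \<longleftrightarrow> (\<exists>N (F :: 'a list set). (\<forall>w\<in>F. length w = N) \<and>
       X = {x. \<forall>i. word x i N \<notin> F})"

definition nontrivial :: "(int \<Rightarrow> 'a) set \<Rightarrow> bool" where
  "nontrivial X \<longleftrightarrow> (\<exists>x\<in>X. \<exists>y\<in>X. x \<noteq> y)"

text \<open>Topological mixing, written out on the cylinder base of the (relative product) topology.\<close>
definition top_mixing :: "(int \<Rightarrow> 'a) set \<Rightarrow> bool" where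
  "top_mixing X \<longleftrightarrow> (\<forall>u v. u \<in> lang X (length u) \<longrightarrow> v \<in> lang X (length v) \<longrightarrow>
      (\<exists>N. \<forall>n\<ge>N. \<exists>x\<in>X. word x 0 (length u) = u \<and> word x (int n) (length v) = v))"

definition shift_dist :: "(int \<Rightarrow> 'a) \<Rightarrow> (int \<Rightarrow> 'a) \<Rightarrow> real" where
  "shift_dist x y = (if x = y then 0
      else (1/2) ^ (LEAST k. \<exists>i. nat \<bar>i\<bar> = k \<and> x i \<noteq> y i))"

definition holder_on :: "(int \<Rightarrow> 'a) set \<Rightarrow> ((int \<Rightarrow> 'a) \<Rightarrow> real) \<Rightarrow> bool" where
  "holder_on X f \<longleftrightarrow> (\<exists>C \<theta>. \<theta> > 0 \<and>
      (\<forall>x\<in>X. \<forall>y\<in>X. \<bar>f x - f y\<bar> \<le> C * shift_dist x y powr \<theta>))"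

definition birkhoff :: "((int \<Rightarrow> 'a) \<Rightarrow> real) \<Rightarrow> nat \<Rightarrow> (int \<Rightarrow> 'a) \<Rightarrow> real" where
  "birkhoff f m x = (\<Sum>i<m. f ((shift ^^ i) x))"

definition Smf :: "(int \<Rightarrow> 'a) set \<Rightarrow> ((int \<Rightarrow> 'a) \<Rightarrow> real) \<Rightarrow> 'a list \<Rightarrow> real" where
  "Smf Y f w = (SUP x \<in> cyl Y w. birkhoff f (length w) x)"

definition pressure :: "(int \<Rightarrow> 'a) set \<Rightarrow> ((int \<Rightarrow> 'a) \<Rightarrow> real) \<Rightarrow> ereal" where
  "pressure Y f = (if Y = {} then -\<infinity>
      else ereal (lim (\<lambda>m. ln (\<Sum>w\<in>lang Y m. exp (Smf Y f w)) / real m)))"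

definition FS :: "(int \<Rightarrow> 'a) measure" where
  "FS = PiM (UNIV :: int set) (\<lambda>_. count_space (UNIV :: 'a set))"

definition invariant_on :: "(int \<Rightarrow> 'a) set \<Rightarrow> (int \<Rightarrow> 'a) measure \<Rightarrow> bool" where
  "invariant_on X \<mu> \<longleftrightarrow> prob_space \<mu> \<and> sets \<mu> = sets FS \<and> X \<in> sets FS \<and>
      emeasure \<mu> X = 1 \<and> (\<forall>A\<in>sets FS. emeasure \<mu> (shift -` A) = emeasure \<mu> A)"

definition ent_fun :: "real \<Rightarrow> real" where
  "ent_fun p = (if p = 0 then 0 else - p * ln p)"

definition part_entropy :: "(int \<Rightarrow> 'a) measure \<Rightarrow> ((int \<Rightarrow> 'a) \<Rightarrow> 'b) \<Rightarrow> real" where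
  "part_entropy \<mu> Q = (\<Sum>v\<in>Q ` space \<mu>. ent_fun (measure \<mu> {x\<in>space \<mu>. Q x = v}))"

text \<open>Entropy of the shift w.r.t. the finite partition given by P (cells = fibres of P).\<close>
definition entropy_wrt :: "(int \<Rightarrow> 'a) measure \<Rightarrow> ((int \<Rightarrow> 'a) \<Rightarrow> nat) \<Rightarrow> real" where
  "entropy_wrt \<mu> P = lim (\<lambda>n. part_entropy \<mu> (\<lambda>x. map (\<lambda>k. P ((shift ^^ k) x)) [0..<n]) / real n)"

definition ks_entropy :: "(int \<Rightarrow> 'a) measure \<Rightarrow> real" where
  "ks_entropy \<mu> = (SUP P \<in> {P. P \<in> measurable FS (count_space UNIV) \<and> finite (range P)}.
      entropy_wrt \<mu> P)"

definition equilibrium_state ::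
    "(int \<Rightarrow> 'a) set \<Rightarrow> ((int \<Rightarrow> 'a) \<Rightarrow> real) \<Rightarrow> (int \<Rightarrow> 'a) measure \<Rightarrow> bool" where
  "equilibrium_state X f \<mu> \<longleftrightarrow> invariant_on X \<mu> \<and>
     (\<forall>\<nu>. invariant_on X \<nu> \<longrightarrow>
        ks_entropy \<nu> + (\<integral>x. indicator X x * f x \<partial>\<nu>)
          \<le> ks_entropy \<mu> + (\<integral>x. indicator X x * f x \<partial>\<mu>))"

definition gamma0 :: "(int \<Rightarrow> 'a) set \<Rightarrow> (int \<Rightarrow> 'a) measure \<Rightarrow> real" where
  "gamma0 X \<mu> = Inf {\<gamma>. \<gamma> > 0 \<and> (\<exists>n0. \<forall>m\<ge>n0. \<forall>u\<in>lang X m. measure \<mu> (cyl X u) \<le> \<gamma> ^ m)}"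

definition rand_forbidden :: "(int \<Rightarrow> 'a) set \<Rightarrow> real \<Rightarrow> nat \<Rightarrow> 'a list set pmf" where
  "rand_forbidden X \<alpha> n =
     map_pmf (\<lambda>b. {w \<in> lang X n. b w}) (Pi_pmf (lang X n) False (\<lambda>_. bernoulli_pmf (1 - \<alpha>)))"

definition Yn :: "(int \<Rightarrow> 'a) set \<Rightarrow> nat \<Rightarrow> 'a list set \<Rightarrow> (int \<Rightarrow> 'a) set" where
  "Yn X n F = {x \<in> X. \<forall>i. word x i n \<notin> F}"

end

theory Submission
  imports Defs "HOL-Real_Asymp.Real_Asymp"
begin

text \<open>
  Write \<open>P\<close> for the pressure of \<open>X\<close>. An equilibrium state \<open>\<mu>\<close> satisfies the lower Gibbs bound
  \<open>\<mu>[u] \<ge> c exp (S u - m P)\<close>, so for any \<open>\<gamma>\<close> with \<open>gamma0 < \<gamma> < \<alpha>\<close> all words satisfy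
  \<open>exp (S u - m P) \<le> C \<gamma>^m\<close>. Neither the transfer operator nor uniqueness of \<open>\<mu>\<close> is used: the bound
  follows from the finite Gibbs inequality, once the variational principle is known in the direction
  \<open>P \<le> h(\<mu>) + \<integral>f d\<mu>\<close> (averaged measures of independent glued words) and \<open>h(\<mu>)\<close> is known to be at
  most the entropy rate of words (the coordinate partition generates).

  A word of length \<open>m\<close> survives with probability \<open>\<alpha>\<close> to the number of its distinct \<open>n\<close>-subwords. A
  repeated subword determines \<open>n\<close> further letters; this costs \<open>\<gamma>^n\<close> and gains at most \<open>\<alpha>^-n\<close>, so
  repetitions are negligible for \<open>m = Q n\<close>. The first moment of the partition function of length \<open>m\<close> then
  gives the upper tail. For the lower tail, the second moment of the weighted number of surviving points of
  period \<open>m\<close> shows that this number is close to \<open>(\<alpha> exp P)^m\<close>; surviving periodic points that begin with the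
  same \<open>n\<close>-word can be concatenated freely, and choosing the most frequent word costs only a factor
  \<open>CARD('a)^n\<close>.
\<close>

section \<open>Words, Birkhoff sums and pressure\<close>

text \<open>The length m = Q n is forced from both sides. Windows at the end of a word and the
  choice of a common prefix produce factors exponential in n; in a pressure, which is a logarithm
  divided by m, they weigh O(1 / Q), so Q must be large in terms of the tolerance. With Q fixed, on
  the other hand, there are only polynomially many places where two windows can coincide, and a
  polynomial loses against (\<open>\<gamma>\<close> / \<open>\<alpha>\<close>)^n. This ratio, the
  cost of a coincidence against the probability it saves, is the only source of the exponential
  rate. The second moment runs over periodic points because a surviving word need not extend to a
  point of the random subshift, whereas survival of a periodic orbit depends on finitely many words
  and is unaffected by rotation. Only an upper bound on the weights of words is needed, which is why
  the lower half of the Gibbs property of \<open>\<mu>\<close> is the relevant one. It comes from a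
  perturbation: a penalty on occurrences of a word u must change the free energy at a rate that can
  be computed on finite words.\<close>

lemma fekete:
  fixes a :: "nat \<Rightarrow> real"
  assumes sub: "\<And>m n. m \<ge> 1 \<Longrightarrow> n \<ge> 1 \<Longrightarrow> a (m + n) \<le> a m + a n"
    and bdd: "\<And>n. n \<ge> 1 \<Longrightarrow> c * real n \<le> a n"
  obtains L where "(\<lambda>n. a n / real n) \<longlonglongrightarrow> L" and "\<And>n. n \<ge> 1 \<Longrightarrow> L \<le> a n / real n"
proof -
  define S where "S = (\<lambda>n. a n / real n) ` {1..}"
  define L where "L = Inf S"
  have bS: "bdd_below S"
    unfolding S_def using bdd by (intro bdd_belowI2[where m = c]) (auto simp: field_simps)
  have neS: "S \<noteq> {}" unfolding S_def by auto
  have lower: "L \<le> a n / real n" if "n \<ge> 1" for n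
    unfolding L_def using that bS by (intro cInf_lower) (auto simp: S_def)
  have "(\<lambda>n. a n / real n) \<longlonglongrightarrow> L"
  proof (rule LIMSEQ_I)
    fix e :: real assume e: "e > 0"
    have "\<exists>s\<in>S. s < L + e / 2"
      using cInf_less_iff[OF neS bS, of "L + e/2"] e unfolding L_def by auto
    then obtain m where m: "m \<ge> 1" "a m / real m < L + e / 2" unfolding S_def by auto
    define M where "M = (\<Sum>r<m. \<bar>a r\<bar>)"
    have M: "\<bar>a r\<bar> \<le> M" if "r < m" for r
      unfolding M_def using that by (intro member_le_sum) auto
    have M0: "M \<ge> 0" unfolding M_def by (intro sum_nonneg) auto
    have mult: "a (Suc q * m) \<le> real (Suc q) * a m" for q
    proof (induction q)
      case (Suc q)
      have "a (Suc (Suc q) * m) \<le> a m + a (Suc q * m)" using sub[of m "Suc q * m"] m by simp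
      then show ?case using Suc by (simp add: algebra_simps)
    qed simp
    have main: "a n \<le> real (n div m) * a m + M" if n: "n \<ge> m" for n
    proof -
      have q: "n div m \<ge> 1" using n m by (simp add: div_greater_zero_iff Suc_leI)
      then obtain q where q': "n div m = Suc q" by (cases "n div m") auto
      have nn: "n = Suc q * m + n mod m" by (metis q' div_mult_mod_eq)
      have r: "n mod m < m" using m by simp
      \<comment> \<open>Subadditivity is assumed for positive arguments only, so a vanishing
        remainder has to be split off.\<close>
      show ?thesis
      proof (cases "n mod m = 0")
        case True
        then show ?thesis using mult[of q] nn q' M0 by simp
      next
        case False
        have "a (Suc q * m + n mod m) \<le> a (Suc q * m) + a (n mod m)"
          using False m by (intro sub) auto
        then show ?thesis using mult[of q] nn q' M[OF r] by simp
      qed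
    qed
    \<comment> \<open>\<open>a m\<close> may be negative, so rounding n / m down can cost up to its
      absolute value; \<open>M\<close> bounds the remainder term.\<close>
    define K where "K = \<bar>a m\<bar> + M"
    have up: "a n / real n \<le> a m / real m + K / real n" if n: "n \<ge> m" for n
    proof -
      have n0: "real n > 0" using n m by simp
      have e1: "real (n div m) * real m = real n - real (n mod m)"
        by (metis add_diff_cancel_right' div_mult_mod_eq of_nat_add of_nat_mult)
      have "real (n div m) * a m = (real n - real (n mod m)) * (a m / real m)"
        using m by (simp add: e1[symmetric])
      also have "\<dots> \<le> real n * (a m / real m) + \<bar>a m\<bar>"
      proof -
        have "- (real (n mod m) * (a m / real m)) \<le> \<bar>real (n mod m) * (a m / real m)\<bar>" by (rule abs_ge_minus_self)
        also have "\<dots> = \<bar>a m\<bar> * (real (n mod m) / real m)" by (simp add: abs_mult)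
        also have "\<dots> \<le> \<bar>a m\<bar> * 1"
          using m by (intro mult_left_mono) (auto simp: divide_le_eq less_imp_le)
        finally show ?thesis by (simp add: algebra_simps)
      qed
      finally have "a n \<le> real n * (a m / real m) + K" using main[OF n] by (simp add: K_def)
      then show ?thesis using n0 by (simp add: field_simps)
    qed
    have "(\<lambda>n. K / real n) \<longlonglongrightarrow> 0" by (rule lim_const_over_n)
    then obtain n0 where n0: "\<And>n. n \<ge> n0 \<Longrightarrow> \<bar>K / real n\<bar> < e / 2"
      using e by (metis LIMSEQ_D half_gt_zero diff_zero real_norm_def)
    show "\<exists>no. \<forall>n\<ge>no. norm (a n / real n - L) < e"
    proof (intro exI allI impI)
      fix n assume n: "max m (max n0 1) \<le> n"
      have "a n / real n \<le> a m / real m + K / real n" using n by (intro up) simp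
      moreover have "\<bar>K / real n\<bar> < e / 2" using n by (intro n0) simp
      ultimately have "a n / real n < L + e" using m(2) by linarith
      moreover have "L \<le> a n / real n" using lower[of n] n by auto
      ultimately show "norm (a n / real n - L) < e" using e by simp
    qed
  qed
  then show ?thesis using lower that by blast
qed

section \<open>Words, translates and Birkhoff sums\<close>

lemma length_word [simp]: "length (word x i m) = m"
  by (simp add: word_def)

lemma nth_word [simp]: "k < m \<Longrightarrow> word x i m ! k = x (i + int k)"
  by (simp add: word_def)

lemma word_eq_iff: "word x i m = word y j m \<longleftrightarrow> (\<forall>k<m. x (i + int k) = y (j + int k))"
  by (auto simp: list_eq_iff_nth_eq)

lemma word_eq_list_iff: "word x i m = w \<longleftrightarrow> length w = m \<and> (\<forall>k<m. x (i + int k) = w ! k)"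
  by (auto simp: list_eq_iff_nth_eq)

lemma word_add: "word x i (m + n) = word x i m @ word x (i + int m) n"
  by (rule nth_equalityI) (auto simp: nth_append algebra_simps)

lemma take_word: "k \<le> m \<Longrightarrow> take k (word x i m) = word x i k"
  by (rule nth_equalityI) auto

lemma drop_word: "drop k (word x i m) = word x (i + int k) (m - k)"
  by (rule nth_equalityI) (auto simp: algebra_simps)

lemma word_translate: "word (\<lambda>i. x (i + p)) j m = word x (j + p) m"
  by (simp add: word_eq_iff algebra_simps)

lemma shift_funpow: "(shift ^^ k) x = (\<lambda>i. x (i + int k))"
proof (induction k arbitrary: x)
  case (Suc k)
  then show ?case by (simp add: shift_def algebra_simps)
qed simp

lemma birkhoff_alt: "birkhoff f m x = (\<Sum>i<m. f (\<lambda>j. x (j + int i)))"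
  by (simp add: birkhoff_def shift_funpow)

lemma birkhoff_add:
  "birkhoff f (m + n) x = birkhoff f m x + birkhoff f n (\<lambda>i. x (i + int m))"
  by (induction n) (auto simp: birkhoff_alt algebra_simps)

definition translation_invariant :: "(int \<Rightarrow> 'a) set \<Rightarrow> bool" where
  "translation_invariant Y \<longleftrightarrow> (\<forall>x\<in>Y. \<forall>k. (\<lambda>i. x (i + k)) \<in> Y)"

lemma finite_words: "finite {w :: 'a::finite list. length w = m}"
  using finite_lists_length_eq[of "UNIV :: 'a set" m] by simp

lemma lang_length: "w \<in> lang Y m \<Longrightarrow> length w = m"
  by (auto simp: lang_def)

lemma finite_lang [simp]: "finite (lang (Y :: (int \<Rightarrow> 'a::finite) set) m)"
  by (rule finite_subset[OF _ finite_words[of m]]) (auto simp: lang_def)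

lemma lang_mono: "Y \<subseteq> Z \<Longrightarrow> lang Y m \<subseteq> lang Z m"
  by (auto simp: lang_def)

lemma word_in_lang [intro]: "x \<in> Y \<Longrightarrow> word x i m \<in> lang Y m"
  by (auto simp: lang_def)

lemma lang_obtain:
  assumes "translation_invariant Y" "w \<in> lang Y m"
  obtains x where "x \<in> Y" "word x 0 m = w"
proof -
  obtain x i where x: "x \<in> Y" "w = word x i m" using assms(2) by (auto simp: lang_def)
  have "word (\<lambda>j. x (j + i)) 0 m = w" by (simp add: word_translate x)
  then show ?thesis using that assms(1) x(1) unfolding translation_invariant_def by blast
qed

lemma lang_appendD:
  assumes "u @ v \<in> lang Y m"
  shows "u \<in> lang Y (length u)" and "v \<in> lang Y (length v)"
proof -
  obtain x i where x: "x \<in> Y" "u @ v = word x i m" using assms by (auto simp: lang_def)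
  have m: "m = length u + length v" using x(2) by (metis length_word length_append)
  have "u = word x i (length u)" "v = word x (i + int (length u)) (length v)"
    using x(2) unfolding m word_add by auto
  then show "u \<in> lang Y (length u)" and "v \<in> lang Y (length v)"
    using x(1) word_in_lang by metis+
qed

text \<open>All that is used of a mixing SFT and a Hoelder potential. \<open>window\<close> is
  finite type: a sequence belongs to X once each of its n-windows occurs somewhere in X; as the
  position \<open>j\<close> is free, translation invariance follows. \<open>glue\<close> is
  specification with one gap G for all pairs of half-lines. In \<open>distort\<close> the points
  agree on 0..k-1 only, and \<open>V\<close> does not depend on k.\<close>

locale sft_system =
  fixes X :: "(int \<Rightarrow> 'a::finite) set" and f :: "(int \<Rightarrow> 'a) \<Rightarrow> real"
    and N0 G :: nat and V B :: real
  assumes window: "\<And>n z. n \<ge> N0 \<Longrightarrow>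
      (\<And>i. \<exists>x\<in>X. \<exists>j. \<forall>k<n. z (i + int k) = x (j + int k)) \<Longrightarrow> z \<in> X"
    and glue: "\<And>x y. x \<in> X \<Longrightarrow> y \<in> X \<Longrightarrow>
      \<exists>z\<in>X. (\<forall>i<0. z i = x i) \<and> (\<forall>i\<ge>0. z (i + int G) = y i)"
    and distort: "\<And>x y k. x \<in> X \<Longrightarrow> y \<in> X \<Longrightarrow> (\<And>i. i < k \<Longrightarrow> x (int i) = y (int i)) \<Longrightarrow>
      \<bar>birkhoff f k x - birkhoff f k y\<bar> \<le> V"
    and bound: "\<And>x. x \<in> X \<Longrightarrow> \<bar>f x\<bar> \<le> B"
    and nonempty: "X \<noteq> {}"
begin

lemma X_translate:
  assumes "x \<in> X"
  shows "(\<lambda>i. x (i + k)) \<in> X"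
proof (rule window[OF order_refl])
  fix i
  show "\<exists>y\<in>X. \<exists>j. \<forall>ka<N0. x (i + int ka + k) = y (j + int ka)"
    using assms by (intro bexI[of _ x] exI[of _ "i + k"]) (auto simp: algebra_simps)
qed

lemma X_inv: "translation_invariant X"
  by (auto simp: translation_invariant_def X_translate)

lemma B_nonneg: "B \<ge> 0" and V_nonneg: "V \<ge> 0"
proof -
  obtain x where "x \<in> X" using nonempty by auto
  then show "B \<ge> 0" "V \<ge> 0" using bound[of x] distort[of x x 0] by auto
qed

lemma birkhoff_bound: "x \<in> X \<Longrightarrow> \<bar>birkhoff f m x\<bar> \<le> B * real m"
proof -
  assume x: "x \<in> X"
  have "\<bar>birkhoff f m x\<bar> \<le> (\<Sum>i<m. \<bar>f (\<lambda>j. x (j + int i))\<bar>)"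
    unfolding birkhoff_alt by (rule sum_abs)
  also have "\<dots> \<le> (\<Sum>i<m. B)" by (intro sum_mono bound X_translate x)
  finally show ?thesis by (simp add: mult.commute)
qed

lemma le_Smf:
  assumes "Y \<subseteq> X" "x \<in> Y" "word x 0 m = w"
  shows "birkhoff f m x \<le> Smf Y f w"
proof -
  have m: "length w = m" using assms(3) by auto
  have "bdd_above (birkhoff f (length w) ` cyl Y w)"
    using birkhoff_bound[of _ "length w"] assms(1)
    by (intro bdd_aboveI2[where M = "B * real (length w)"]) (fastforce simp: cyl_def abs_le_iff)
  then show ?thesis unfolding Smf_def m[symmetric]
    by (rule cSUP_upper[rotated]) (use assms m in \<open>auto simp: cyl_def\<close>)
qed

lemma Smf_le:
  assumes "translation_invariant Y" "w \<in> lang Y m"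
    "\<And>x. x \<in> Y \<Longrightarrow> word x 0 m = w \<Longrightarrow> birkhoff f m x \<le> c"
  shows "Smf Y f w \<le> c"
proof -
  have "length w = m" using assms(2) by (rule lang_length)
  moreover have "cyl Y w \<noteq> {}" using lang_obtain[OF assms(1,2)] calculation
    by (auto simp: cyl_def)
  ultimately show ?thesis unfolding Smf_def
    by (intro cSUP_least) (use assms(3) in \<open>auto simp: cyl_def\<close>)
qed

lemma Smf_abs_le:
  assumes "translation_invariant Y" "Y \<subseteq> X" "w \<in> lang Y m"
  shows "\<bar>Smf Y f w\<bar> \<le> B * real m"
proof -
  obtain x where x: "x \<in> Y" "word x 0 m = w" using lang_obtain[OF assms(1,3)] .
  have "- (B * real m) \<le> Smf Y f w"
    using le_Smf[OF assms(2) x] birkhoff_bound[of x m] x assms(2) by fastforce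
  moreover have "Smf Y f w \<le> B * real m"
    using birkhoff_bound assms(2)
    by (intro Smf_le[OF assms(1,3)]) (fastforce simp: abs_le_iff)
  ultimately show ?thesis by auto
qed

text \<open>Bounded distortion: every point of a cylinder attains the supremum up to
  \<open>V\<close>. Together with \<open>le_Smf\<close> this moves the weight of a word onto any
  point containing it and back.\<close>

lemma Smf_le_birkhoff:
  assumes "x \<in> X" "word x 0 m = w"
  shows "Smf X f w \<le> birkhoff f m x + V"
proof (rule Smf_le[OF X_inv])
  show "w \<in> lang X m" using assms by auto
next
  fix y assume y: "y \<in> X" "word y 0 m = w"
  have "y (int i) = x (int i)" if "i < m" for i
    using y(2) assms(2) that word_eq_iff[of y 0 m x 0] by auto
  then show "birkhoff f m y \<le> birkhoff f m x + V"
    using distort[OF y(1) assms(1), of m] by auto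
qed

lemma Smf_append_le:
  assumes "translation_invariant Y" "Y \<subseteq> X" "u @ v \<in> lang Y m"
  shows "Smf Y f (u @ v) \<le> Smf Y f u + Smf Y f v"
proof (rule Smf_le[OF assms(1,3)])
  have m: "m = length u + length v" using lang_length[OF assms(3)] by simp
  fix x assume x: "x \<in> Y" "word x 0 m = u @ v"
  have w: "word x 0 (length u) = u" "word x (int (length u)) (length v) = v"
    using x(2) unfolding m word_add by auto
  have "birkhoff f m x = birkhoff f (length u) x + birkhoff f (length v) (\<lambda>i. x (i + int (length u)))"
    unfolding m birkhoff_add ..
  also have "\<dots> \<le> Smf Y f u + Smf Y f v"
    using assms(1) x(1) w by (intro add_mono le_Smf[OF assms(2)])
      (auto simp: translation_invariant_def word_translate)
  finally show "birkhoff f m x \<le> Smf Y f u + Smf Y f v" .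
qed

lemma Smf_mono:
  assumes "translation_invariant Y" "Y \<subseteq> X" "w \<in> lang Y m"
  shows "Smf Y f w \<le> Smf X f w"
  using assms by (intro Smf_le[OF assms(1,3)] le_Smf) auto

definition Z :: "(int \<Rightarrow> 'a) set \<Rightarrow> nat \<Rightarrow> real" where
  "Z Y m = (\<Sum>w\<in>lang Y m. exp (Smf Y f w))"

lemma lang_nonempty: "Y \<noteq> {} \<Longrightarrow> lang Y m \<noteq> {}"
  by (auto simp: lang_def)

lemma Z_pos: "Y \<noteq> {} \<Longrightarrow> Z Y m > 0"
  unfolding Z_def by (intro sum_pos lang_nonempty) auto

lemma inj_take_drop: "inj_on (\<lambda>w. (take m w, drop m w)) A"
  by (rule inj_onI) (metis Pair_inject append_take_drop_id)

lemma take_in_lang: "w \<in> lang Y k \<Longrightarrow> m \<le> k \<Longrightarrow> take m w \<in> lang Y m"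
  and drop_in_lang: "w \<in> lang Y k \<Longrightarrow> drop m w \<in> lang Y (k - m)"
  by (auto simp: take_word drop_word lang_def) blast+

lemma Z_submult:
  assumes "translation_invariant Y" "Y \<subseteq> X"
  shows "Z Y (m + n) \<le> Z Y m * Z Y n"
proof -
  have "Z Y (m + n) \<le> (\<Sum>w\<in>lang Y (m + n). exp (Smf Y f (take m w)) * exp (Smf Y f (drop m w)))"
    unfolding Z_def
  proof (intro sum_mono)
    fix w assume "w \<in> lang Y (m + n)"
    then show "exp (Smf Y f w) \<le> exp (Smf Y f (take m w)) * exp (Smf Y f (drop m w))"
      using Smf_append_le[OF assms, of "take m w" "drop m w" "m + n"] by (simp add: exp_add[symmetric])
  qed
  also have "\<dots> = (\<Sum>(u,v)\<in>(\<lambda>w. (take m w, drop m w)) ` lang Y (m + n). exp (Smf Y f u) * exp (Smf Y f v))"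
    by (subst sum.reindex[OF inj_take_drop]) auto
  also have "\<dots> \<le> (\<Sum>(u,v)\<in>lang Y m \<times> lang Y n. exp (Smf Y f u) * exp (Smf Y f v))"
    using take_in_lang[of _ Y "m + n" m] drop_in_lang[of _ Y "m + n" m]
    by (intro sum_mono2) auto
  also have "\<dots> = Z Y m * Z Y n"
    by (simp add: Z_def sum_product sum.cartesian_product)
  finally show ?thesis .
qed

text \<open>Fekete's lemma for \<open>ln (Z Y m)\<close>. Its lower-bound half matters later: a
  single length m bounds the pressure from above, without passing to the limit.\<close>

lemma pressure_props:
  assumes "translation_invariant Y" "Y \<subseteq> X" "Y \<noteq> {}"
  obtains L where "pressure Y f = ereal L" "(\<lambda>m. ln (Z Y m) / real m) \<longlonglongrightarrow> L"
    "\<And>m. m \<ge> 1 \<Longrightarrow> L \<le> ln (Z Y m) / real m"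
proof -
  have sub: "ln (Z Y (m + n)) \<le> ln (Z Y m) + ln (Z Y n)" for m n
    using Z_submult[OF assms(1,2), of m n] Z_pos[OF assms(3)]
    by (subst ln_mult_pos[symmetric]) (auto simp: less_imp_le)
  have bdd: "- B * real n \<le> ln (Z Y n)" for n
  proof -
    obtain w where w: "w \<in> lang Y n" using lang_nonempty[OF assms(3)] by auto
    have "exp (- B * real n) \<le> exp (Smf Y f w)" using Smf_abs_le[OF assms(1,2) w] by auto
    also have "\<dots> \<le> Z Y n" unfolding Z_def using w by (intro member_le_sum) auto
    finally show ?thesis using Z_pos[OF assms(3), of n] by (subst ln_ge_iff) auto
  qed
  obtain L where L: "(\<lambda>m. ln (Z Y m) / real m) \<longlonglongrightarrow> L" "\<And>m. m \<ge> 1 \<Longrightarrow> L \<le> ln (Z Y m) / real m"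
    using fekete[of "\<lambda>m. ln (Z Y m)" "-B"] sub bdd by metis
  have "pressure Y f = ereal L"
    using limI[OF L(1)] assms(3) by (simp add: pressure_def Z_def)
  with L that show ?thesis by blast
qed

end

section \<open>Quasi-multiplicativity of the partition functions\<close>

context sft_system
begin

definition prs :: real where
  "prs = lim (\<lambda>m. ln (Z X m) / real m)"

text \<open>\<open>CD\<close> is the price of gluing two words: one distortion for each and the
  energy of the G letters between them. \<open>CZ\<close> adds the price of replacing a length by
  one that differs by at most G inside \<open>exp (prs * length)\<close>.\<close>

definition CD :: real where "CD = exp (2 * V + B * real G)"
definition CZ :: real where "CZ = CD * exp (\<bar>prs\<bar> * real G)"

lemma pressure_X: "pressure X f = ereal prs"
  and Z_tendsto: "(\<lambda>m. ln (Z X m) / real m) \<longlonglongrightarrow> prs"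
  and prs_le: "m \<ge> 1 \<Longrightarrow> prs \<le> ln (Z X m) / real m"
proof -
  obtain L where L: "pressure X f = ereal L" "(\<lambda>m. ln (Z X m) / real m) \<longlonglongrightarrow> L"
    "\<And>m. m \<ge> 1 \<Longrightarrow> L \<le> ln (Z X m) / real m"
    using pressure_props[OF X_inv order_refl nonempty] by metis
  have "prs = L" unfolding prs_def by (rule limI[OF L(2)])
  then show "pressure X f = ereal prs" "(\<lambda>m. ln (Z X m) / real m) \<longlonglongrightarrow> prs"
    "m \<ge> 1 \<Longrightarrow> prs \<le> ln (Z X m) / real m" using L by auto
qed

lemma CD_ge1: "CD \<ge> 1" and CZ_ge1: "CZ \<ge> 1"
proof -
  show 1: "CD \<ge> 1" unfolding CD_def using B_nonneg V_nonneg by simp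
  have "CD \<le> CZ" unfolding CZ_def using 1 by (simp add: mult_le_cancel_left1)
  with 1 show "CZ \<ge> 1" by simp
qed

lemma Z_0: "Z X 0 = 1"
proof -
  have "lang X 0 = {[]}" using nonempty by (auto simp: lang_def word_def)
  moreover have "Smf X f [] = 0" using Smf_abs_le[OF X_inv order_refl, of "[]" 0] calculation by auto
  ultimately show ?thesis by (simp add: Z_def)
qed

lemma Z_lower: "exp (prs * real m) \<le> Z X m"
proof (cases "m = 0")
  case False
  then have "prs * real m \<le> ln (Z X m)" using prs_le[of m] by (simp add: field_simps)
  then show ?thesis using Z_pos[OF nonempty, of m] by (simp add: ln_ge_iff)
qed (simp add: Z_0)

lemma glue_words:
  assumes "u \<in> lang X m" "v \<in> lang X n"
  obtains g where "length g = G" "u @ g @ v \<in> lang X (m + G + n)"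
    "Smf X f u + Smf X f v \<le> Smf X f (u @ g @ v) + ln CD"
proof -
  obtain x where x: "x \<in> X" "word x 0 m = u" using lang_obtain[OF X_inv assms(1)] .
  obtain y where y: "y \<in> X" "word y 0 n = v" using lang_obtain[OF X_inv assms(2)] .
  obtain z where z: "z \<in> X" "\<And>i. i < 0 \<Longrightarrow> z i = x (i + int m)" "\<And>i. i \<ge> 0 \<Longrightarrow> z (i + int G) = y i"
    using glue[OF X_translate[OF x(1), of "int m"] y(1)] by auto
  define w where "w = (\<lambda>i. z (i - int m))"
  have w: "w \<in> X" unfolding w_def using X_translate[OF z(1), of "- int m"] by simp
  have w1: "word w 0 m = u" unfolding x(2)[symmetric] word_eq_iff w_def using z(2)
    by auto
  have w2: "word w (int m + int G) n = v" unfolding y(2)[symmetric] word_eq_iff w_def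
    using z(3) by (auto simp: algebra_simps)
  define g where "g = word w (int m) G"
  have ww: "word w 0 (m + G + n) = u @ g @ v"
    unfolding word_add using w1 w2 by (simp add: g_def)
  have "Smf X f u \<le> birkhoff f m w + V" using Smf_le_birkhoff[OF w w1] .
  moreover have "Smf X f v \<le> birkhoff f n (\<lambda>i. w (i + int (m + G))) + V"
    by (rule Smf_le_birkhoff[OF X_translate[OF w]]) (use w2 in \<open>simp add: word_translate\<close>)
  moreover have "- (B * real G) \<le> birkhoff f G (\<lambda>i. w (i + int m))"
    using birkhoff_bound[OF X_translate[OF w], of G "int m"] by (simp add: abs_le_iff)
  moreover have "birkhoff f (m + G + n) w \<le> Smf X f (u @ g @ v)"
    by (rule le_Smf[OF order_refl w ww])
  ultimately have "Smf X f u + Smf X f v \<le> Smf X f (u @ g @ v) + ln CD"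
    unfolding birkhoff_add by (simp add: CD_def algebra_simps)
  moreover have "u @ g @ v \<in> lang X (m + G + n)" using word_in_lang[OF w, of 0 "m + G + n"] by (simp add: ww)
  ultimately show ?thesis using that[of g] by (simp add: g_def)
qed

text \<open>Up to the factor \<open>Z X M\<close> this is the mass of the cylinder of \<open>v\<close> under the finite Gibbs measure on
  words of length \<open>M\<close>. Its two-sided bounds take the place of an infinite-volume Gibbs measure.\<close>
definition tree :: "nat \<Rightarrow> 'a list \<Rightarrow> real" where
  "tree M v = (\<Sum>w\<in>{w\<in>lang X M. take (length v) w = v}. exp (Smf X f w))"

lemma tree_nonneg: "tree M v \<ge> 0"
  unfolding tree_def by (intro sum_nonneg) auto

lemma tree_Nil: "tree M [] = Z X M"
  by (simp add: tree_def Z_def)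

lemma tree_eq_0:
  assumes "length v \<le> M" "v \<notin> lang X (length v)"
  shows "tree M v = 0"
proof -
  have "{w\<in>lang X M. take (length v) w = v} = {}"
    using take_in_lang[of _ X M "length v"] assms by (metis (mono_tags, lifting) empty_Collect_eq)
  then show ?thesis unfolding tree_def by (simp only: sum.empty)
qed

text \<open>Each word u of length r extends v after a filler. The filler depends on u, but its
  length does not, so u can be read off from the result and no extension is counted twice.\<close>

lemma tree_ge:
  assumes "v \<in> lang X (length v)" "length v + G + r = M"
  shows "exp (Smf X f v) * Z X r \<le> CD * tree M v"
proof -
  have "\<exists>g. length g = G \<and> v @ g @ u \<in> lang X M \<and> Smf X f v + Smf X f u \<le> Smf X f (v @ g @ u) + ln CD"
    if "u \<in> lang X r" for u
    using glue_words[OF assms(1) that] assms(2) by (metis (no_types))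
  then obtain g where g: "\<And>u. u \<in> lang X r \<Longrightarrow> length (g u) = G"
    "\<And>u. u \<in> lang X r \<Longrightarrow> v @ g u @ u \<in> lang X M"
    "\<And>u. u \<in> lang X r \<Longrightarrow> Smf X f v + Smf X f u \<le> Smf X f (v @ g u @ u) + ln CD"
    by metis
  have inj: "inj_on (\<lambda>u. v @ g u @ u) (lang X r)"
  proof (rule inj_onI)
    fix a b assume ab: "a \<in> lang X r" "b \<in> lang X r" "v @ g a @ a = v @ g b @ b"
    then show "a = b" using g(1)[OF ab(1)] g(1)[OF ab(2)] by simp
  qed
  have "exp (Smf X f v) * Z X r = (\<Sum>u\<in>lang X r. exp (Smf X f v + Smf X f u))"
    by (simp add: Z_def sum_distrib_left exp_add)
  also have "\<dots> \<le> (\<Sum>u\<in>lang X r. CD * exp (Smf X f (v @ g u @ u)))"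
  proof (rule sum_mono)
    fix u assume u: "u \<in> lang X r"
    have "CD * exp (Smf X f (v @ g u @ u)) = exp (Smf X f (v @ g u @ u) + ln CD)"
      using CD_ge1 by (simp add: exp_add)
    then show "exp (Smf X f v + Smf X f u) \<le> CD * exp (Smf X f (v @ g u @ u))"
      using g(3)[OF u] by simp
  qed
  also have "\<dots> = CD * (\<Sum>w\<in>(\<lambda>u. v @ g u @ u) ` lang X r. exp (Smf X f w))"
    by (simp add: sum.reindex[OF inj] sum_distrib_left)
  also have "\<dots> \<le> CD * tree M v"
    unfolding tree_def using CD_ge1 g(2)
    by (intro mult_left_mono sum_mono2) auto
  finally show ?thesis .
qed

lemma tree_le:
  assumes "length v + r = M"
  shows "tree M v \<le> exp (Smf X f v) * Z X r"
proof -
  let ?S = "{w\<in>lang X M. take (length v) w = v}"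
  have inj: "inj_on (drop (length v)) ?S"
    by (rule inj_onI) (metis (mono_tags, lifting) append_take_drop_id mem_Collect_eq)
  have "tree M v \<le> (\<Sum>w\<in>?S. exp (Smf X f v) * exp (Smf X f (drop (length v) w)))"
    unfolding tree_def
  proof (rule sum_mono)
    fix w assume w: "w \<in> ?S"
    then have "v @ drop (length v) w = w" by (metis (mono_tags, lifting) append_take_drop_id mem_Collect_eq)
    then have "Smf X f w \<le> Smf X f v + Smf X f (drop (length v) w)"
      using Smf_append_le[OF X_inv order_refl, of v "drop (length v) w" M] w by auto
    then show "exp (Smf X f w) \<le> exp (Smf X f v) * exp (Smf X f (drop (length v) w))"
      by (simp add: exp_add[symmetric])
  qed
  also have "\<dots> = exp (Smf X f v) * (\<Sum>u\<in>drop (length v) ` ?S. exp (Smf X f u))"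
    by (simp add: sum.reindex[OF inj] sum_distrib_left)
  also have "\<dots> \<le> exp (Smf X f v) * Z X r"
    unfolding Z_def using assms drop_in_lang[of _ X M "length v"]
    by (intro mult_left_mono sum_mono2) auto
  finally show ?thesis .
qed

lemma Z_supermult: "Z X m * Z X n \<le> CD * Z X (m + G + n)"
proof -
  have "Z X m * Z X n \<le> (\<Sum>v\<in>lang X m. CD * tree (m + G + n) v)"
    unfolding Z_def[of X m] sum_distrib_right
    by (intro sum_mono tree_ge) (auto dest: lang_length)
  also have "\<dots> = CD * (\<Sum>v\<in>lang X m. \<Sum>w\<in>{w\<in>lang X (m + G + n). take m w = v}. exp (Smf X f w))"
    unfolding sum_distrib_left[symmetric] tree_def
    by (intro arg_cong[of _ _ "(*) CD"] sum.cong) (auto dest: lang_length)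
  also have "\<dots> = CD * Z X (m + G + n)"
    unfolding Z_def by (subst sum.group) (auto intro: take_in_lang)
  finally show ?thesis .
qed

lemma Z_power: "Z X m ^ q \<le> CD ^ q * Z X (q * (m + G))"
proof (induction q)
  case (Suc q)
  have "Z X m ^ Suc q \<le> Z X m * (CD ^ q * Z X (q * (m + G)))"
    using Suc Z_pos[OF nonempty, of m] by (simp add: mult_left_mono)
  also have "\<dots> = CD ^ q * (Z X m * Z X (q * (m + G)))" by simp
  also have "\<dots> \<le> CD ^ q * (CD * Z X (m + G + q * (m + G)))"
    using CD_ge1 by (intro mult_left_mono Z_supermult) auto
  finally show ?case by (simp add: algebra_simps)
qed (simp add: Z_0)

text \<open>Gluing q copies compares the q-th power of \<open>Z X m\<close> with the partition
  function of length q (m + G). After taking logarithms and dividing by q, the limit along these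
  lengths replaces the latter by the pressure, at a cost that does not depend on m.\<close>

lemma Z_upper: "Z X m \<le> CZ * exp (prs * real m)"
proof (cases "m + G = 0")
  case True
  then show ?thesis using Z_0 CZ_ge1 by simp
next
  case False
  have pos: "Z X k > 0" for k by (rule Z_pos[OF nonempty])
  define s where "s = (\<lambda>q::nat. q * (m + G))"
  have "strict_mono s" unfolding s_def using False by (intro strict_monoI) simp
  then have lim: "(\<lambda>q. ln (Z X (s q)) / real (s q)) \<longlonglongrightarrow> prs"
    using LIMSEQ_subseq_LIMSEQ[OF Z_tendsto, of s] by (simp add: o_def)
  have "ln (Z X m) \<le> ln CD + real (m + G) * (ln (Z X (s q)) / real (s q))" if q: "q \<ge> 1" for q
  proof -
    have "ln (Z X m ^ q) \<le> ln (CD ^ q * Z X (s q))"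
      using Z_power[of m q] pos CD_ge1 by (subst ln_le_cancel_iff) (auto simp: s_def)
    then have "real q * ln (Z X m) \<le> real q * ln CD + ln (Z X (s q))"
      using pos CD_ge1 by (simp add: ln_mult_pos ln_realpow)
    moreover have "ln (Z X (s q)) = real q * (real (m + G) * (ln (Z X (s q)) / real (s q)))"
    proof -
      have "real (s q) = real q * real (m + G)" "real (s q) \<noteq> 0" using q False by (auto simp: s_def)
      then show ?thesis by (simp add: mult.assoc[symmetric])
    qed
    ultimately have "real q * ln (Z X m) \<le> real q * (ln CD + real (m + G) * (ln (Z X (s q)) / real (s q)))"
      by (simp add: algebra_simps)
    then show ?thesis using q by simp
  qed
  then have "ln (Z X m) \<le> ln CD + real (m + G) * prs"
    by (intro tendsto_lowerbound[OF tendsto_add[OF tendsto_const tendsto_mult[OF tendsto_const lim]]])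
      (auto intro!: eventually_sequentiallyI[of 1])
  also have "\<dots> \<le> ln CZ + prs * real m"
    unfolding CZ_def using CD_ge1 mult_right_mono[OF abs_ge_self[of prs], of "real G"]
    by (simp add: ln_mult_pos algebra_simps)
  finally have "ln (Z X m) \<le> ln (CZ * exp (prs * real m))" using CZ_ge1 by (simp add: ln_mult_pos)
  then show ?thesis using pos[of m] CZ_ge1 by (subst (asm) ln_le_cancel_iff) auto
qed

lemma exp_Smf_le:
  assumes "u \<in> lang X m"
  shows "exp (Smf X f u) \<le> CZ * exp (prs * real m)"
proof -
  have "exp (Smf X f u) \<le> Z X m" unfolding Z_def using assms by (intro member_le_sum) auto
  then show ?thesis using Z_upper[of m] by simp
qed

lemma tree_upper:
  assumes "length v + r = M"
  shows "tree M v \<le> CZ * exp (Smf X f v + prs * real r)"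
proof -
  have "tree M v \<le> exp (Smf X f v) * (CZ * exp (prs * real r))"
    using tree_le[OF assms] by (rule order_trans) (intro mult_left_mono Z_upper, simp)
  then show ?thesis by (simp add: exp_add mult_ac)
qed

lemma tree_lower:
  assumes "v \<in> lang X (length v)" "length v + r = M"
  shows "exp (Smf X f v + prs * real r) \<le> CZ * tree M v"
proof (cases "r \<ge> G")
  case True
  have "exp (Smf X f v + prs * real r) = exp (Smf X f v) * exp (prs * real (r - G)) * exp (prs * real G)"
    unfolding exp_add[symmetric] using True by (simp add: algebra_simps of_nat_diff)
  also have "\<dots> \<le> exp (Smf X f v) * Z X (r - G) * exp (\<bar>prs\<bar> * real G)"
    by (intro mult_mono mult_left_mono Z_lower) (auto simp: mult_right_mono less_imp_le[OF Z_pos[OF nonempty]])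
  also have "\<dots> \<le> CD * tree M v * exp (\<bar>prs\<bar> * real G)"
    using True assms by (intro mult_right_mono tree_ge) auto
  finally show ?thesis by (simp add: CZ_def mult_ac)
next
  case False
  \<comment> \<open>There is no room for a gap of length G. One extension of v inside a point
    suffices, since fewer than G further letters change the weight by a bounded factor.\<close>
  obtain x where x: "x \<in> X" "word x 0 (length v) = v" using lang_obtain[OF X_inv assms(1)] .
  define w where "w = word x 0 M"
  have w: "w \<in> lang X M" "take (length v) w = v" using x assms(2) by (auto simp: w_def take_word)
  have "Smf X f v \<le> birkhoff f (length v) x + V" by (rule Smf_le_birkhoff[OF x])
  moreover have "birkhoff f (length v) x = birkhoff f M x - birkhoff f r (\<lambda>i. x (i + int (length v)))"
    unfolding assms(2)[symmetric] birkhoff_add by simp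
  moreover have "- (B * real r) \<le> birkhoff f r (\<lambda>i. x (i + int (length v)))"
    using birkhoff_bound[OF X_translate[OF x(1)], of r "int (length v)"] by (simp add: abs_le_iff)
  moreover have "B * real r \<le> B * real G" using False B_nonneg by (intro mult_left_mono) auto
  moreover have "birkhoff f M x \<le> Smf X f w" by (rule le_Smf[OF order_refl x(1)]) (simp add: w_def)
  ultimately have "Smf X f v \<le> Smf X f w + V + B * real G" by linarith
  moreover have "prs * real r \<le> \<bar>prs\<bar> * real G" using False by (intro mult_mono) auto
  ultimately have "exp (Smf X f v + prs * real r) \<le> exp ((2 * V + B * real G) + \<bar>prs\<bar> * real G + Smf X f w)"
    using V_nonneg by simp
  also have "\<dots> = CZ * exp (Smf X f w)" by (simp add: CZ_def CD_def exp_add)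
  also have "\<dots> \<le> CZ * tree M v" unfolding tree_def using w CZ_ge1
    by (intro mult_left_mono member_le_sum) auto
  finally show ?thesis .
qed

text \<open>The conditional form of the upper Gibbs bound, uniform in the prefix: both masses are
  compared with exponentials of \<open>Smf\<close>, once by \<open>tree_upper\<close> and once by
  \<open>tree_lower\<close>, whence the square.\<close>

lemma tree_append_le:
  assumes "length v + length u \<le> M"
  shows "tree M (v @ u) \<le> CZ\<^sup>2 * exp (Smf X f u - prs * real (length u)) * tree M v"
proof (cases "v @ u \<in> lang X (length (v @ u))")
  case True
  obtain r where r: "length v + length u + r = M" using assms by (metis le_Suc_ex)
  have v: "v \<in> lang X (length v)" using lang_appendD(1)[OF True] .
  have "tree M (v @ u) \<le> CZ * exp (Smf X f (v @ u) + prs * real r)"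
    using r by (intro tree_upper) auto
  also have "\<dots> \<le> CZ * exp (Smf X f v + Smf X f u + prs * real r)"
    using Smf_append_le[OF X_inv order_refl True] CZ_ge1 by simp
  also have "\<dots> = CZ * exp (Smf X f u - prs * real (length u)) * exp (Smf X f v + prs * real (length u + r))"
    unfolding mult.assoc exp_add[symmetric] by (simp add: algebra_simps)
  also have "\<dots> \<le> CZ * exp (Smf X f u - prs * real (length u)) * (CZ * tree M v)"
    using CZ_ge1 r v by (intro mult_left_mono tree_lower) auto
  finally show ?thesis by (simp add: power2_eq_square mult_ac)
next
  case False
  then show ?thesis using assms tree_eq_0[OF _ False, of M] tree_nonneg[of M v] by simp
qed

text \<open>After a gap every admissible word can follow every prefix. The three factors
  \<open>CZ\<close> are paid to \<open>tree_upper\<close>, to the gluing and to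
  \<open>tree_lower\<close>.\<close>

lemma tree_append_ge:
  assumes "v \<in> lang X (length v)" "u \<in> lang X m" "length v + G + m \<le> M"
  obtains g where "length g = G"
    "exp (Smf X f u - prs * real m) * tree M v \<le> CZ ^ 3 * tree M (v @ g @ u)"
proof -
  obtain r where r: "length v + G + m + r = M" using assms by (metis le_Suc_ex)
  obtain g where g: "length g = G" "v @ g @ u \<in> lang X (length v + G + m)"
    "Smf X f v + Smf X f u \<le> Smf X f (v @ g @ u) + ln CD"
    using glue_words[OF assms(1,2)] .
  have m: "length u = m" using assms(2) lang_length by auto
  have g2: "v @ g @ u \<in> lang X (length (v @ g @ u))" using g(1,2) m by (simp add: add.assoc)
  have "exp (Smf X f u - prs * real m) * tree M v
      \<le> exp (Smf X f u - prs * real m) * (CZ * exp (Smf X f v + prs * real (G + m + r)))"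
    using r by (intro mult_left_mono tree_upper) auto
  also have "\<dots> = CZ * exp (Smf X f v + Smf X f u + prs * real G + prs * real r)"
    by (simp add: exp_add exp_diff algebra_simps)
  also have "\<dots> \<le> CZ * exp (Smf X f (v @ g @ u) + ln CD + \<bar>prs\<bar> * real G + prs * real r)"
    using g(3) CZ_ge1 mult_right_mono[OF abs_ge_self[of prs], of "real G"] by simp
  also have "\<dots> = CZ * CZ * exp (Smf X f (v @ g @ u) + prs * real r)"
    using CD_ge1 by (simp add: CZ_def exp_add)
  also have "\<dots> \<le> CZ * CZ * (CZ * tree M (v @ g @ u))"
    using CZ_ge1 g(1) r m by (intro mult_left_mono tree_lower g2) auto
  finally show ?thesis using that[of g] g(1) by (simp add: power3_eq_cube mult_ac)
qed

lemma tree_group: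
  assumes "length v \<le> k" "k \<le> M"
  shows "(\<Sum>v'\<in>{v'. length v' = k \<and> take (length v) v' = v}. tree M v') = tree M v"
proof -
  let ?T = "{v'. length v' = k \<and> take (length v) v' = v}"
  let ?S = "{w\<in>lang X M. take (length v) w = v}"
  have fin: "finite ?T" by (rule finite_subset[OF _ finite_words[of k]]) auto
  have sub: "take k ` ?S \<subseteq> ?T" using assms by (auto dest: lang_length simp: min_def)
  have "tree M v = (\<Sum>v'\<in>?T. \<Sum>w\<in>{w\<in>?S. take k w = v'}. exp (Smf X f w))"
    unfolding tree_def by (rule sum.group[symmetric]) (use fin sub in auto)
  also have "\<dots> = (\<Sum>v'\<in>?T. tree M v')"
  proof (rule sum.cong[OF refl])
    fix v' assume v': "v' \<in> ?T"
    have "take (length v) w = v" if "take k w = v'" for w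
      using v' assms that by (metis (mono_tags, lifting) mem_Collect_eq min.absorb1 take_take)
    then have "{w\<in>?S. take k w = v'} = {w\<in>lang X M. take (length v') w = v'}"
      using v' by auto
    then show "(\<Sum>w\<in>{w\<in>?S. take k w = v'}. exp (Smf X f w)) = tree M v'" by (simp add: tree_def)
  qed
  finally show ?thesis ..
qed

text \<open>The weight of the perturbed potential that penalises each occurrence of \<open>u\<close> at the end of a
  block decays geometrically, because inserting \<open>u\<close> behind any prefix costs only a constant.\<close>
lemma penalised_sum:
  assumes u: "u \<in> lang X m"
  defines "b \<equiv> G + m"
  defines "q \<equiv> (1 - exp (-1)) * exp (Smf X f u - prs * real m) / CZ ^ 3"
  defines "occ \<equiv> \<lambda>j w. take m (drop (j * b + G) w) = u"
  shows "(\<Sum>w\<in>lang X (k * b). exp (Smf X f w - real (card {j. j < k \<and> occ j w})))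
    \<le> Z X (k * b) * (1 - q) ^ k" and "q \<le> 1"
proof -
  define p where "p = exp (Smf X f u - prs * real m)"
  \<comment> \<open>A unit penalty multiplies the weight by exp (-1), so \<open>s\<close> is the
    fraction lost at an occurrence.\<close>
  define s :: real where "s = 1 - exp (-1)"
  have s: "0 \<le> s" "s \<le> 1" by (auto simp: s_def)
  have cz0: "CZ > 0" using CZ_ge1 by linarith
  have pq: "q = s * (p / CZ ^ 3)" by (simp add: q_def s_def p_def)
  have m: "length u = m" using u lang_length by auto
  have pCZ: "p / CZ ^ 3 \<le> 1"
  proof -
    have "p \<le> CZ" using exp_Smf_le[OF u] by (simp add: p_def exp_diff divide_le_eq)
    also have "\<dots> \<le> CZ ^ 3" using CZ_ge1 by (simp add: self_le_power)
    finally show ?thesis using cz0 by simp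
  qed
  show q1: "q \<le> 1" unfolding pq
    using mult_mono[OF s(2) pCZ] s by (simp add: p_def cz0 less_imp_le)
  define M where "M = k * b"
  \<comment> \<open>Only blocks from number i on are penalised. The prefix of length i * b then
    carries the plain mass \<open>tree M v\<close>, and the induction on k - i peels off one block
    at a time.\<close>
  define F where "F = (\<lambda>i w. exp (Smf X f w) * exp (- real (card {j. i \<le> j \<and> j < k \<and> occ j w})))"
  have main: "(\<Sum>w\<in>{w\<in>lang X M. take (length v) w = v}. F i w) \<le> tree M v * (1 - q) ^ (k - i)"
    if "i \<le> k" "length v = i * b" for i v
    using that
  proof (induction "k - i" arbitrary: i v)
    case 0
    then have "i = k" by simp
    moreover have "{j. k \<le> j \<and> j < k \<and> occ j w} = {}" for w by auto
    ultimately show ?case unfolding F_def tree_def by (auto intro!: sum_mono)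
  next
    case (Suc d)
    then have ik: "i < k" by simp
    have bM: "Suc i * b \<le> M" unfolding M_def using ik by (intro mult_right_mono) auto
    let ?S = "{w\<in>lang X M. take (length v) w = v}"
    let ?T = "{v'. length v' = Suc i * b \<and> take (length v) v' = v}"
    have fin: "finite ?T" by (rule finite_subset[OF _ finite_words[of "Suc i * b"]]) auto
    have sub: "take (Suc i * b) ` ?S \<subseteq> ?T" using bM Suc by (auto dest: lang_length simp: min_def)
    have lv: "length v = i * b" by (rule Suc)
    have occ_take: "occ i w \<longleftrightarrow> occ i (take (Suc i * b) w)" for w
      unfolding occ_def by (simp add: drop_take b_def)
    have inner: "(\<Sum>w\<in>{w\<in>?S. take (Suc i * b) w = v'}. F i w)
        \<le> (1 - s * of_bool (occ i v')) * (tree M v' * (1 - q) ^ (k - Suc i))" if v': "v' \<in> ?T" for v'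
    proof -
      have eq: "{w\<in>?S. take (Suc i * b) w = v'} = {w\<in>lang X M. take (length v') w = v'}"
      proof -
        have "take (length v) w = v" if "take (Suc i * b) w = v'" for w
          using v' lv that by (metis (mono_tags, lifting) le_add2 mem_Collect_eq min.absorb1 mult_Suc take_take)
        then show ?thesis using v' by auto
      qed
      have "F i w = (1 - s * of_bool (occ i v')) * F (Suc i) w"
        if w: "w \<in> {w\<in>lang X M. take (length v') w = v'}" for w
      proof -
        have "take (Suc i * b) w = v'" using w v' by auto
        then have o: "occ i w \<longleftrightarrow> occ i v'" using occ_take[of w] by simp
        show ?thesis
        proof (cases "occ i v'")
          case True
          have "{j. i \<le> j \<and> j < k \<and> occ j w} = insert i {j. Suc i \<le> j \<and> j < k \<and> occ j w}"
            using o True ik by (auto simp: le_less Suc_le_eq)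
          then have "card {j. i \<le> j \<and> j < k \<and> occ j w} = Suc (card {j. Suc i \<le> j \<and> j < k \<and> occ j w})"
            by simp
          then show ?thesis using True by (simp add: F_def s_def exp_add[symmetric])
        next
          case False
          have "{j. i \<le> j \<and> j < k \<and> occ j w} = {j. Suc i \<le> j \<and> j < k \<and> occ j w}"
            using o False by (auto simp: le_less Suc_le_eq)
          then show ?thesis using False by (simp add: F_def)
        qed
      qed
      then have "(\<Sum>w\<in>{w\<in>?S. take (Suc i * b) w = v'}. F i w)
          = (1 - s * of_bool (occ i v')) * (\<Sum>w\<in>{w\<in>lang X M. take (length v') w = v'}. F (Suc i) w)"
        unfolding eq sum_distrib_left by (intro sum.cong) auto
      also have "\<dots> \<le> (1 - s * of_bool (occ i v')) * (tree M v' * (1 - q) ^ (k - Suc i))"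
        using s v' ik Suc(2) by (intro mult_left_mono Suc(1)) (auto simp: of_bool_def)
      finally show ?thesis .
    qed
    have "(\<Sum>w\<in>?S. F i w) = (\<Sum>v'\<in>?T. \<Sum>w\<in>{w\<in>?S. take (Suc i * b) w = v'}. F i w)"
      by (rule sum.group[symmetric]) (use fin sub in auto)
    also have "\<dots> \<le> (\<Sum>v'\<in>?T. (1 - s * of_bool (occ i v')) * (tree M v' * (1 - q) ^ (k - Suc i)))"
      by (intro sum_mono inner)
    also have "\<dots> = (\<Sum>v'\<in>?T. tree M v' - s * (of_bool (occ i v') * tree M v')) * (1 - q) ^ (k - Suc i)"
      unfolding sum_distrib_right by (intro sum.cong) (auto simp: algebra_simps)
    also have "\<dots> = (tree M v - s * (\<Sum>v'\<in>?T. of_bool (occ i v') * tree M v')) * (1 - q) ^ (k - Suc i)"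
      unfolding sum_subtractf sum_distrib_left[symmetric] using tree_group[of v "Suc i * b" M] bM lv by simp
    also have "\<dots> \<le> (tree M v - q * tree M v) * (1 - q) ^ (k - Suc i)"
    proof -
      \<comment> \<open>Among the continuations of v by one block, the single one
        \<open>v @ g @ u\<close> already carries the required share of the mass.\<close>
      have "p / CZ ^ 3 * tree M v \<le> (\<Sum>v'\<in>?T. of_bool (occ i v') * tree M v')"
      proof (cases "v \<in> lang X (length v)")
        case False
        then have "tree M v = 0" using bM lv by (intro tree_eq_0) auto
        then show ?thesis using tree_nonneg by (auto intro!: sum_nonneg)
      next
        case True
        obtain g where g: "length g = G" "p * tree M v \<le> CZ ^ 3 * tree M (v @ g @ u)"
          unfolding p_def using tree_append_ge[OF True u, of M] bM lv by (auto simp: b_def)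
        have "p / CZ ^ 3 * tree M v \<le> of_bool (occ i (v @ g @ u)) * tree M (v @ g @ u)"
          using g cz0 lv m by (simp add: occ_def field_simps)
        also have "\<dots> \<le> (\<Sum>v'\<in>?T. of_bool (occ i v') * tree M v')"
          using fin g lv m tree_nonneg by (intro member_le_sum) (auto simp: b_def)
        finally show ?thesis .
      qed
      then have "q * tree M v \<le> s * (\<Sum>v'\<in>?T. of_bool (occ i v') * tree M v')"
        unfolding pq using s mult_left_mono by (fastforce simp: mult.assoc)
      then show ?thesis using q1 by (intro mult_right_mono) auto
    qed
    also have "\<dots> = tree M v * (1 - q) ^ (k - i)"
    proof -
      have "k - i = Suc (k - Suc i)" using ik by simp
      then show ?thesis by (simp add: algebra_simps)
    qed
    finally show ?case .
  qed
  have F0: "F 0 w = exp (Smf X f w - real (card {j. j < k \<and> occ j w}))" for w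
    by (simp add: F_def exp_diff exp_minus field_simps)
  show "(\<Sum>w\<in>lang X (k * b). exp (Smf X f w - real (card {j. j < k \<and> occ j w})))
      \<le> Z X (k * b) * (1 - q) ^ k"
    using main[of 0 "[]"] by (simp add: tree_Nil F0 M_def)
qed

end

section \<open>Entropy of finite partitions\<close>

lemma sum_lists_prod:
  fixes h :: "nat \<Rightarrow> 'b \<Rightarrow> real"
  assumes "finite S"
  shows "(\<Sum>z\<in>{z. set z \<subseteq> S \<and> length z = n}. \<Prod>i<n. h i (z ! i)) = (\<Prod>i<n. \<Sum>b\<in>S. h i b)"
proof (induction n)
  case (Suc n)
  let ?L = "\<lambda>n. {z. set z \<subseteq> S \<and> length z = n}"
  have bij: "bij_betw (\<lambda>(z, b). z @ [b]) (?L n \<times> S) (?L (Suc n))"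
    unfolding bij_betw_def
  proof
    show "inj_on (\<lambda>(z, b). z @ [b]) (?L n \<times> S)" by (auto simp: inj_on_def)
    show "(\<lambda>(z, b). z @ [b]) ` (?L n \<times> S) = ?L (Suc n)"
    proof
      show "?L (Suc n) \<subseteq> (\<lambda>(z, b). z @ [b]) ` (?L n \<times> S)"
      proof
        fix z assume z: "z \<in> ?L (Suc n)"
        then obtain y b where "z = y @ [b]" by (cases z rule: rev_cases) auto
        with z show "z \<in> (\<lambda>(z, b). z @ [b]) ` (?L n \<times> S)" by force
      qed
    qed auto
  qed
  have "(\<Sum>z\<in>?L (Suc n). \<Prod>i<Suc n. h i (z ! i))
      = (\<Sum>(z, b)\<in>?L n \<times> S. \<Prod>i<Suc n. h i ((z @ [b]) ! i))"
    by (subst sum.reindex_bij_betw[OF bij, symmetric]) (simp add: case_prod_beta)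
  also have "\<dots> = (\<Sum>(z, b)\<in>?L n \<times> S. (\<Prod>i<n. h i (z ! i)) * h n b)"
    by (intro sum.cong) (auto simp: nth_append intro!: prod.cong)
  also have "\<dots> = (\<Prod>i<Suc n. \<Sum>b\<in>S. h i b)"
    by (simp add: sum.cartesian_product[symmetric] Suc[symmetric] sum_product)
  finally show ?case .
next
  case 0
  have "{z. set z \<subseteq> S \<and> length z = 0} = {[]}" by auto
  then show ?case by simp
qed

section \<open>Random variables with finitely many values\<close>

context prob_space
begin

text \<open>Measurable fibres are demanded instead of measurability into some sigma-algebra, so that
  words, lists of words and pairs can be values without further structure.\<close>

definition finite_rv :: "('a \<Rightarrow> 'b) \<Rightarrow> bool" where
  "finite_rv Q \<longleftrightarrow> finite (Q ` space M) \<and> (\<forall>v. {x\<in>space M. Q x = v} \<in> events)"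

definition pr :: "('a \<Rightarrow> 'b) \<Rightarrow> 'b \<Rightarrow> real" where
  "pr Q v = prob {x\<in>space M. Q x = v}"

lemma finite_rv_sets:
  assumes "finite_rv Q"
  shows "{x\<in>space M. P (Q x)} \<in> events"
proof -
  have "{x\<in>space M. P (Q x)} = (\<Union>v\<in>{v\<in>Q ` space M. P v}. {x\<in>space M. Q x = v})" by auto
  also have "\<dots> \<in> events" using assms by (intro sets.finite_UN) (auto simp: finite_rv_def)
  finally show ?thesis .
qed

lemma finite_rv_compose: "finite_rv Q \<Longrightarrow> finite_rv (\<lambda>x. g (Q x))"
  using finite_rv_sets[of Q "\<lambda>v. g v = w" for w] finite_imageI[of "Q ` space M" g]
  by (simp add: finite_rv_def image_image)

lemma finite_rv_pair:
  assumes "finite_rv Q" "finite_rv R"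
  shows "finite_rv (\<lambda>x. (Q x, R x))"
  unfolding finite_rv_def
proof
  have "(\<lambda>x. (Q x, R x)) ` space M \<subseteq> Q ` space M \<times> R ` space M" by auto
  then show "finite ((\<lambda>x. (Q x, R x)) ` space M)"
    using assms finite_subset unfolding finite_rv_def by blast
  have eq: "{x\<in>space M. (Q x, R x) = v} = {x\<in>space M. Q x = fst v} \<inter> {x\<in>space M. R x = snd v}" for v
    by auto
  show "\<forall>v. {x\<in>space M. (Q x, R x) = v} \<in> events"
    unfolding eq using assms by (intro allI sets.Int) (auto simp: finite_rv_def)
qed

lemma finite_rv_integral:
  fixes g :: "'b \<Rightarrow> real"
  assumes Q: "finite_rv Q"
  shows "integrable M (\<lambda>x. g (Q x))"
    and "(\<integral>x. g (Q x) \<partial>M) = (\<Sum>v\<in>Q ` space M. pr Q v * g v)"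
proof -
  let ?h = "\<lambda>x. \<Sum>v\<in>Q ` space M. g v * indicator {x\<in>space M. Q x = v} x"
  have fin: "finite (Q ` space M)" and ev: "{x\<in>space M. Q x = v} \<in> events" for v
    using Q by (auto simp: finite_rv_def)
  have eq: "g (Q x) = ?h x" if "x \<in> space M" for x
  proof -
    have "?h x = (\<Sum>v\<in>Q ` space M. if v = Q x then g v else 0)"
      using that by (intro sum.cong) (auto simp: indicator_def)
    then show ?thesis using fin that by simp
  qed
  have int: "integrable M (\<lambda>x. g v * indicator {x\<in>space M. Q x = v} x)" for v
    using ev[of v] by (intro integrable_mult_right integrable_real_indicator) (auto simp: less_top[symmetric])
  have "integrable M ?h" using int by (intro Bochner_Integration.integrable_sum) auto
  then show "integrable M (\<lambda>x. g (Q x))"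
    using eq by (subst Bochner_Integration.integrable_cong) auto
  have "(\<integral>x. g (Q x) \<partial>M) = (\<integral>x. ?h x \<partial>M)" using eq by (intro Bochner_Integration.integral_cong) auto
  also have "\<dots> = (\<Sum>v\<in>Q ` space M. g v * pr Q v)"
    using int ev by (subst Bochner_Integration.integral_sum) (auto simp: pr_def)
  finally show "(\<integral>x. g (Q x) \<partial>M) = (\<Sum>v\<in>Q ` space M. pr Q v * g v)" by (simp add: mult.commute)
qed

lemma pr_nonneg [simp]: "pr Q v \<ge> 0"
  by (simp add: pr_def)

lemma pr_sum:
  assumes "finite_rv Q"
  shows "(\<Sum>v\<in>Q ` space M. pr Q v) = 1"
  using finite_rv_integral(2)[OF assms, of "\<lambda>_. 1"] by (simp add: prob_space)

lemma pr_mono: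
  assumes "finite_rv R"
  shows "pr R (R x) \<le> pr (\<lambda>x. g (R x)) (g (R x))"
  unfolding pr_def using finite_rv_sets[OF assms, of "\<lambda>v. g v = g (R x)"]
  by (intro finite_measure_mono) auto

lemma AE_pr_pos:
  assumes Q: "finite_rv Q"
  shows "AE x in M. pr Q (Q x) > 0"
proof -
  let ?N = "{x\<in>space M. pr Q (Q x) = 0}"
  have "?N = (\<Union>v\<in>{v\<in>Q ` space M. pr Q v = 0}. {x\<in>space M. Q x = v})" by auto
  moreover have "{x\<in>space M. Q x = v} \<in> null_sets M" if "pr Q v = 0" for v
    using Q that by (auto simp: finite_rv_def pr_def null_sets_def emeasure_eq_measure)
  ultimately have "?N \<in> null_sets M"
    using Q by (auto simp: finite_rv_def intro!: null_sets.finite_UN)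
  then show ?thesis by (rule AE_I') (auto simp: less_le)
qed

end

section \<open>Entropy inequalities, all drawn from the finite Gibbs inequality\<close>

locale process = prob_space M for M :: "(int \<Rightarrow> 'a) measure"
begin

lemma part_entropy_eq:
  assumes "finite_rv Q"
  shows "part_entropy M Q = (\<integral>x. - ln (pr Q (Q x)) \<partial>M)"
  unfolding finite_rv_integral(2)[OF assms, of "\<lambda>v. - ln (pr Q v)"] part_entropy_def ent_fun_def
  by (intro sum.cong) (auto simp: pr_def)

text \<open>Nonnegativity of relative entropy, from ln t \<le> t - 1. Each entropy estimate below
  amounts to a choice of the reference weights q, which may have total mass below 1.\<close>

lemma gibbs_inequality:
  assumes Q: "finite_rv Q"
    and q: "\<And>v. v \<in> Q ` space M \<Longrightarrow> q v \<ge> 0" "(\<Sum>v\<in>Q ` space M. q v) \<le> 1"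
    and pos: "\<And>v. v \<in> Q ` space M \<Longrightarrow> pr Q v > 0 \<Longrightarrow> q v > 0"
  shows "part_entropy M Q \<le> (\<integral>x. - ln (q (Q x)) \<partial>M)"
proof -
  have "pr Q v * - ln (pr Q v) - pr Q v * - ln (q v) \<le> q v - pr Q v" if v: "v \<in> Q ` space M" for v
  proof (cases "pr Q v = 0")
    case False
    then have p: "pr Q v > 0" by (simp add: less_le)
    then have "pr Q v * ln (q v / pr Q v) \<le> pr Q v * (q v / pr Q v - 1)"
      using pos[OF v] by (intro mult_left_mono ln_le_minus_one) auto
    then show ?thesis using p pos[OF v] by (simp add: ln_div algebra_simps)
  qed (use q(1)[OF v] in simp)
  then have "(\<Sum>v\<in>Q ` space M. pr Q v * - ln (pr Q v) - pr Q v * - ln (q v))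
      \<le> (\<Sum>v\<in>Q ` space M. q v - pr Q v)" by (rule sum_mono)
  also have "\<dots> \<le> 0" using q(2) pr_sum[OF Q] by (simp add: sum_subtractf)
  finally show ?thesis
    unfolding part_entropy_eq[OF Q] finite_rv_integral(2)[OF Q, of "\<lambda>v. - ln (pr Q v)"]
      finite_rv_integral(2)[OF Q, of "\<lambda>v. - ln (q v)"]
    unfolding sum_subtractf by simp
qed

lemma part_entropy_nonneg:
  assumes "finite_rv Q"
  shows "part_entropy M Q \<ge> 0"
  unfolding part_entropy_eq[OF assms]
proof (rule Bochner_Integration.integral_nonneg)
  fix x
  show "0 \<le> - ln (pr Q (Q x))" by (cases "pr Q (Q x) = 0") (auto simp: pr_def less_le)
qed

lemma part_entropy_compose_le:
  assumes R: "finite_rv R"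
  shows "part_entropy M (\<lambda>x. g (R x)) \<le> part_entropy M R"
  unfolding part_entropy_eq[OF R] part_entropy_eq[OF finite_rv_compose[OF R]]
proof (rule integral_mono_AE)
  show "integrable M (\<lambda>x. - ln (pr (\<lambda>x. g (R x)) (g (R x))))"
    using finite_rv_integral(1)[OF R, of "\<lambda>v. - ln (pr (\<lambda>x. g (R x)) (g v))"] .
  show "integrable M (\<lambda>x. - ln (pr R (R x)))" by (rule finite_rv_integral(1)[OF R])
  \<comment> \<open>Points in null fibres have to be discarded: there \<open>ln 0 = 0\<close> would
    spoil the comparison.\<close>
  show "AE x in M. - ln (pr (\<lambda>x. g (R x)) (g (R x))) \<le> - ln (pr R (R x))"
    using AE_pr_pos[OF R]
  proof eventually_elim
    case (elim x)
    then show ?case using pr_mono[OF R, of x g] by simp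
  qed
qed

text \<open>The Gibbs inequality with the product of the two marginals as reference.\<close>

lemma part_entropy_pair_le:
  assumes Q: "finite_rv Q" and R: "finite_rv R"
  shows "part_entropy M (\<lambda>x. (Q x, R x)) \<le> part_entropy M Q + part_entropy M R"
proof -
  let ?J = "\<lambda>x. (Q x, R x)"
  have J: "finite_rv ?J" by (rule finite_rv_pair[OF Q R])
  have "part_entropy M ?J \<le> (\<integral>x. - ln ((\<lambda>(a, b). pr Q a * pr R b) (?J x)) \<partial>M)"
  proof (rule gibbs_inequality[OF J])
    have "(\<Sum>v\<in>?J ` space M. (\<lambda>(a, b). pr Q a * pr R b) v)
        \<le> (\<Sum>v\<in>Q ` space M \<times> R ` space M. (\<lambda>(a, b). pr Q a * pr R b) v)"
      using Q R by (intro sum_mono2) (auto simp: finite_rv_def)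
    also have "\<dots> = (\<Sum>a\<in>Q ` space M. pr Q a) * (\<Sum>b\<in>R ` space M. pr R b)"
      by (simp add: sum_product sum.cartesian_product)
    finally show "(\<Sum>v\<in>?J ` space M. (\<lambda>(a, b). pr Q a * pr R b) v) \<le> 1"
      using pr_sum[OF Q] pr_sum[OF R] by simp
  next
    fix v assume v: "v \<in> ?J ` space M" "pr ?J v > 0"
    then obtain x where x: "v = (Q x, R x)" by auto
    have "pr ?J v \<le> pr Q (Q x)" "pr ?J v \<le> pr R (R x)"
      using pr_mono[OF J, of x fst] pr_mono[OF J, of x snd] by (auto simp: x)
    then show "(\<lambda>(a, b). pr Q a * pr R b) v > 0" using v(2) x by simp
  qed auto
  also have "\<dots> = (\<integral>x. - ln (pr Q (Q x)) + - ln (pr R (R x)) \<partial>M)"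
  proof (rule integral_cong_AE)
    show "(\<lambda>x. - ln ((\<lambda>(a, b). pr Q a * pr R b) (?J x))) \<in> borel_measurable M"
      using finite_rv_integral(1)[OF J, of "\<lambda>v. - ln ((\<lambda>(a, b). pr Q a * pr R b) v)"] by auto
    show "(\<lambda>x. - ln (pr Q (Q x)) + - ln (pr R (R x))) \<in> borel_measurable M"
      using finite_rv_integral(1)[OF Q, of "\<lambda>v. - ln (pr Q v)"]
        finite_rv_integral(1)[OF R, of "\<lambda>v. - ln (pr R v)"] by (intro borel_measurable_add) auto
    show "AE x in M. - ln ((\<lambda>(a, b). pr Q a * pr R b) (?J x)) = - ln (pr Q (Q x)) + - ln (pr R (R x))"
      using AE_pr_pos[OF Q] AE_pr_pos[OF R] by eventually_elim (simp add: ln_mult_pos)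
  qed
  also have "\<dots> = part_entropy M Q + part_entropy M R"
    unfolding part_entropy_eq[OF Q] part_entropy_eq[OF R]
    by (rule Bochner_Integration.integral_add)
      (use finite_rv_integral(1)[OF Q, of "\<lambda>v. - ln (pr Q v)"]
        finite_rv_integral(1)[OF R, of "\<lambda>v. - ln (pr R v)"] in auto)
  finally show ?thesis .
qed

end

section \<open>Measurability in the full shift and approximation by finite windows\<close>

lemma space_FS [simp]: "space FS = UNIV"
  by (simp add: FS_def space_PiM)

lemma FS_component [measurable]: "(\<lambda>x. x i) \<in> measurable FS (count_space UNIV)"
  unfolding FS_def by measurable

lemma FS_coordinate_set: "{x. x i = (a :: 'a)} \<in> sets FS"
proof -
  have "(\<lambda>x. x i) -` {a} \<inter> space FS \<in> sets FS"
    by (rule measurable_sets[OF FS_component]) simp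
  then show ?thesis by (simp add: vimage_def)
qed

lemma word_set [measurable]: "{x :: int \<Rightarrow> 'a. word x i m = w} \<in> sets FS"
proof (cases "length w = m")
  case True
  have "{x :: int \<Rightarrow> 'a. word x i m = w} = {x\<in>space FS. \<forall>k\<in>{..<m}. x (i + int k) = w ! k}"
    using True by (auto simp: word_eq_list_iff)
  also have "\<dots> \<in> sets FS"
    by (rule sets.sets_Collect_finite_All) (auto simp: FS_coordinate_set)
  finally show ?thesis .
next
  case False
  then have "{x :: int \<Rightarrow> 'a. word x i m = w} = {}" by auto
  then show ?thesis by simp
qed

lemma measurable_FS_I:
  assumes "\<And>i a. {x\<in>space N. g x i = a} \<in> sets N"
  shows "g \<in> measurable N (FS :: (int \<Rightarrow> 'a::finite) measure)"
  unfolding FS_def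
proof (rule measurable_PiM_single)
  fix A :: "'a set" and i
  have "{x\<in>space N. g x i \<in> A} = (\<Union>a\<in>A. {x\<in>space N. g x i = a})" by auto
  also have "\<dots> \<in> sets N" using assms by (intro sets.finite_UN) auto
  finally show "{x\<in>space N. g x i \<in> A} \<in> sets N" .
qed (auto simp: space_PiM)

lemma translate_measurable [measurable]:
  "(\<lambda>x i. x (i + k)) \<in> measurable FS (FS :: (int \<Rightarrow> 'a::finite) measure)"
  by (rule measurable_FS_I) (simp add: FS_coordinate_set)

lemma finite_range_word: "finite (range (\<lambda>x :: int \<Rightarrow> 'a::finite. word x i m))"
  by (rule finite_subset[OF _ finite_words[of m]]) auto

text \<open>The sets determined by the coordinates from -r to r. Centring the windows lets any two
  such sets be brought to a common radius.\<close>

definition window_set :: "nat \<Rightarrow> 'a list set \<Rightarrow> (int \<Rightarrow> 'a) set" where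
  "window_set r W = {x. word x (- int r) (2 * r + 1) \<in> W}"

lemma window_set_enlarge:
  assumes "r \<le> s"
  obtains W' where "window_set r W = window_set s W'"
proof -
  have "word x (- int r) (2 * r + 1) = take (2 * r + 1) (drop (s - r) (word x (- int s) (2 * s + 1)))" for x :: "int \<Rightarrow> 'a"
    using assms by (simp add: drop_word take_word of_nat_diff)
  then have "window_set r W = window_set s {w. take (2 * r + 1) (drop (s - r) w) \<in> W}"
    by (auto simp: window_set_def)
  then show ?thesis using that by blast
qed

lemma window_set_sets [measurable]: "window_set r W \<in> sets (FS :: (int \<Rightarrow> 'a::finite) measure)"
proof -
  have "window_set r W = (\<Union>w\<in>{w\<in>W. length w = 2 * r + 1}. {x. word x (- int r) (2 * r + 1) = w})"
    by (auto simp: window_set_def)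
  also have "\<dots> \<in> sets FS"
    by (intro sets.finite_UN finite_subset[OF _ finite_words[of "2 * r + 1"]]) auto
  finally show ?thesis .
qed

lemma window_set_compl: "- window_set r W = window_set r (- W)"
  by (auto simp: window_set_def)

lemma window_set_Un: "\<exists>t U. window_set r W \<union> window_set s W' = window_set t U"
proof -
  obtain A B where "window_set r W = window_set (max r s) A" "window_set s W' = window_set (max r s) B"
    using window_set_enlarge max.cobounded1 max.cobounded2 by metis
  then have "window_set r W \<union> window_set s W' = window_set (max r s) (A \<union> B)"
    by (auto simp: window_set_def)
  then show ?thesis by blast
qed

text \<open>Density of the algebra of window sets in measure, by induction over the generated
  sigma-algebra. A countable union is first cut to a finite one by continuity of the measure; a
  finite union is handled by adding symmetric differences.\<close>

lemma window_approx:
  fixes \<mu> :: "(int \<Rightarrow> 'a::finite) measure"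
  assumes "prob_space \<mu>" and sets: "sets \<mu> = sets FS" and A: "A \<in> sets FS"
  shows "\<forall>e>0. \<exists>r W. measure \<mu> ((A - window_set r W) \<union> (window_set r W - A)) < e"
proof -
  interpret prob_space \<mu> by fact
  have sp: "space \<mu> = UNIV" using sets_eq_imp_space_eq[OF sets] by simp
  have ws: "window_set r W \<in> events" for r W using sets window_set_sets by auto
  have "A \<in> sigma_sets UNIV {{x. x i \<in> B} |i B. True}"
    using A unfolding FS_def sets_PiM_single by (simp add: space_PiM PiE_def)
  then have "A \<in> events \<and> (\<forall>e>0. \<exists>r W. prob ((A - window_set r W) \<union> (window_set r W - A)) < e)"
  proof (induction rule: sigma_sets.induct)
    case (Basic A)
    then obtain i B where A: "A = {x. x i \<in> B}" by auto
    define r where "r = nat \<bar>i\<bar>"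
    have "word x (- int r) (2 * r + 1) ! nat (i + int r) = x i" for x :: "int \<Rightarrow> 'a"
      unfolding r_def by (subst nth_word) auto
    then have eq: "A = window_set r {w. w ! nat (i + int r) \<in> B}" by (simp add: A window_set_def)
    have "prob ((A - A) \<union> (A - A)) = 0" by simp
    then show ?case using eq ws by (metis order_less_le_trans order_refl)
  next
    case Empty
    have "window_set 0 {} = ({} :: (int \<Rightarrow> 'a) set)" by (simp add: window_set_def)
    then have "prob (({} - window_set 0 {}) \<union> (window_set 0 {} - {})) = 0" by simp
    then show ?case by (metis sets.empty_sets)
  next
    case (Compl A)
    have "\<exists>r W. prob (((UNIV - A) - window_set r W) \<union> (window_set r W - (UNIV - A))) < e" if "e > 0" for e
    proof -
      obtain r W where "prob ((A - window_set r W) \<union> (window_set r W - A)) < e" using Compl \<open>e > 0\<close> by blast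
      moreover have "((UNIV - A) - window_set r (- W)) \<union> (window_set r (- W) - (UNIV - A))
          = (A - window_set r W) \<union> (window_set r W - A)"
        unfolding window_set_compl[symmetric] by auto
      ultimately show ?thesis by metis
    qed
    moreover have "UNIV - A \<in> events" using Compl sets.compl_sets[of A \<mu>] by (simp add: sp)
    ultimately show ?case by blast
  next
    case (Union A)
    have ev: "A i \<in> events" for i using Union by blast
    have "\<exists>r W. prob (((\<Union>i. A i) - window_set r W) \<union> (window_set r W - (\<Union>i. A i))) < e" if e: "e > 0" for e
    proof -
      define C where "C = (\<lambda>n. \<Union>i<n. A i)"
      have "incseq C" unfolding C_def incseq_def by (intro allI impI UN_mono) auto
      moreover have "range C \<subseteq> events" unfolding C_def using ev by (auto intro!: sets.finite_UN)
      ultimately have C: "range C \<subseteq> events" "incseq C" by auto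
      have "(\<Union>n. C n) = (\<Union>i. A i)" by (auto simp: C_def)
      then have "(\<lambda>n. prob (C n)) \<longlonglongrightarrow> prob (\<Union>i. A i)" using finite_Lim_measure_incseq[OF C] by simp
      then obtain n where n: "\<bar>prob (C n) - prob (\<Union>i. A i)\<bar> < e / 2"
        using e by (metis LIMSEQ_D half_gt_zero order_refl real_norm_def)
      have Uev: "(\<Union>i. A i) \<in> events" using ev by auto
      have Cev: "C n \<in> events" for n using C by auto
      have diff: "prob ((\<Union>i. A i) - C n) < e / 2"
      proof -
        have "C n \<subseteq> (\<Union>i. A i)" by (auto simp: C_def)
        then have "prob ((\<Union>i. A i) - C n) = prob (\<Union>i. A i) - prob (C n)"
          by (rule finite_measure_Diff[OF Uev Cev])
        then show ?thesis using n by linarith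
      qed
      have "\<forall>e>0. \<exists>r W. prob ((C n - window_set r W) \<union> (window_set r W - C n)) < e" for n
      proof (induction n)
        case 0
        have "window_set 0 {} = ({} :: (int \<Rightarrow> 'a) set)" by (simp add: window_set_def)
        then have "prob ((C 0 - window_set 0 {}) \<union> (window_set 0 {} - C 0)) = 0" by (simp add: C_def)
        then show ?case by metis
      next
        case (Suc n)
        show ?case
        proof (intro allI impI)
          fix e :: real assume e: "e > 0"
          obtain r W where 1: "prob ((C n - window_set r W) \<union> (window_set r W - C n)) < e / 2"
            using Suc e half_gt_zero by blast
          obtain s W' where 2: "prob ((A n - window_set s W') \<union> (window_set s W' - A n)) < e / 2"
            using Union(2)[of n] e half_gt_zero by blast
          obtain t U where U: "window_set r W \<union> window_set s W' = window_set t U" using window_set_Un by blast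
          have "prob ((C (Suc n) - window_set t U) \<union> (window_set t U - C (Suc n)))
              \<le> prob (((C n - window_set r W) \<union> (window_set r W - C n)) \<union> ((A n - window_set s W') \<union> (window_set s W' - A n)))"
            unfolding U[symmetric] using Cev ev ws
            by (intro finite_measure_mono) (auto simp: C_def lessThan_Suc)
          also have "\<dots> \<le> prob ((C n - window_set r W) \<union> (window_set r W - C n)) + prob ((A n - window_set s W') \<union> (window_set s W' - A n))"
            using Cev ev ws by (intro measure_Un_le) auto
          finally show "\<exists>r W. prob ((C (Suc n) - window_set r W) \<union> (window_set r W - C (Suc n))) < e"
            using 1 2 by (intro exI[of _ t] exI[of _ U]) simp
        qed
      qed
      then obtain r W where rW: "prob ((C n - window_set r W) \<union> (window_set r W - C n)) < e / 2"
        using e half_gt_zero by blast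
      have "prob (((\<Union>i. A i) - window_set r W) \<union> (window_set r W - (\<Union>i. A i)))
          \<le> prob (((\<Union>i. A i) - C n) \<union> ((C n - window_set r W) \<union> (window_set r W - C n)))"
        using Cev Uev ws by (intro finite_measure_mono) (auto simp: C_def)
      also have "\<dots> \<le> prob ((\<Union>i. A i) - C n) + prob ((C n - window_set r W) \<union> (window_set r W - C n))"
        using Cev Uev ws by (intro measure_Un_le) auto
      finally show ?thesis using rW diff by (intro exI[of _ r] exI[of _ W]) simp
    qed
    then show ?case using ev by blast
  qed
  then show ?thesis by blast
qed

section \<open>The Kolmogorov--Sinai theorem for the shift\<close>

locale stationary = process \<mu> for \<mu> :: "(int \<Rightarrow> 'a::finite) measure" +
  assumes sets_eq: "sets \<mu> = sets FS"
    and shift_inv: "\<And>A. A \<in> sets FS \<Longrightarrow> emeasure \<mu> (shift -` A) = emeasure \<mu> A"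
begin

lemma space_eq [simp]: "space \<mu> = UNIV"
  using sets_eq_imp_space_eq[OF sets_eq] by simp

lemma funpow_measurable: "(shift ^^ k) \<in> measurable \<mu> \<mu>"
proof -
  have "(\<lambda>x i. x (i + int k)) \<in> measurable FS (FS :: (int \<Rightarrow> 'a) measure)" by measurable
  moreover have "(shift ^^ k :: (int \<Rightarrow> 'a) \<Rightarrow> _) = (\<lambda>x i. x (i + int k))" by (rule ext) (simp add: shift_funpow)
  ultimately show ?thesis by (simp add: measurable_cong_sets[OF sets_eq sets_eq])
qed

lemma emeasure_funpow:
  assumes "A \<in> events"
  shows "emeasure \<mu> ((shift ^^ k) -` A) = emeasure \<mu> A"
proof (induction k)
  case (Suc k)
  have A': "(shift ^^ k) -` A \<in> sets FS"
    using measurable_sets[OF funpow_measurable assms, of k] by (simp add: sets_eq)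
  have "(shift ^^ Suc k) -` A = shift -` ((shift ^^ k) -` A)"
    by (rule set_eqI) (simp add: funpow_Suc_right del: funpow.simps)
  then have "emeasure \<mu> ((shift ^^ Suc k) -` A) = emeasure \<mu> (shift -` ((shift ^^ k) -` A))"
    by (simp only:)
  then show ?case using shift_inv[OF A'] Suc by (simp only:)
qed simp

lemma distr_funpow: "distr \<mu> \<mu> (shift ^^ k) = \<mu>"
proof (rule measure_eqI)
  fix A assume "A \<in> sets (distr \<mu> \<mu> (shift ^^ k))"
  then have A: "A \<in> events" by simp
  then show "emeasure (distr \<mu> \<mu> (shift ^^ k)) A = emeasure \<mu> A"
    by (subst emeasure_distr[OF funpow_measurable A]) (simp add: emeasure_funpow)
qed simp

lemma integral_funpow:
  fixes g :: "(int \<Rightarrow> 'a) \<Rightarrow> real"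
  assumes "g \<in> borel_measurable \<mu>"
  shows "(\<integral>x. g ((shift ^^ k) x) \<partial>\<mu>) = (\<integral>x. g x \<partial>\<mu>)"
  using integral_distr[OF funpow_measurable assms, of k] by (simp add: distr_funpow)

lemma prob_funpow:
  assumes "{x. P x} \<in> events"
  shows "prob {x. P ((shift ^^ k) x)} = prob {x. P x}"
  using emeasure_funpow[OF assms, of k] by (simp add: vimage_def measure_def)

lemma finite_rv_word: "finite_rv (\<lambda>x. word x i m)"
  using finite_range_word word_set by (simp add: finite_rv_def sets_eq)

lemma finite_rv_funpow:
  assumes Q: "finite_rv Q"
  shows "finite_rv (\<lambda>x. Q ((shift ^^ k) x))"
proof -
  have "finite (range (\<lambda>x. Q ((shift ^^ k) x)))"
    using Q by (auto simp: finite_rv_def intro: finite_subset[of _ "range Q"])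
  moreover have "{x. Q ((shift ^^ k) x) = v} \<in> events" for v
    using measurable_sets[OF funpow_measurable, of "{x. Q x = v}" k] Q
    by (simp add: finite_rv_def vimage_def)
  ultimately show ?thesis by (simp add: finite_rv_def)
qed

definition itinerary :: "((int \<Rightarrow> 'a) \<Rightarrow> 'b) \<Rightarrow> nat \<Rightarrow> (int \<Rightarrow> 'a) \<Rightarrow> 'b list" where
  "itinerary Q n x = map (\<lambda>k. Q ((shift ^^ k) x)) [0..<n]"

lemma itinerary_Suc: "itinerary Q (Suc n) x = itinerary Q n x @ [Q ((shift ^^ n) x)]"
  by (simp add: itinerary_def)

lemma itinerary_add: "itinerary Q (m + n) x = itinerary Q m x @ itinerary Q n ((shift ^^ m) x)"
  by (induction n) (simp_all add: itinerary_Suc funpow_add[symmetric] add.commute itinerary_def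
      flip: comp_apply[of "shift ^^ _" "shift ^^ _"])

lemma finite_rv_itinerary:
  assumes "finite_rv Q"
  shows "finite_rv (itinerary Q n)"
proof (induction n)
  case 0
  have "itinerary Q 0 = (\<lambda>x. (\<lambda>_. []) (Q x))" by (rule ext) (simp add: itinerary_def)
  then show ?case using finite_rv_compose[OF assms, of "\<lambda>_. []"] by simp
next
  case (Suc n)
  have "itinerary Q (Suc n) = (\<lambda>x. (\<lambda>(a, b). a @ [b]) (itinerary Q n x, Q ((shift ^^ n) x)))"
    by (rule ext) (simp add: itinerary_Suc)
  then show ?case
    using finite_rv_compose[OF finite_rv_pair[OF Suc finite_rv_funpow[OF assms, of n]], of "\<lambda>(a, b). a @ [b]"]
    by (simp only:)
qed

lemma part_entropy_funpow:
  assumes Q: "finite_rv Q"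
  shows "part_entropy \<mu> (\<lambda>x. Q ((shift ^^ k) x)) = part_entropy \<mu> Q"
proof -
  have "pr (\<lambda>x. Q ((shift ^^ k) x)) v = pr Q v" for v
    using prob_funpow[of "\<lambda>x. Q x = v" k] Q by (simp add: pr_def finite_rv_def)
  then have "part_entropy \<mu> (\<lambda>x. Q ((shift ^^ k) x)) = (\<integral>x. - ln (pr Q (Q ((shift ^^ k) x))) \<partial>\<mu>)"
    by (simp add: part_entropy_eq[OF finite_rv_funpow[OF Q]])
  also have "\<dots> = part_entropy \<mu> Q"
    unfolding part_entropy_eq[OF Q] using finite_rv_integral(1)[OF Q, of "\<lambda>v. - ln (pr Q v)"]
    by (intro integral_funpow) auto
  finally show ?thesis .
qed

lemma part_entropy_itinerary_subadd:
  assumes Q: "finite_rv Q"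
  shows "part_entropy \<mu> (itinerary Q (m + n)) \<le> part_entropy \<mu> (itinerary Q m) + part_entropy \<mu> (itinerary Q n)"
proof -
  let ?R = "\<lambda>x. itinerary Q n ((shift ^^ m) x)"
  have R: "finite_rv ?R" by (rule finite_rv_funpow[OF finite_rv_itinerary[OF Q]])
  note m = finite_rv_itinerary[OF Q, of m]
  have "itinerary Q (m + n) = (\<lambda>x. (\<lambda>(a, b). a @ b) (itinerary Q m x, ?R x))"
    by (rule ext) (simp add: itinerary_add)
  then have "part_entropy \<mu> (itinerary Q (m + n)) \<le> part_entropy \<mu> (\<lambda>x. (itinerary Q m x, ?R x))"
    using part_entropy_compose_le[OF finite_rv_pair[OF m R], of "\<lambda>(a, b). a @ b"] by simp
  also have "\<dots> \<le> part_entropy \<mu> (itinerary Q m) + part_entropy \<mu> ?R"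
    by (rule part_entropy_pair_le[OF m R])
  finally show ?thesis using part_entropy_funpow[OF finite_rv_itinerary[OF Q]] by simp
qed

lemma entropy_limit:
  assumes Q: "finite_rv Q"
  obtains L where "(\<lambda>n. part_entropy \<mu> (itinerary Q n) / real n) \<longlonglongrightarrow> L"
    "\<And>n. n \<ge> 1 \<Longrightarrow> L \<le> part_entropy \<mu> (itinerary Q n) / real n"
  using fekete[of "\<lambda>n. part_entropy \<mu> (itinerary Q n)" 0]
    part_entropy_itinerary_subadd[OF Q] part_entropy_nonneg[OF finite_rv_itinerary[OF Q]]
  by auto

lemma entropy_wrt_tendsto:
  assumes Q: "finite_rv Q"
  shows "(\<lambda>n. part_entropy \<mu> (itinerary Q n) / real n) \<longlonglongrightarrow> entropy_wrt \<mu> Q"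
proof -
  obtain L where L: "(\<lambda>n. part_entropy \<mu> (itinerary Q n) / real n) \<longlonglongrightarrow> L"
    using entropy_limit[OF Q] by blast
  have "entropy_wrt \<mu> Q = lim (\<lambda>n. part_entropy \<mu> (itinerary Q n) / real n)"
    unfolding entropy_wrt_def itinerary_def by simp
  then show ?thesis using L limI[OF L] by simp
qed

definition word_entropy :: "nat \<Rightarrow> real" where
  "word_entropy n = part_entropy \<mu> (\<lambda>x. word x 0 n)"

lemma word_itinerary: "(\<lambda>x. word x 0 n) = itinerary (\<lambda>x. x 0) n"
  by (rule ext) (simp add: word_def itinerary_def shift_funpow)

lemma finite_rv_coordinate: "finite_rv (\<lambda>x. x 0)"
  using finite_rv_compose[OF finite_rv_word[of 0 1], of "\<lambda>w. w ! 0"] by simp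

lemma part_entropy_word: "part_entropy \<mu> (\<lambda>x. word x (- int r) n) = word_entropy n"
proof -
  have "word ((shift ^^ r) x) (- int r) n = word x 0 n" for x :: "int \<Rightarrow> 'a"
    by (simp add: shift_funpow word_translate)
  then show ?thesis
    using part_entropy_funpow[OF finite_rv_word, of r "- int r" n] by (simp add: word_entropy_def)
qed

text \<open>If \<open>Q\<close> agrees with \<open>Q'\<close> outside a small set, the itinerary of \<open>Q\<close> is the itinerary of \<open>Q'\<close>
  observed through a symmetric noisy channel; comparing its law with the output law of this channel
  replaces conditional entropies.\<close>
lemma itinerary_entropy_perturb:
  fixes Q Q' :: "(int \<Rightarrow> 'a) \<Rightarrow> 'b"
  assumes Q: "finite_rv Q" and Q': "finite_rv Q'" and d: "0 < d" "d < 1"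
  defines "K \<equiv> real (card (range Q))"
  shows "part_entropy \<mu> (itinerary Q n) \<le> part_entropy \<mu> (itinerary Q' n)
    + real n * (- ln (1 - d) + ln (K / d) * prob {x. Q x \<noteq> Q' x})"
proof -
  let ?S = "range Q"
  let ?U = "itinerary Q' n" and ?Z = "itinerary Q n"
  let ?L = "{z. set z \<subseteq> ?S \<and> length z = n}"
  have finS: "finite ?S" using Q by (simp add: finite_rv_def)
  have "?S \<noteq> {}" by simp
  then have K1: "K \<ge> 1" unfolding K_def using finS
    by (metis One_nat_def Suc_leI card_gt_0_iff of_nat_1 of_nat_le_iff)
  \<comment> \<open>The channel keeps a symbol with weight 1 - d and otherwise spreads d over the K
    symbols. Leaving d / K out of the diagonal only makes it substochastic, which the Gibbs
    inequality permits.\<close>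
  define kap :: "'b \<Rightarrow> 'b \<Rightarrow> real" where "kap = (\<lambda>a b. if a = b then 1 - d else d / K)"
  have kap_pos: "kap a b > 0" for a b using d K1 by (auto simp: kap_def)
  have kap_sum: "(\<Sum>b\<in>?S. kap a b) \<le> 1" for a
  proof -
    have "(\<Sum>b\<in>?S. kap a b) \<le> (\<Sum>b\<in>?S. (if b = a then 1 - d else 0) + d / K)"
      using d K1 by (intro sum_mono) (auto simp: kap_def)
    also have "\<dots> = (if a \<in> ?S then 1 - d else 0) + d"
      using finS K1 by (simp add: sum.distrib K_def)
    finally show ?thesis using d by (auto split: if_splits)
  qed
  define ch where "ch = (\<lambda>y z. \<Prod>i<n. kap (y ! i) (z ! i))"
  have ch_pos: "ch y z > 0" for y z unfolding ch_def by (intro prod_pos) (simp add: kap_pos)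
  \<comment> \<open>The output law of the channel when it is fed with the itinerary of
    \<open>Q'\<close>.\<close>
  define q where "q = (\<lambda>z. \<Sum>y\<in>range ?U. pr ?U y * ch y z)"
  note U = finite_rv_itinerary[OF Q', of n] and Z = finite_rv_itinerary[OF Q, of n]
  have finU: "finite (range ?U)" using U by (simp add: finite_rv_def)
  have q0: "q z \<ge> 0" for z unfolding q_def using ch_pos by (intro sum_nonneg) (simp add: less_imp_le)
  have sub: "range ?Z \<subseteq> ?L" by (auto simp: itinerary_def)
  have finL: "finite ?L" using finS by (rule finite_lists_length_eq)
  have "(\<Sum>z\<in>range ?Z. q z) \<le> (\<Sum>z\<in>?L. q z)" using sub finL q0 by (intro sum_mono2) auto
  also have "\<dots> = (\<Sum>y\<in>range ?U. pr ?U y * (\<Sum>z\<in>?L. ch y z))"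
    unfolding q_def by (subst sum.swap) (simp add: sum_distrib_left)
  also have "\<dots> \<le> (\<Sum>y\<in>range ?U. pr ?U y * 1)"
  proof (intro sum_mono mult_left_mono)
    fix y
    have "(\<Sum>z\<in>?L. ch y z) = (\<Prod>i<n. \<Sum>b\<in>?S. kap (y ! i) b)"
      unfolding ch_def by (rule sum_lists_prod[OF finS])
    also have "\<dots> \<le> 1" using kap_pos kap_sum
      by (intro prod_le_1 conjI sum_nonneg) (auto simp: less_imp_le)
    finally show "(\<Sum>z\<in>?L. ch y z) \<le> 1" .
  qed simp
  also have "\<dots> = 1" using pr_sum[OF U] by simp
  finally have qsum: "(\<Sum>z\<in>range ?Z. q z) \<le> 1" .
  \<comment> \<open>Keeping only the input that really occurred splits -ln q into the information of
    the itinerary of \<open>Q'\<close> and a sum of one-letter channel costs; stationarity makes all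
    these costs equal in mean.\<close>
  have q_ge: "pr ?U (?U x) * ch (?U x) (?Z x) \<le> q (?Z x)" for x
    unfolding q_def using finU ch_pos by (intro member_le_sum) (auto simp: less_imp_le)
  note J = finite_rv_pair[OF U Z]
  have "part_entropy \<mu> ?Z \<le> (\<integral>x. - ln (q (?Z x)) \<partial>\<mu>)"
  proof (rule gibbs_inequality[OF Z])
    fix v assume v: "pr ?Z v > 0"
    have "\<exists>x. ?Z x = v \<and> pr ?U (?U x) > 0"
    proof (rule ccontr)
      assume neg: "\<not> ?thesis"
      have "AE x in \<mu>. ?Z x \<noteq> v" using AE_pr_pos[OF U] by eventually_elim (use neg in auto)
      then have "pr ?Z v = 0" unfolding pr_def
        by (subst prob_eq_0) (use Z in \<open>auto simp: finite_rv_def\<close>)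
      then show False using v by simp
    qed
    then obtain x where x: "?Z x = v" "pr ?U (?U x) > 0" by blast
    then show "q v > 0" using q_ge[of x] ch_pos[of "?U x" v] by (metis mult_pos_pos order_less_le_trans)
  qed (use q0 qsum in auto)
  also have "\<dots> \<le> (\<integral>x. - ln (pr ?U (?U x)) + - ln (ch (?U x) (?Z x)) \<partial>\<mu>)"
  proof (rule integral_mono_AE)
    show "integrable \<mu> (\<lambda>x. - ln (q (?Z x)))" by (rule finite_rv_integral(1)[OF Z])
    show "integrable \<mu> (\<lambda>x. - ln (pr ?U (?U x)) + - ln (ch (?U x) (?Z x)))"
      using finite_rv_integral(1)[OF J, of "\<lambda>(a, b). - ln (pr ?U a) + - ln (ch a b)"] by simp
    show "AE x in \<mu>. - ln (q (?Z x)) \<le> - ln (pr ?U (?U x)) + - ln (ch (?U x) (?Z x))"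
      using AE_pr_pos[OF U]
    proof eventually_elim
      case (elim x)
      have "ln (pr ?U (?U x)) + ln (ch (?U x) (?Z x)) = ln (pr ?U (?U x) * ch (?U x) (?Z x))"
        using elim ch_pos by (simp add: ln_mult_pos)
      also have "\<dots> \<le> ln (q (?Z x))"
        using q_ge[of x] elim ch_pos[of "?U x" "?Z x"]
        by (subst ln_le_cancel_iff) (auto intro: order_less_le_trans[OF mult_pos_pos])
      finally show ?case by simp
    qed
  qed
  also have "\<dots> = part_entropy \<mu> ?U + (\<integral>x. - ln (ch (?U x) (?Z x)) \<partial>\<mu>)"
    unfolding part_entropy_eq[OF U]
    using finite_rv_integral(1)[OF U, of "\<lambda>v. - ln (pr ?U v)"]
      finite_rv_integral(1)[OF J, of "\<lambda>(a, b). - ln (ch a b)"]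
    by (intro Bochner_Integration.integral_add) auto
  also have "(\<integral>x. - ln (ch (?U x) (?Z x)) \<partial>\<mu>) = (\<integral>x. (\<Sum>i<n. - ln (kap (Q' ((shift ^^ i) x)) (Q ((shift ^^ i) x)))) \<partial>\<mu>)"
  proof (intro Bochner_Integration.integral_cong refl)
    fix x
    have "ln (ch (?U x) (?Z x)) = (\<Sum>i<n. ln (kap (?U x ! i) (?Z x ! i)))"
      unfolding ch_def using kap_pos by (intro ln_prod) (auto simp: less_imp_neq[symmetric])
    then show "- ln (ch (?U x) (?Z x)) = (\<Sum>i<n. - ln (kap (Q' ((shift ^^ i) x)) (Q ((shift ^^ i) x))))"
      by (simp add: sum_negf itinerary_def)
  qed
  also have "\<dots> = (\<Sum>i<n. (\<integral>x. - ln (kap (Q' ((shift ^^ i) x)) (Q ((shift ^^ i) x))) \<partial>\<mu>))"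
    using finite_rv_integral(1)[OF finite_rv_pair[OF finite_rv_funpow[OF Q'] finite_rv_funpow[OF Q]],
        of "\<lambda>(a, b). - ln (kap a b)"]
    by (intro Bochner_Integration.integral_sum) auto
  also have "\<dots> = (\<Sum>i<n. (\<integral>x. - ln (kap (Q' x) (Q x)) \<partial>\<mu>))"
    using finite_rv_integral(1)[OF finite_rv_pair[OF Q' Q], of "\<lambda>(a, b). - ln (kap a b)"]
    by (intro sum.cong refl integral_funpow) auto
  also have "(\<integral>x. - ln (kap (Q' x) (Q x)) \<partial>\<mu>) \<le> - ln (1 - d) + ln (K / d) * prob {x. Q x \<noteq> Q' x}"
  proof -
    have ev: "{x. Q x \<noteq> Q' x} \<in> events"
      using finite_rv_sets[OF finite_rv_pair[OF Q' Q], of "\<lambda>(a, b). b \<noteq> a"] by simp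
    have l0: "- ln (1 - d) \<ge> 0" using d by simp
    have "(\<integral>x. - ln (kap (Q' x) (Q x)) \<partial>\<mu>)
        \<le> (\<integral>x. - ln (1 - d) + ln (K / d) * indicator {x. Q x \<noteq> Q' x} x \<partial>\<mu>)"
    proof (rule integral_mono)
      show "integrable \<mu> (\<lambda>x. - ln (kap (Q' x) (Q x)))"
        using finite_rv_integral(1)[OF finite_rv_pair[OF Q' Q], of "\<lambda>(a, b). - ln (kap a b)"] by simp
      show "integrable \<mu> (\<lambda>x. - ln (1 - d) + ln (K / d) * indicator {x. Q x \<noteq> Q' x} x)"
        using ev by (auto simp: less_top[symmetric])
      fix x
      show "- ln (kap (Q' x) (Q x)) \<le> - ln (1 - d) + ln (K / d) * indicator {x. Q x \<noteq> Q' x} x"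
        using l0 d K1 by (auto simp: kap_def indicator_def ln_div)
    qed
    also have "\<dots> = - ln (1 - d) + ln (K / d) * prob {x. Q x \<noteq> Q' x}"
      using ev by (subst Bochner_Integration.integral_add) (auto simp: less_top[symmetric] prob_space[unfolded space_eq])
    finally show ?thesis .
  qed
  finally show ?thesis by (simp add: mult_left_mono)
qed

text \<open>Each of the K fibres is approximated up to e / K by a window set of a common radius, and
  \<open>\<phi>\<close> picks the value whose window set contains the observed word. Off the
  exceptional sets there is exactly one such value, namely \<open>Q x\<close>.\<close>

lemma finite_rv_approx:
  fixes Q :: "(int \<Rightarrow> 'a) \<Rightarrow> 'b"
  assumes Q: "finite_rv Q" and e: "e > 0"
  obtains r \<phi> where "prob {x. Q x \<noteq> \<phi> (word x (- int r) (2 * r + 1))} < e"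
proof -
  let ?S = "range Q"
  have finS: "finite ?S" using Q by (simp add: finite_rv_def)
  define K where "K = real (card ?S)"
  have K: "K > 0" using finS by (simp add: K_def card_gt_0_iff)
  have ev: "{x. Q x = v} \<in> events" for v using Q by (simp add: finite_rv_def)
  have "\<exists>r W. prob (({x. Q x = v} - window_set r W) \<union> (window_set r W - {x. Q x = v})) < e / K" for v
    using window_approx[OF prob_space_axioms sets_eq, of "{x. Q x = v}"] ev[of v] e K
    by (simp add: sets_eq)
  then obtain r W where rW: "\<And>v. prob (({x. Q x = v} - window_set (r v) (W v)) \<union> (window_set (r v) (W v) - {x. Q x = v})) < e / K"
    by metis
  define R where "R = Max (r ` ?S)"
  have "\<exists>W'. window_set (r v) (W v) = window_set R W'" if "v \<in> ?S" for v
    using window_set_enlarge[of "r v" R "W v"] that finS unfolding R_def by (metis Max_ge finite_imageI imageI)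
  then obtain W' where W': "\<And>v. v \<in> ?S \<Longrightarrow> window_set (r v) (W v) = window_set R (W' v)" by metis
  define E where "E = (\<lambda>v. ({x. Q x = v} - window_set R (W' v)) \<union> (window_set R (W' v) - {x. Q x = v}))"
  have E: "prob (E v) < e / K" if "v \<in> ?S" for v using rW[of v] W'[OF that] by (simp add: E_def)
  define \<phi> where "\<phi> = (\<lambda>w. SOME v. v \<in> ?S \<and> w \<in> W' v)"
  have sub: "{x. Q x \<noteq> \<phi> (word x (- int R) (2 * R + 1))} \<subseteq> (\<Union>v\<in>?S. E v)"
  proof
    fix x assume x: "x \<in> {x. Q x \<noteq> \<phi> (word x (- int R) (2 * R + 1))}"
    show "x \<in> (\<Union>v\<in>?S. E v)"
    proof (rule ccontr)
      assume neg: "x \<notin> (\<Union>v\<in>?S. E v)"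
      have "word x (- int R) (2 * R + 1) \<in> W' v \<longleftrightarrow> Q x = v" if v: "v \<in> ?S" for v
      proof -
        have "x \<notin> E v" using neg v by blast
        then show ?thesis by (auto simp: E_def window_set_def)
      qed
      then have "v \<in> ?S \<and> word x (- int R) (2 * R + 1) \<in> W' v \<longleftrightarrow> v = Q x" for v
        by auto
      then have "\<phi> (word x (- int R) (2 * R + 1)) = Q x" unfolding \<phi>_def by simp
      then show False using x by simp
    qed
  qed
  have Eev: "E v \<in> events" for v
    unfolding E_def using ev sets_eq window_set_sets by (intro sets.Un sets.Diff) auto
  have "prob {x. Q x \<noteq> \<phi> (word x (- int R) (2 * R + 1))} \<le> prob (\<Union>v\<in>?S. E v)"
    using Eev finS by (intro finite_measure_mono sub sets.finite_UN) auto
  also have "\<dots> \<le> (\<Sum>v\<in>?S. prob (E v))" using Eev finS by (intro finite_measure_subadditive_finite) auto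
  also have "\<dots> < (\<Sum>v\<in>?S. e / K)" using finS E by (intro sum_strict_mono) auto
  also have "\<dots> = e" using K by (simp add: K_def)
  finally show ?thesis using that by blast
qed

text \<open>The coordinate partition generates: up to a small error Q is a function of a window of
  radius r, so its itinerary of length n is a function of a word of length n + 2 r. The additional 2
  r letters disappear in the rate.\<close>

theorem entropy_wrt_le:
  fixes Q :: "(int \<Rightarrow> 'a) \<Rightarrow> nat"
  assumes Q: "finite_rv Q" and n: "n \<ge> 1"
  shows "entropy_wrt \<mu> Q \<le> word_entropy n / real n"
proof -
  obtain h where h: "(\<lambda>n. word_entropy n / real n) \<longlonglongrightarrow> h"
    "\<And>n. n \<ge> 1 \<Longrightarrow> h \<le> word_entropy n / real n"
    using entropy_limit[OF finite_rv_coordinate] unfolding word_entropy_def word_itinerary by blast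
  have "entropy_wrt \<mu> Q \<le> h + e" if e: "e > 0" for e
  proof -
    define K where "K = real (card (range Q))"
    \<comment> \<open>Chosen so that -ln (1 - d) is at most e / 2; the minimum with 1 only keeps d
      moderate.\<close>
    define d where "d = 1 - exp (- (min e 1 / 2))"
    have d: "0 < d" "d < 1" using e by (auto simp: d_def)
    have ld: "- ln (1 - d) \<le> e / 2" by (simp add: d_def)
    \<comment> \<open>The channel cost of a disagreement, ln (K / d), is fixed by now;
      \<open>\<eta>\<close> makes its mean contribution at most e / 2.\<close>
    define \<eta> where "\<eta> = e / 2 / (\<bar>ln (K / d)\<bar> + 1)"
    have \<eta>: "\<eta> > 0" using e by (simp add: \<eta>_def add_nonneg_pos)
    obtain r \<phi> where phi: "prob {x. Q x \<noteq> \<phi> (word x (- int r) (2 * r + 1))} < \<eta>"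
      using finite_rv_approx[OF Q \<eta>] .
    define Q' where "Q' = (\<lambda>x. \<phi> (word x (- int r) (2 * r + 1)))"
    have Q': "finite_rv Q'" unfolding Q'_def by (rule finite_rv_compose[OF finite_rv_word])
    have step: "part_entropy \<mu> (itinerary Q n) / real n \<le> word_entropy (n + 2 * r) / real n + e" if n: "n \<ge> 1" for n
    proof -
      have "ln (K / d) * prob {x. Q x \<noteq> Q' x} \<le> \<bar>ln (K / d)\<bar> * prob {x. Q x \<noteq> Q' x}"
        by (intro mult_right_mono) auto
      also have "\<dots> \<le> \<bar>ln (K / d)\<bar> * \<eta>" using phi by (intro mult_left_mono) (auto simp: Q'_def)
      also have "\<dots> \<le> (\<bar>ln (K / d)\<bar> + 1) * \<eta>" using \<eta> by (intro mult_right_mono) auto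
      also have "\<dots> = e / 2"
      proof -
        have "\<bar>ln (K / d)\<bar> + 1 > 0" by (simp add: add_nonneg_pos)
        then show ?thesis by (simp add: \<eta>_def del: divide_divide_eq_left)
      qed
      finally have "- ln (1 - d) + ln (K / d) * prob {x. Q x \<noteq> Q' x} \<le> e" using ld by simp
      then have "real n * (- ln (1 - d) + ln (K / d) * prob {x. Q x \<noteq> Q' x}) \<le> real n * e"
        by (intro mult_left_mono) auto
      moreover have "part_entropy \<mu> (itinerary Q' n) \<le> word_entropy (n + 2 * r)"
      proof -
        have "Q' ((shift ^^ k) x) = \<phi> (take (2 * r + 1) (drop k (word x (- int r) (n + 2 * r))))" if "k < n" for k x
          using that by (simp add: Q'_def drop_word take_word shift_funpow word_translate algebra_simps)
        then have "itinerary Q' n = (\<lambda>x. map (\<lambda>k. \<phi> (take (2 * r + 1) (drop k (word x (- int r) (n + 2 * r))))) [0..<n])"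
          by (intro ext) (auto simp: itinerary_def)
        then have "part_entropy \<mu> (itinerary Q' n) \<le> part_entropy \<mu> (\<lambda>x. word x (- int r) (n + 2 * r))"
          using part_entropy_compose_le[OF finite_rv_word[of "- int r" "n + 2 * r"],
              of "\<lambda>w. map (\<lambda>k. \<phi> (take (2 * r + 1) (drop k w))) [0..<n]"] by simp
        then show ?thesis by (simp add: part_entropy_word)
      qed
      ultimately have "part_entropy \<mu> (itinerary Q n) \<le> word_entropy (n + 2 * r) + real n * e"
        using itinerary_entropy_perturb[OF Q Q' d, of n] by (simp add: K_def)
      then show ?thesis using n by (simp add: field_simps)
    qed
    have "(\<lambda>n. word_entropy (n + 2 * r) / real (n + 2 * r)) \<longlonglongrightarrow> h"
      using LIMSEQ_ignore_initial_segment[OF h(1)] .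
    moreover have "(\<lambda>n. real (n + 2 * r) / real n) \<longlonglongrightarrow> 1"
      by real_asymp
    ultimately have "(\<lambda>n. word_entropy (n + 2 * r) / real (n + 2 * r) * (real (n + 2 * r) / real n) + e) \<longlonglongrightarrow> h * 1 + e"
      by (intro tendsto_intros)
    moreover have "\<forall>\<^sub>F n in sequentially. part_entropy \<mu> (itinerary Q n) / real n
        \<le> word_entropy (n + 2 * r) / real (n + 2 * r) * (real (n + 2 * r) / real n) + e"
    proof (rule eventually_sequentiallyI[of 1])
      fix n :: nat assume n: "1 \<le> n"
      have "real (n + 2 * r) \<noteq> 0" using n by simp
      then show "part_entropy \<mu> (itinerary Q n) / real n
        \<le> word_entropy (n + 2 * r) / real (n + 2 * r) * (real (n + 2 * r) / real n) + e"
        using step[OF n] by simp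
    qed
    ultimately show ?thesis
      using tendsto_le[OF sequentially_bot _ entropy_wrt_tendsto[OF Q]] by simp
  qed
  then have "entropy_wrt \<mu> Q \<le> h" by (rule field_le_epsilon)
  then show ?thesis using h(2)[OF n] by simp
qed

end

section \<open>Averaged block measures\<close>

text \<open>The law of a uniformly random translate, by an offset below L, of a randomly coded
  sequence. A coding by blocks of length L is invariant under shifts by L only; the random offset
  restores full invariance.\<close>

definition averaged :: "nat \<Rightarrow> 'w measure \<Rightarrow> ('w \<Rightarrow> int \<Rightarrow> 'a) \<Rightarrow> (int \<Rightarrow> 'a) measure" where
  "averaged L \<rho> \<Phi> = distr (measure_pmf (pmf_of_set {..<L}) \<Otimes>\<^sub>M \<rho>) FS (\<lambda>(j, \<omega>) i. \<Phi> \<omega> (i + int j))"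

context
  fixes L :: nat and \<rho> :: "'w measure" and \<Phi> :: "'w \<Rightarrow> int \<Rightarrow> 'a::finite"
  assumes L: "L > 0" and \<rho>: "prob_space \<rho>" and \<Phi>[measurable]: "\<Phi> \<in> measurable \<rho> FS"
begin

interpretation \<rho>: prob_space \<rho> by fact
interpretation u: prob_space "measure_pmf (pmf_of_set {..<L})" by (rule prob_space_measure_pmf)
interpretation P: pair_prob_space "measure_pmf (pmf_of_set {..<L})" \<rho> ..

lemma averaged_component: "(\<lambda>\<omega> i. \<Phi> \<omega> (i + int j)) \<in> measurable \<rho> FS"
  using measurable_comp[OF \<Phi> translate_measurable[of "int j"]] by (simp add: comp_def)

lemma averaged_measurable:
  "(\<lambda>(j, \<omega>) i. \<Phi> \<omega> (i + int j)) \<in> measurable (measure_pmf (pmf_of_set {..<L}) \<Otimes>\<^sub>M \<rho>) FS"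
proof -
  have "(\<lambda>(j, \<omega>) i. \<Phi> \<omega> (i + int j)) \<in> measurable (count_space UNIV \<Otimes>\<^sub>M \<rho>) FS"
    by (rule measurable_pair_measure_countable1) (use averaged_component in auto)
  moreover have "sets (measure_pmf (pmf_of_set {..<L}) \<Otimes>\<^sub>M \<rho>) = sets (count_space UNIV \<Otimes>\<^sub>M \<rho>)"
    by (intro sets_pair_measure_cong) auto
  ultimately show ?thesis by (subst measurable_cong_sets[OF _ refl])
qed

lemma emeasure_averaged:
  assumes A: "A \<in> sets FS"
  shows "emeasure (averaged L \<rho> \<Phi>) A
    = (\<Sum>j<L. emeasure \<rho> {\<omega>\<in>space \<rho>. (\<lambda>i. \<Phi> \<omega> (i + int j)) \<in> A}) / L"
proof -
  let ?u = "measure_pmf (pmf_of_set {..<L})"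
  let ?T = "\<lambda>(j, \<omega>) i. \<Phi> \<omega> (i + int j)"
  let ?A = "?T -` A \<inter> space (?u \<Otimes>\<^sub>M \<rho>)"
  have "emeasure (averaged L \<rho> \<Phi>) A = emeasure (?u \<Otimes>\<^sub>M \<rho>) ?A"
    unfolding averaged_def by (rule emeasure_distr[OF averaged_measurable A])
  also have "\<dots> = (\<integral>\<^sup>+j. emeasure \<rho> (Pair j -` ?A) \<partial>?u)"
    by (rule \<rho>.emeasure_pair_measure_alt) (rule measurable_sets[OF averaged_measurable A])
  also have "\<dots> = (\<Sum>j<L. emeasure \<rho> (Pair j -` ?A)) / card {..<L}"
    using L by (intro nn_integral_pmf_of_set) auto
  finally have "emeasure (averaged L \<rho> \<Phi>) A = (\<Sum>j<L. emeasure \<rho> (Pair j -` ?A)) / L" by simp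
  moreover have "Pair j -` ?A = {\<omega>\<in>space \<rho>. (\<lambda>i. \<Phi> \<omega> (i + int j)) \<in> A}" for j
    by (auto simp: space_pair_measure)
  ultimately show ?thesis by simp
qed

lemma prob_space_averaged: "prob_space (averaged L \<rho> \<Phi>)"
  unfolding averaged_def by (rule P.prob_space_distr[OF averaged_measurable])

lemma sets_averaged [simp]: "sets (averaged L \<rho> \<Phi>) = sets FS"
  by (simp add: averaged_def)

lemma measure_averaged:
  assumes A: "A \<in> sets FS"
  shows "measure (averaged L \<rho> \<Phi>) A
    = (\<Sum>j<L. measure \<rho> {\<omega>\<in>space \<rho>. (\<lambda>i. \<Phi> \<omega> (i + int j)) \<in> A}) / L"
proof -
  interpret av: prob_space "averaged L \<rho> \<Phi>" by (rule prob_space_averaged)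
  have "ennreal (measure (averaged L \<rho> \<Phi>) A)
      = ennreal ((\<Sum>j<L. measure \<rho> {\<omega>\<in>space \<rho>. (\<lambda>i. \<Phi> \<omega> (i + int j)) \<in> A}) / L)"
    unfolding av.emeasure_eq_measure[symmetric] emeasure_averaged[OF A] \<rho>.emeasure_eq_measure
    using L by (simp add: divide_ennreal[symmetric] sum_nonneg ennreal_of_nat_eq_real_of_nat sum_ennreal)
  then show ?thesis by (subst (asm) ennreal_inj) (auto intro!: sum_nonneg divide_nonneg_nonneg)
qed

lemma integral_averaged:
  fixes g :: "(int \<Rightarrow> 'a) \<Rightarrow> real"
  assumes g: "g \<in> borel_measurable FS" and bd: "\<And>x. \<bar>g x\<bar> \<le> c"
  shows "(\<integral>x. g x \<partial>averaged L \<rho> \<Phi>) = (\<Sum>j<L. \<integral>\<omega>. g (\<lambda>i. \<Phi> \<omega> (i + int j)) \<partial>\<rho>) / L"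
proof -
  let ?u = "measure_pmf (pmf_of_set {..<L})"
  let ?T = "\<lambda>(j, \<omega>) i. \<Phi> \<omega> (i + int j)"
  have int: "integrable (?u \<Otimes>\<^sub>M \<rho>) (\<lambda>p. g (?T p))"
    using bd by (intro P.integrable_const_bound[where B = c])
      (auto intro!: measurable_compose[OF averaged_measurable g] AE_I2)
  have "(\<integral>x. g x \<partial>averaged L \<rho> \<Phi>) = (\<integral>p. g (?T p) \<partial>(?u \<Otimes>\<^sub>M \<rho>))"
    unfolding averaged_def by (rule integral_distr[OF averaged_measurable g])
  also have "\<dots> = (\<integral>j. (\<integral>\<omega>. g (?T (j, \<omega>)) \<partial>\<rho>) \<partial>?u)"
    using P.integral_fst'[OF int] by simp
  also have "\<dots> = (\<Sum>j<L. \<integral>\<omega>. g (?T (j, \<omega>)) \<partial>\<rho>) / card {..<L}"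
    using L by (intro integral_pmf_of_set) auto
  finally show ?thesis by simp
qed

text \<open>One further shift turns the offsets 0..L-1 into 1..L. The offset L has the same
  contribution as 0, because moving by L letters is the measure-preserving map
  \<open>\<theta>\<close> in the source.\<close>

lemma stationary_averaged:
  assumes \<theta>: "\<theta> \<in> measurable \<rho> \<rho>" "distr \<rho> \<rho> \<theta> = \<rho>"
    and equivariant: "\<And>\<omega> i. \<Phi> (\<theta> \<omega>) i = \<Phi> \<omega> (i + int L)"
  shows "stationary (averaged L \<rho> \<Phi>)"
proof -
  interpret av: prob_space "averaged L \<rho> \<Phi>" by (rule prob_space_averaged)
  show ?thesis
  proof unfold_locales
    show "sets (averaged L \<rho> \<Phi>) = sets FS" by simp
    fix A :: "(int \<Rightarrow> 'a) set" assume A: "A \<in> sets FS"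
    define E where "E = (\<lambda>j. emeasure \<rho> {\<omega>\<in>space \<rho>. (\<lambda>i. \<Phi> \<omega> (i + int j)) \<in> A})"
    have "(\<lambda>x i. x (i + 1)) -` A \<inter> space FS \<in> sets FS"
      by (rule measurable_sets[OF translate_measurable A])
    then have A': "shift -` A \<in> sets FS" by (simp add: vimage_def shift_def)
    have "{\<omega>\<in>space \<rho>. (\<lambda>i. \<Phi> \<omega> (i + int 0)) \<in> A} = (\<lambda>\<omega> i. \<Phi> \<omega> (i + int 0)) -` A \<inter> space \<rho>"
      by auto
    then have ev: "{\<omega>\<in>space \<rho>. (\<lambda>i. \<Phi> \<omega> (i + int 0)) \<in> A} \<in> sets \<rho>"
      using measurable_sets[OF averaged_component A, of 0] by (simp only:)
    have eqv: "\<Phi> (\<theta> \<omega>) = (\<lambda>i. \<Phi> \<omega> (i + int L))" for \<omega> by (rule ext) (rule equivariant)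
    have "E L = emeasure \<rho> (\<theta> -` {\<omega>\<in>space \<rho>. (\<lambda>i. \<Phi> \<omega> (i + int 0)) \<in> A} \<inter> space \<rho>)"
      unfolding E_def using measurable_space[OF \<theta>(1)]
      by (intro arg_cong[of _ _ "emeasure \<rho>"]) (auto simp: eqv)
    also have "\<dots> = E 0"
      unfolding E_def emeasure_distr[OF \<theta>(1) ev, symmetric] \<theta>(2) ..
    finally have EL: "E L = E 0" .
    have "emeasure (averaged L \<rho> \<Phi>) (shift -` A) = (\<Sum>j<L. E (Suc j)) / L"
      unfolding emeasure_averaged[OF A'] E_def by (simp add: shift_def algebra_simps)
    also have "(\<Sum>j<L. E (Suc j)) = (\<Sum>j<L. E j)"
    proof -
      obtain l where l: "L = Suc l" using L by (cases L) auto
      have "(\<Sum>j<L. E (Suc j)) = (\<Sum>j<l. E (Suc j)) + E L" by (simp add: l)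
      also have "\<dots> = (\<Sum>j<L. E j)" unfolding EL unfolding l sum.lessThan_Suc_shift by (rule add.commute)
      finally show ?thesis .
    qed
    also have "\<dots> / L = emeasure (averaged L \<rho> \<Phi>) A"
      unfolding emeasure_averaged[OF A] E_def ..
    finally show "emeasure (averaged L \<rho> \<Phi>) (shift -` A) = emeasure (averaged L \<rho> \<Phi>) A" .
  qed
qed

end

lemma finite_rv_words_of_map:
  fixes \<Phi> :: "'w \<Rightarrow> int \<Rightarrow> 'a::finite"
  assumes "prob_space \<rho>" "\<Phi> \<in> measurable \<rho> FS"
  shows "prob_space.finite_rv \<rho> (\<lambda>\<omega>. word (\<Phi> \<omega>) i m)"
proof -
  interpret prob_space \<rho> by fact
  have "finite ((\<lambda>\<omega>. word (\<Phi> \<omega>) i m) ` space \<rho>)"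
    by (rule finite_subset[OF _ finite_words[of m]]) auto
  moreover have "{\<omega>\<in>space \<rho>. word (\<Phi> \<omega>) i m = v} \<in> events" for v
  proof -
    have "{\<omega>\<in>space \<rho>. word (\<Phi> \<omega>) i m = v} = \<Phi> -` {x. word x i m = v} \<inter> space \<rho>" by auto
    then show ?thesis using measurable_sets[OF assms(2) word_set[of i m v]] by (simp only:)
  qed
  ultimately show ?thesis unfolding finite_rv_def by blast
qed

text \<open>Entropy is concave: apply the Gibbs inequality to each translate with the averaged law as reference.\<close>
lemma averaged_entropy_ge:
  fixes \<Phi> :: "(int \<Rightarrow> 'w) \<Rightarrow> int \<Rightarrow> 'a::finite"
  assumes L: "L > 0" and \<rho>: "process \<rho>" and \<Phi>: "\<Phi> \<in> measurable \<rho> FS"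
    and st: "stationary (averaged L \<rho> \<Phi>)"
  shows "(\<Sum>j<L. part_entropy \<rho> (\<lambda>\<omega>. word (\<Phi> \<omega>) (int j) n)) / L
    \<le> stationary.word_entropy (averaged L \<rho> \<Phi>) n"
proof -
  interpret \<rho>: process \<rho> by fact
  interpret av: stationary "averaged L \<rho> \<Phi>" by fact
  note ps = \<rho>.prob_space_axioms
  define W where "W = (\<lambda>j \<omega>. word (\<Phi> \<omega>) (int j) n)"
  have W: "\<rho>.finite_rv (W j)" for j
    unfolding W_def by (rule finite_rv_words_of_map[OF ps \<Phi>])
  define q where "q = av.pr (\<lambda>x. word x 0 n)"
  have q: "q w = (\<Sum>j<L. \<rho>.pr (W j) w) / L" for w
  proof -
    have "q w = measure (averaged L \<rho> \<Phi>) {x. word x 0 n = w}" by (simp add: q_def av.pr_def)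
    also have "\<dots> = (\<Sum>j<L. \<rho>.pr (W j) w) / L"
      unfolding measure_averaged[OF L ps \<Phi> word_set] by (simp add: \<rho>.pr_def W_def word_translate)
    finally show ?thesis .
  qed
  have finA: "finite {w :: 'a list. length w = n}" by (rule finite_words)
  have qsum: "(\<Sum>w\<in>W j ` space \<rho>. q w) \<le> 1" for j
  proof -
    have "(\<Sum>w\<in>W j ` space \<rho>. q w) \<le> (\<Sum>w\<in>{w. length w = n}. q w)"
      using finA by (intro sum_mono2) (auto simp: W_def q_def)
    also have "\<dots> = (\<Sum>w\<in>range (\<lambda>x. word x 0 n). q w)"
    proof (rule sum.mono_neutral_right[OF finA])
      show "\<forall>w\<in>{w. length w = n} - range (\<lambda>x. word x 0 n). q w = 0"
      proof
        fix w :: "'a list" assume w: "w \<in> {w. length w = n} - range (\<lambda>x. word x 0 n)"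
        have "word x 0 n \<noteq> w" for x :: "int \<Rightarrow> 'a" using w by blast
        then show "q w = 0" by (simp add: q_def av.pr_def)
      qed
    qed auto
    also have "\<dots> = 1" using av.pr_sum[OF av.finite_rv_word[of 0 n]] by (simp add: q_def)
    finally show ?thesis .
  qed
  have le: "part_entropy \<rho> (W j) \<le> (\<integral>\<omega>. - ln (q (W j \<omega>)) \<partial>\<rho>)" if j: "j < L" for j
  proof (rule \<rho>.gibbs_inequality[OF W])
    fix w assume w: "\<rho>.pr (W j) w > 0"
    have "\<rho>.pr (W j) w \<le> (\<Sum>j<L. \<rho>.pr (W j) w)" using j by (intro member_le_sum) auto
    then show "q w > 0" using w L by (simp add: q)
  qed (use qsum in \<open>auto simp: q_def\<close>)
  have "(\<Sum>j<L. part_entropy \<rho> (W j)) \<le> (\<Sum>j<L. \<integral>\<omega>. - ln (q (W j \<omega>)) \<partial>\<rho>)"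
    using le by (intro sum_mono) auto
  also have "\<dots> = (\<Sum>j<L. \<Sum>w\<in>{w. length w = n}. \<rho>.pr (W j) w * - ln (q w))"
  proof (intro sum.cong refl)
    fix j
    have "(\<integral>\<omega>. - ln (q (W j \<omega>)) \<partial>\<rho>) = (\<Sum>w\<in>W j ` space \<rho>. \<rho>.pr (W j) w * - ln (q w))"
      by (rule \<rho>.finite_rv_integral(2)[OF W])
    also have "\<dots> = (\<Sum>w\<in>{w. length w = n}. \<rho>.pr (W j) w * - ln (q w))"
    proof (rule sum.mono_neutral_left[OF finA])
      show "\<forall>w\<in>{w. length w = n} - W j ` space \<rho>. \<rho>.pr (W j) w * - ln (q w) = 0"
      proof
        fix w assume "w \<in> {w. length w = n} - W j ` space \<rho>"
        then have "{\<omega>\<in>space \<rho>. W j \<omega> = w} = {}" by auto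
        then show "\<rho>.pr (W j) w * - ln (q w) = 0"
          by (simp only: \<rho>.pr_def measure_empty mult_zero_left)
      qed
    qed (auto simp: W_def)
    finally show "(\<integral>\<omega>. - ln (q (W j \<omega>)) \<partial>\<rho>) = (\<Sum>w\<in>{w. length w = n}. \<rho>.pr (W j) w * - ln (q w))" .
  qed
  also have "\<dots> = (\<Sum>w\<in>{w. length w = n}. real L * (q w * - ln (q w)))"
    using L by (subst sum.swap) (simp add: q sum_distrib_right[symmetric] sum_negf)
  also have "\<dots> = real L * (\<Sum>w\<in>range (\<lambda>x. word x 0 n). q w * - ln (q w))"
    unfolding sum_distrib_left
  proof (rule sum.mono_neutral_right[OF finA])
    show "\<forall>w\<in>{w. length w = n} - range (\<lambda>x. word x 0 n). real L * (q w * - ln (q w)) = 0"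
    proof
      fix w :: "'a list" assume w: "w \<in> {w. length w = n} - range (\<lambda>x. word x 0 n)"
      have "word x 0 n \<noteq> w" for x :: "int \<Rightarrow> 'a" using w by blast
      then show "real L * (q w * - ln (q w)) = 0" by (simp add: q_def av.pr_def)
    qed
  qed auto
  also have "\<dots> = real L * av.word_entropy n"
    unfolding av.word_entropy_def av.part_entropy_eq[OF av.finite_rv_word] q_def
    using av.finite_rv_integral(2)[OF av.finite_rv_word[of 0 n], of "\<lambda>w. - ln (av.pr (\<lambda>x. word x 0 n) w)"]
    by simp
  finally show ?thesis using L by (simp add: W_def field_simps)
qed

text \<open>The product space also contains sequences that leave \<open>S\<close>; composing with the retraction \<open>c\<close> onto
  \<open>S\<close> makes the coordinates random variables of finite range.\<close>
context
  fixes p :: "'w pmf" and c :: "'w \<Rightarrow> 'w" and S :: "'w set"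
  assumes S: "finite S" "set_pmf p \<subseteq> S" and c: "\<And>v. v \<in> S \<Longrightarrow> c v = v" "\<And>v. c v \<in> S"
begin

abbreviation "iid \<equiv> PiM (UNIV :: int set) (\<lambda>_. measure_pmf p)"

lemma process_iid: "process iid"
  unfolding process_def by (rule prob_space_PiM) (rule prob_space_measure_pmf)

interpretation iid: process iid by (rule process_iid)

interpretation prod: product_prob_space "\<lambda>_::int. measure_pmf p" UNIV
  by (simp add: product_prob_space_def product_sigma_finite_def product_prob_space_axioms_def
      prob_space_measure_pmf prob_space_imp_sigma_finite)

lemma space_iid: "space iid = UNIV"
  by (simp add: space_PiM)

lemma clamp_prob: "v \<in> S \<Longrightarrow> measure (measure_pmf p) {u. c u = v} = pmf p v"
proof -
  assume v: "v \<in> S"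
  have "measure (measure_pmf p) {u. c u = v} = measure (measure_pmf p) {v}"
    using S c v by (intro measure_pmf.finite_measure_eq_AE) (auto simp: AE_measure_pmf_iff)
  then show ?thesis by (simp add: measure_pmf_single)
qed

lemma iid_prob:
  assumes "finite J" "\<And>i. i \<in> J \<Longrightarrow> v i \<in> S"
  shows "measure iid {\<omega>. \<forall>i\<in>J. c (\<omega> i) = v i} = (\<Prod>i\<in>J. pmf p (v i))"
proof -
  have "emeasure iid {\<omega>\<in>space iid. \<forall>i\<in>J. \<omega> i \<in> {u. c u = v i}} = (\<Prod>i\<in>J. emeasure (measure_pmf p) {u. c u = v i})"
    using assms by (intro prod.emeasure_PiM_Collect) auto
  also have "\<dots> = (\<Prod>i\<in>J. ennreal (pmf p (v i)))"
    using assms clamp_prob by (intro prod.cong) (auto simp: measure_pmf.emeasure_eq_measure)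
  also have "\<dots> = ennreal (\<Prod>i\<in>J. pmf p (v i))"
    by (rule prod_ennreal) simp
  finally show ?thesis by (simp add: space_iid iid.emeasure_eq_measure prod_nonneg)
qed

lemma iid_coordinate_set: "{\<omega>. P (\<omega> i)} \<in> sets iid"
proof -
  have "(\<lambda>\<omega>. \<omega> i) \<in> measurable iid (measure_pmf p)" by measurable
  from measurable_sets[OF this, of "Collect P"] show ?thesis
    by (simp add: space_iid vimage_def)
qed

lemma finite_rv_clamp: "iid.finite_rv (\<lambda>\<omega>. c (\<omega> i))"
  using iid_coordinate_set[of "\<lambda>u. c u = v" i for v] finite_subset[OF _ S(1), of "range (\<lambda>\<omega>. c (\<omega> i))"] c(2)
  by (auto simp: iid.finite_rv_def space_iid)

lemma iid_integral:
  fixes g :: "'w \<Rightarrow> real"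
  shows "integrable iid (\<lambda>\<omega>. g (c (\<omega> i)))"
    and "(\<integral>\<omega>. g (c (\<omega> i)) \<partial>iid) = (\<Sum>v\<in>S. pmf p v * g v)"
proof -
  show "integrable iid (\<lambda>\<omega>. g (c (\<omega> i)))" by (rule iid.finite_rv_integral(1)[OF finite_rv_clamp])
  have "(\<lambda>\<omega>. c (\<omega> i)) ` space iid = S"
  proof (intro equalityI subsetI)
    fix v assume "v \<in> S"
    then show "v \<in> (\<lambda>\<omega>. c (\<omega> i)) ` space iid"
      using c(1) by (intro image_eqI[of _ _ "\<lambda>_. v"]) (auto simp: space_iid)
  qed (use c(2) in auto)
  then have "(\<integral>\<omega>. g (c (\<omega> i)) \<partial>iid) = (\<Sum>v\<in>S. iid.pr (\<lambda>\<omega>. c (\<omega> i)) v * g v)"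
    using iid.finite_rv_integral(2)[OF finite_rv_clamp, of g i] by simp
  also have "\<dots> = (\<Sum>v\<in>S. pmf p v * g v)"
    using iid_prob[of "{i}" "\<lambda>_. v" for v]
    by (intro sum.cong refl) (simp add: iid.pr_def space_iid)
  finally show "(\<integral>\<omega>. g (c (\<omega> i)) \<partial>iid) = (\<Sum>v\<in>S. pmf p v * g v)" .
qed

text \<open>The blocks start with number 1: a window that begins inside block 0 may cut that block,
  but it contains the following k blocks completely.\<close>

lemma iid_entropy:
  "part_entropy iid (\<lambda>\<omega>. map (\<lambda>i. c (\<omega> (int i + 1))) [0..<k]) = real k * (\<Sum>v\<in>S. - pmf p v * ln (pmf p v))"
proof -
  let ?V = "\<lambda>\<omega>. map (\<lambda>i. c (\<omega> (int i + 1))) [0..<k]"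
  have ev: "{\<omega>. ?V \<omega> = v} \<in> sets iid" for v
  proof (cases "length v = k")
    case True
    have "{\<omega>. ?V \<omega> = v} = {\<omega>\<in>space iid. \<forall>i\<in>{..<k}. c (\<omega> (int i + 1)) = v ! i}"
      using True by (auto simp: list_eq_iff_nth_eq space_iid)
    also have "\<dots> \<in> sets iid"
      using iid_coordinate_set[of "\<lambda>u. c u = v ! i" "int i + 1" for i]
      by (intro sets.sets_Collect_finite_All) (auto simp: space_iid)
    finally show ?thesis .
  next
    case False
    then have "{\<omega>. ?V \<omega> = v} = {}" by auto
    then show ?thesis by simp
  qed
  have "finite (range ?V)"
    using c(2) by (intro finite_subset[OF _ finite_lists_length_eq[OF S(1), of k]]) auto
  then have V: "iid.finite_rv ?V" using ev by (simp add: iid.finite_rv_def space_iid)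
  have pr: "iid.pr ?V (?V \<omega>) = (\<Prod>i<k. pmf p (c (\<omega> (int i + 1))))" for \<omega>
  proof -
    have "{\<xi>. ?V \<xi> = ?V \<omega>} = {\<xi>. \<forall>j\<in>(\<lambda>i. int i + 1) ` {..<k}. c (\<xi> j) = c (\<omega> j)}"
      by (auto simp: list_eq_iff_nth_eq)
    then have "iid.pr ?V (?V \<omega>) = (\<Prod>j\<in>(\<lambda>i. int i + 1) ` {..<k}. pmf p (c (\<omega> j)))"
      unfolding iid.pr_def space_iid using iid_prob[of "(\<lambda>i. int i + 1) ` {..<k}" "\<lambda>j. c (\<omega> j)"] c(2) by simp
    also have "\<dots> = (\<Prod>i<k. pmf p (c (\<omega> (int i + 1))))"
      by (subst prod.reindex) (auto simp: inj_on_def)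
    finally show ?thesis .
  qed
  have "AE \<omega> in iid. (\<Prod>i<k. pmf p (c (\<omega> (int i + 1)))) > 0"
    using iid.AE_pr_pos[OF V] by (simp add: pr)
  then have "AE \<omega> in iid. - ln (iid.pr ?V (?V \<omega>)) = (\<Sum>i<k. - ln (pmf p (c (\<omega> (int i + 1)))))"
  proof eventually_elim
    case (elim \<omega>)
    then have "pmf p (c (\<omega> (int i + 1))) \<noteq> 0" if "i < k" for i
      using that by (metis (no_types, lifting) finite_lessThan lessThan_iff less_irrefl prod_zero)
    then show ?case unfolding pr by (subst ln_prod) (auto simp: sum_negf)
  qed
  then have "part_entropy iid ?V = (\<integral>\<omega>. (\<Sum>i<k. - ln (pmf p (c (\<omega> (int i + 1))))) \<partial>iid)"
    unfolding iid.part_entropy_eq[OF V]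
    using iid.finite_rv_integral(1)[OF V, of "\<lambda>v. - ln (iid.pr ?V v)"] iid_integral(1)[of "\<lambda>v. - ln (pmf p v)"]
    by (intro integral_cong_AE borel_measurable_sum) auto
  also have "\<dots> = (\<Sum>i<k. \<integral>\<omega>. - ln (pmf p (c (\<omega> (int i + 1)))) \<partial>iid)"
    using iid_integral(1)[of "\<lambda>v. - ln (pmf p v)"] by (intro Bochner_Integration.integral_sum) auto
  also have "\<dots> = real k * (\<Sum>v\<in>S. pmf p v * - ln (pmf p v))"
    unfolding iid_integral(2)[of "\<lambda>v. - ln (pmf p v)"] by simp
  finally show ?thesis by simp
qed

lemma iid_shift:
  "(\<lambda>\<omega> i. \<omega> (i + 1)) \<in> measurable iid iid" "distr iid iid (\<lambda>\<omega> i. \<omega> (i + 1)) = iid"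
proof -
  show "(\<lambda>\<omega> i. \<omega> (i + 1)) \<in> measurable iid iid"
    by (intro measurable_PiM_single' measurable_component_singleton) (auto simp: space_PiM)
  show "distr iid iid (\<lambda>\<omega> i. \<omega> (i + 1)) = iid"
    using distr_PiM_reindex[of UNIV "\<lambda>_. measure_pmf p" "\<lambda>i::int. i + 1" UNIV]
    by (simp add: prob_space_measure_pmf inj_on_def restrict_def)
qed

end

section \<open>The lower Gibbs bound for equilibrium states\<close>

lemma div_mod_int_add_less:
  fixes i k L :: int
  assumes "0 \<le> k" "i mod L + k < L" "L > 0"
  shows "(i + k) div L = i div L" "(i + k) mod L = i mod L + k"
proof -
  have e: "i + k = L * (i div L) + (i mod L + k)" by simp
  have b: "0 \<le> i mod L + k" using assms by (simp add: add_nonneg_nonneg)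
  show "(i + k) div L = i div L"
    by (rule int_div_pos_eq[OF e b assms(2)])
  show "(i + k) mod L = i mod L + k"
    by (rule int_mod_pos_eq[OF e b assms(2)])
qed

lemma div_mod_int_add_ge:
  fixes i k L :: int
  assumes "L \<le> i mod L + k" "i mod L + k < 2 * L" "L > 0"
  shows "(i + k) div L = i div L + 1" "(i + k) mod L = i mod L + k - L"
proof -
  have e: "i + k = L * (i div L + 1) + (i mod L + k - L)" by (simp add: algebra_simps)
  have b: "0 \<le> i mod L + k - L" "i mod L + k - L < L" using assms by auto
  show "(i + k) div L = i div L + 1"
    by (rule int_div_pos_eq[OF e b])
  show "(i + k) mod L = i mod L + k - L"
    by (rule int_mod_pos_eq[OF e b])
qed

text \<open>The word entropy bounds all partition entropies at once. This proves the upper estimate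
  and also bounds the set whose real supremum is taken, without which no partition could be compared
  with that supremum.\<close>

lemma (in stationary) ks_entropy_le:
  assumes "n \<ge> 1"
  shows "ks_entropy \<mu> \<le> word_entropy n / real n"
    and "P \<in> measurable FS (count_space UNIV) \<Longrightarrow> finite (range P) \<Longrightarrow> entropy_wrt \<mu> P \<le> ks_entropy \<mu>"
proof -
  let ?\<P> = "{P. P \<in> measurable FS (count_space UNIV) \<and> finite (range P)} :: ((int \<Rightarrow> 'a) \<Rightarrow> nat) set"
  have rv: "finite_rv P" if "P \<in> ?\<P>" for P
  proof -
    have "P -` {v} \<inter> space FS \<in> sets FS" for v using that by (intro measurable_sets[of P FS "count_space UNIV"]) auto
    then show ?thesis using that by (simp add: finite_rv_def sets_eq vimage_def)
  qed
  have bdd: "bdd_above (entropy_wrt \<mu> ` ?\<P>)"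
    using entropy_wrt_le[OF rv assms] by (intro bdd_aboveI2) auto
  show "entropy_wrt \<mu> P \<le> ks_entropy \<mu>" if "P \<in> measurable FS (count_space UNIV)" "finite (range P)"
    unfolding ks_entropy_def using that bdd by (intro cSUP_upper) auto
  have "(\<lambda>_. 0) \<in> ?\<P>" by simp
  then have "?\<P> \<noteq> {}" by blast
  then show "ks_entropy \<mu> \<le> word_entropy n / real n"
    unfolding ks_entropy_def using entropy_wrt_le[OF rv assms] by (rule cSUP_least)
qed

text \<open>The supremum runs over partitions labelled by natural numbers, so the zeroth coordinate
  is encoded by \<open>to_nat\<close> and decoded again. Lengths that are multiples of b suffice
  since the entropy rate is a limit.\<close>

lemma (in stationary) ks_entropy_ge:
  assumes b: "b > 0" and ge: "\<And>k. real k * h \<le> word_entropy ((k + 1) * b)"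
  shows "h / real b \<le> ks_entropy \<mu>"
proof -
  define P :: "(int \<Rightarrow> 'a) \<Rightarrow> nat" where "P = (\<lambda>x. to_nat (x 0))"
  have fin: "finite (range P)"
    by (rule finite_subset[of _ "range (to_nat :: 'a \<Rightarrow> nat)"]) (auto simp: P_def)
  have meas: "P \<in> measurable FS (count_space UNIV)"
    unfolding P_def by (rule measurable_compose[OF FS_component]) simp
  have P: "finite_rv P"
    using finite_rv_compose[OF finite_rv_coordinate, of to_nat] by (simp add: P_def)
  have le: "word_entropy n \<le> part_entropy \<mu> (itinerary P n)" for n
  proof -
    have "word x 0 n = map from_nat (itinerary P n x)" for x
      by (simp add: word_def itinerary_def P_def shift_funpow)
    then show ?thesis unfolding word_entropy_def
      using part_entropy_compose_le[OF finite_rv_itinerary[OF P, of n], of "map from_nat"] by simp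
  qed
  define s where "s = (\<lambda>k::nat. (k + 1) * b)"
  have "strict_mono s" unfolding s_def using b by (intro strict_monoI) simp
  then have lim: "(\<lambda>k. part_entropy \<mu> (itinerary P (s k)) / real (s k)) \<longlonglongrightarrow> entropy_wrt \<mu> P"
    using LIMSEQ_subseq_LIMSEQ[OF entropy_wrt_tendsto[OF P], of s] by (simp add: o_def)
  have lim2: "(\<lambda>k. real k * h / (real (k + 1) * real b)) \<longlonglongrightarrow> h / real b"
  proof -
    have "(\<lambda>k. real k / real (k + 1) * (h / real b)) \<longlonglongrightarrow> 1 * (h / real b)"
      by (intro tendsto_mult tendsto_const LIMSEQ_n_over_Suc_n[unfolded Suc_eq_plus1])
    then show ?thesis by simp
  qed
  have "h / real b \<le> entropy_wrt \<mu> P"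
  proof (rule tendsto_le[OF sequentially_bot lim lim2])
    have "real k * h / (real (k + 1) * real b) \<le> part_entropy \<mu> (itinerary P (s k)) / real (s k)" for k
    proof -
      have "real k * h \<le> part_entropy \<mu> (itinerary P (s k))"
        using ge[of k] le[of "s k"] by (simp add: s_def)
      then have "real k * h / real (s k) \<le> part_entropy \<mu> (itinerary P (s k)) / real (s k)"
        by (rule divide_right_mono) simp
      moreover have "real (s k) = real (k + 1) * real b" by (simp only: s_def of_nat_mult)
      ultimately show ?thesis by (simp only:)
    qed
    then show "\<forall>\<^sub>F k in sequentially. real k * h / (real (k + 1) * real b) \<le> part_entropy \<mu> (itinerary P (s k)) / real (s k)"
      by simp
  qed
  then show ?thesis using ks_entropy_le(2)[OF order_refl meas fin] by simp
qed

section \<open>A Bernoulli horseshoe whose free energy approaches the pressure\<close>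

context sft_system
begin

lemma X_sets: "X \<in> sets FS"
proof -
  have "X = (\<Inter>i::int. \<Union>w\<in>lang X N0. {x. word x i N0 = w})"
  proof (intro equalityI subsetI)
    fix z assume z: "z \<in> (\<Inter>i::int. \<Union>w\<in>lang X N0. {x. word x i N0 = w})"
    show "z \<in> X"
    proof (rule window[OF order_refl])
      fix i :: int
      have "word z i N0 \<in> lang X N0" using z by auto
      then obtain x j where "x \<in> X" "word z i N0 = word x j N0" by (auto simp: lang_def)
      then show "\<exists>x\<in>X. \<exists>j. \<forall>k<N0. z (i + int k) = x (j + int k)"
        unfolding word_eq_iff by blast
    qed
  qed auto
  also have "\<dots> \<in> sets FS" by (intro sets.countable_INT' sets.finite_UN) auto
  finally show ?thesis .
qed

text \<open>Words of length M are drawn independently with probability proportional to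
  \<open>exp (Smf X f v)\<close>, and neighbours are glued. For these weights block entropy plus
  mean energy is exactly \<open>ln (Z X M)\<close>; the gaps and the distortion account for the
  remaining terms.\<close>

lemma horseshoe_measure:
  assumes fm: "(\<lambda>x. indicator X x * f x) \<in> borel_measurable FS"
    and M: "M \<ge> N0" "M \<ge> 1"
  obtains \<nu> where "invariant_on X \<nu>"
    "(ln (Z X M) - V - B * real G) / real (M + G) \<le> ks_entropy \<nu> + (\<integral>x. indicator X x * f x \<partial>\<nu>)"
proof -
  define L where "L = M + G"
  have L: "L > 0" "M \<le> L" using M by (auto simp: L_def)
  define S where "S = lang X M"
  have S: "finite S" "S \<noteq> {}" by (auto simp: S_def lang_nonempty[OF nonempty])
  have Zp: "Z X M > 0" by (rule Z_pos[OF nonempty])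
  define pf where "pf = (\<lambda>v. if v \<in> S then exp (Smf X f v) / Z X M else 0)"
  have pf0: "pf v \<ge> 0" for v using Zp by (simp add: pf_def)
  have "(\<integral>\<^sup>+v. ennreal (pf v) \<partial>count_space UNIV) = (\<Sum>v\<in>S. ennreal (pf v))"
    using S(1) by (intro nn_integral_count_space') (auto simp: pf_def)
  also have "\<dots> = ennreal (\<Sum>v\<in>S. pf v)" using pf0 by simp
  also have "(\<Sum>v\<in>S. pf v) = 1"
    using Zp by (simp add: pf_def sum_divide_distrib[symmetric] S_def Z_def)
  finally have pf1: "(\<integral>\<^sup>+v. ennreal (pf v) \<partial>count_space UNIV) = 1" by simp
  define p where "p = embed_pmf pf"
  have p: "pmf p v = pf v" for v unfolding p_def by (rule pmf_embed_pmf[OF pf0 pf1])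
  have pS: "set_pmf p \<subseteq> S" by (auto simp: set_pmf_eq p pf_def)
  define c where "c = (\<lambda>v. if v \<in> S then v else (SOME v. v \<in> S))"
  have c: "\<And>v. v \<in> S \<Longrightarrow> c v = v" "\<And>v. c v \<in> S"
    using S(2) some_in_eq by (auto simp: c_def)
  \<comment> \<open>The filler is chosen from the two neighbouring blocks alone, so that the glued
    sequence is a local function of the independent blocks.\<close>
  have "\<exists>y\<in>X. (\<forall>i<M. y (int i) = v ! i) \<and> (\<forall>i<M. y (int i + int L) = v' ! i)"
    if v: "v \<in> S" "v' \<in> S" for v v'
  proof -
    obtain g where g: "length g = G" "v @ g @ v' \<in> lang X (M + G + M)"
      using glue_words[of v M v' M] v unfolding S_def by blast
    obtain y where y: "y \<in> X" "word y 0 (M + G + M) = v @ g @ v'" using lang_obtain[OF X_inv g(2)] .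
    have lv: "length v = M" using v(1) lang_length by (auto simp: S_def)
    have e: "y (int k) = (v @ g @ v') ! k" if "k < M + G + M" for k
      using nth_word[of k "M + G + M" y 0] that y(2) by simp
    have "y (int i) = v ! i" if "i < M" for i using e[of i] that lv by (simp add: nth_append)
    moreover have "y (int i + int L) = v' ! i" if "i < M" for i
      using e[of "i + L"] that lv g(1) by (simp add: nth_append L_def)
    ultimately show ?thesis using y(1) by blast
  qed
  then obtain Y where Y: "\<And>v v'. v \<in> S \<Longrightarrow> v' \<in> S \<Longrightarrow> Y v v' \<in> X"
    "\<And>v v' i. v \<in> S \<Longrightarrow> v' \<in> S \<Longrightarrow> i < M \<Longrightarrow> Y v v' (int i) = v ! i"
    "\<And>v v' i. v \<in> S \<Longrightarrow> v' \<in> S \<Longrightarrow> i < M \<Longrightarrow> Y v v' (int i + int L) = v' ! i"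
    by metis
  \<comment> \<open>A window of length M starting in block q ends at the latest with the word of
    block q + 1, so it is visible in the single point \<open>Y\<close> chosen for this pair. As M is
    at least \<open>N0\<close>, \<open>window\<close> then puts the whole sequence into X.\<close>
  define \<Phi> where "\<Phi> = (\<lambda>\<omega> (i::int). Y (c (\<omega> (i div int L))) (c (\<omega> (i div int L + 1))) (i mod int L))"
  have \<Phi>X: "\<Phi> \<omega> \<in> X" for \<omega>
  proof (rule window[OF M(1)])
    fix i :: int
    define q where "q = i div int L"
    define y where "y = Y (c (\<omega> q)) (c (\<omega> (q + 1)))"
    have "\<Phi> \<omega> (i + int k) = y (i mod int L + int k)" if k: "k < M" for k
    proof (cases "i mod int L + int k < int L")
      case True
      then have "(i + int k) div int L = q" "(i + int k) mod int L = i mod int L + int k"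
        using div_mod_int_add_less[of "int k" i "int L"] L by (auto simp: q_def)
      then show ?thesis by (simp add: \<Phi>_def y_def)
    next
      case False
      have lt: "i mod int L < int L" using L by simp
      define t where "t = nat (i mod int L + int k - int L)"
      have t: "int t = i mod int L + int k - int L" "t < M"
        using False lt k by (auto simp: t_def)
      have "(i + int k) div int L = q + 1" "(i + int k) mod int L = int t"
        using div_mod_int_add_ge[of "int L" i "int k"] False lt k L t by (auto simp: q_def)
      then have "\<Phi> \<omega> (i + int k) = c (\<omega> (q + 1)) ! t"
        using Y(2)[OF c(2) c(2) t(2)] by (simp add: \<Phi>_def)
      also have "\<dots> = y (int t + int L)" unfolding y_def using Y(3)[OF c(2) c(2) t(2)] by simp
      finally show ?thesis using t(1) by simp
    qed
    then show "\<exists>x\<in>X. \<exists>j. \<forall>k<M. \<Phi> \<omega> (i + int k) = x (j + int k)"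
      using Y(1)[OF c(2) c(2)] unfolding y_def by blast
  qed
  have \<Phi>_block: "word (\<Phi> \<omega>) (int j * int L) M = c (\<omega> (int j))" for \<omega> j
  proof (rule nth_equalityI)
    show "length (word (\<Phi> \<omega>) (int j * int L) M) = length (c (\<omega> (int j)))"
      using c(2)[of "\<omega> (int j)"] lang_length by (auto simp: S_def)
    fix i assume "i < length (word (\<Phi> \<omega>) (int j * int L) M)"
    then have i: "i < M" by simp
    then have "(int j * int L + int i) div int L = int j" "(int j * int L + int i) mod int L = int i"
      using div_mod_int_add_less[of "int i" "int j * int L" "int L"] L by auto
    then show "word (\<Phi> \<omega>) (int j * int L) M ! i = c (\<omega> (int j)) ! i"
      using i Y(2)[OF c(2) c(2) i] by (simp add: \<Phi>_def)
  qed
  define \<rho> where "\<rho> = PiM (UNIV :: int set) (\<lambda>_. measure_pmf p)"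
  note iid = S(1) pS c
  interpret \<rho>: process \<rho> unfolding \<rho>_def by (rule process_iid[OF iid])
  have \<rho>ps: "prob_space \<rho>" by unfold_locales
  have sp: "space \<rho> = UNIV" unfolding \<rho>_def by (rule space_iid[OF iid])
  have \<Phi>m: "\<Phi> \<in> measurable \<rho> FS"
  proof (rule measurable_FS_I)
    fix i :: int and a :: 'a
    define q where "q = i div int L"
    have "{\<omega>\<in>space \<rho>. \<Phi> \<omega> i = a} = (\<Union>(v, v')\<in>{(v, v')\<in>S \<times> S. Y v v' (i mod int L) = a}.
        {\<omega>. c (\<omega> q) = v} \<inter> {\<omega>. c (\<omega> (q + 1)) = v'})"
      using c(2) by (auto simp: \<Phi>_def q_def sp)
    also have "\<dots> \<in> sets \<rho>"
      unfolding \<rho>_def using iid_coordinate_set[OF iid, of "\<lambda>u. c u = v" j for v j] S(1)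
      by (intro sets.finite_UN) (auto intro: finite_subset[of _ "S \<times> S"])
    finally show "{\<omega>\<in>space \<rho>. \<Phi> \<omega> i = a} \<in> sets \<rho>" .
  qed
  define \<nu> where "\<nu> = averaged L \<rho> \<Phi>"
  have equi: "\<Phi> (\<lambda>i. \<omega> (i + 1)) i = \<Phi> \<omega> (i + int L)" for \<omega> i
    using L by (simp add: \<Phi>_def add.assoc)
  interpret \<nu>: stationary \<nu>
    unfolding \<nu>_def by (rule stationary_averaged[OF L(1) \<rho>ps \<Phi>m, of "\<lambda>\<omega> i. \<omega> (i + 1)"])
      (use iid_shift[OF iid] equi in \<open>auto simp: \<rho>_def\<close>)
  have in_X: "{\<omega>\<in>space \<rho>. (\<lambda>i. \<Phi> \<omega> (i + int j)) \<in> X} = space \<rho>" for j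
    using \<Phi>X X_translate by auto
  have inv: "invariant_on X \<nu>"
  proof -
    have "measure \<nu> X = 1"
      unfolding \<nu>_def measure_averaged[OF L(1) \<rho>ps \<Phi>m X_sets] in_X using L by (simp add: \<rho>.prob_space)
    then have "emeasure \<nu> X = 1" by (simp add: \<nu>.emeasure_eq_measure)
    then show ?thesis unfolding invariant_on_def
      using \<nu>.prob_space_axioms \<nu>.sets_eq X_sets \<nu>.shift_inv by auto
  qed
  define H where "H = (\<Sum>v\<in>S. - pmf p v * ln (pmf p v))"
  have "real k * H \<le> \<nu>.word_entropy ((k + 1) * L)" for k
  proof -
    define n where "n = (k + 1) * L"
    have "real k * H \<le> part_entropy \<rho> (\<lambda>\<omega>. word (\<Phi> \<omega>) (int j) n)" if j: "j < L" for j
    proof -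
      \<comment> \<open>Recovers k complete blocks from the long word: as the word starts at offset
        j, block i + 1 begins at place (i + 1) L - j of it.\<close>
      define g where "g = (\<lambda>w. map (\<lambda>i. take M (drop ((i + 1) * L - j) w)) [0..<k] :: 'a list list)"
      have "g (word (\<Phi> \<omega>) (int j) n) = map (\<lambda>i. c (\<omega> (int i + 1))) [0..<k]" for \<omega>
      proof -
        have "take M (drop ((i + 1) * L - j) (word (\<Phi> \<omega>) (int j) n)) = c (\<omega> (int i + 1))" if i: "i < k" for i
        proof -
          have jl: "j \<le> (i + 1) * L" using j by (simp add: trans_le_add1)
          have "(i + 1) * L + L \<le> (k + 1) * L"
            using i mult_right_mono[of "i + 2" "k + 1" L] by (simp add: algebra_simps)
          then have "M \<le> n - ((i + 1) * L - j)" using L jl unfolding n_def by linarith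
          then have "take M (drop ((i + 1) * L - j) (word (\<Phi> \<omega>) (int j) n))
              = word (\<Phi> \<omega>) (int j + int ((i + 1) * L - j)) M"
            by (simp only: drop_word take_word)
          also have "int j + int ((i + 1) * L - j) = int (i + 1) * int L"
            using jl by (simp only: of_nat_diff of_nat_mult)
          finally show ?thesis using \<Phi>_block[of \<omega> "i + 1"] by (simp add: add.commute)
        qed
        then show ?thesis by (auto simp: g_def)
      qed
      then have "real k * H = part_entropy \<rho> (\<lambda>\<omega>. g (word (\<Phi> \<omega>) (int j) n))"
        unfolding H_def \<rho>_def by (simp only: iid_entropy[OF iid])
      also have "\<dots> \<le> part_entropy \<rho> (\<lambda>\<omega>. word (\<Phi> \<omega>) (int j) n)"
        by (rule \<rho>.part_entropy_compose_le[OF finite_rv_words_of_map[OF \<rho>ps \<Phi>m]])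
      finally show ?thesis .
    qed
    then have "(\<Sum>j<L. real k * H) \<le> (\<Sum>j<L. part_entropy \<rho> (\<lambda>\<omega>. word (\<Phi> \<omega>) (int j) n))"
      by (intro sum_mono) auto
    then have "real k * H \<le> (\<Sum>j<L. part_entropy \<rho> (\<lambda>\<omega>. word (\<Phi> \<omega>) (int j) n)) / L"
      using L by (simp add: field_simps)
    also have "\<dots> \<le> \<nu>.word_entropy n"
      using averaged_entropy_ge[OF L(1) \<rho>.process_axioms \<Phi>m] \<nu>.stationary_axioms unfolding \<nu>_def by blast
    finally show ?thesis by (simp add: n_def)
  qed
  then have ks: "H / real L \<le> ks_entropy \<nu>" by (rule \<nu>.ks_entropy_ge[OF L(1)])
  define h where "h = (\<lambda>x. indicator X x * f x)"
  have hB: "\<bar>h x\<bar> \<le> B" for x using bound[of x] B_nonneg by (auto simp: h_def indicator_def)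
  have hm: "h \<in> borel_measurable FS" unfolding h_def by (rule fm)
  have hint: "integrable \<rho> (\<lambda>\<omega>. h (\<lambda>i. \<Phi> \<omega> (i + int j)))" for j
  proof (rule \<rho>.integrable_const_bound[where B = B])
    show "(\<lambda>\<omega>. h (\<lambda>i. \<Phi> \<omega> (i + int j))) \<in> borel_measurable \<rho>"
      by (rule measurable_compose[OF averaged_component[OF L(1) \<rho>ps \<Phi>m] hm])
  qed (use hB in simp)
  have "(\<Sum>v\<in>S. pmf p v * (Smf X f v - V - B * real G)) = (\<integral>\<omega>. Smf X f (c (\<omega> 0)) - V - B * real G \<partial>\<rho>)"
    unfolding \<rho>_def using iid_integral(2)[OF iid, of "\<lambda>v. Smf X f v - V - B * real G" 0] by simp
  also have "\<dots> \<le> (\<integral>\<omega>. (\<Sum>j<L. h (\<lambda>i. \<Phi> \<omega> (i + int j))) \<partial>\<rho>)"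
  proof (rule integral_mono)
    show "integrable \<rho> (\<lambda>\<omega>. Smf X f (c (\<omega> 0)) - V - B * real G)"
      unfolding \<rho>_def by (rule iid_integral(1)[OF iid, of "\<lambda>v. Smf X f v - V - B * real G" 0])
    show "integrable \<rho> (\<lambda>\<omega>. \<Sum>j<L. h (\<lambda>i. \<Phi> \<omega> (i + int j)))" using hint by auto
    fix \<omega>
    have "(\<Sum>j<L. h (\<lambda>i. \<Phi> \<omega> (i + int j))) = birkhoff f L (\<Phi> \<omega>)"
      unfolding birkhoff_alt h_def using X_translate[OF \<Phi>X] by simp
    also have "\<dots> = birkhoff f M (\<Phi> \<omega>) + birkhoff f G (\<lambda>i. \<Phi> \<omega> (i + int M))"
      unfolding L_def by (rule birkhoff_add)
    also have "\<dots> \<ge> (Smf X f (c (\<omega> 0)) - V) + - (B * real G)"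
    proof (rule add_mono)
      show "Smf X f (c (\<omega> 0)) - V \<le> birkhoff f M (\<Phi> \<omega>)"
        using Smf_le_birkhoff[OF \<Phi>X, of \<omega> M "c (\<omega> 0)"] \<Phi>_block[of \<omega> 0] by simp
      show "- (B * real G) \<le> birkhoff f G (\<lambda>i. \<Phi> \<omega> (i + int M))"
        using birkhoff_bound[OF X_translate[OF \<Phi>X[of \<omega>]], of G "int M"] by (simp add: abs_le_iff)
    qed
    finally show "Smf X f (c (\<omega> 0)) - V - B * real G \<le> (\<Sum>j<L. h (\<lambda>i. \<Phi> \<omega> (i + int j)))" by simp
  qed
  also have "\<dots> = real L * (\<integral>x. h x \<partial>\<nu>)"
    unfolding \<nu>_def using integral_averaged[OF L(1) \<rho>ps \<Phi>m hm hB] hint L by simp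
  finally have "(\<Sum>v\<in>S. pmf p v * (Smf X f v - V - B * real G)) \<le> real L * (\<integral>x. h x \<partial>\<nu>)" .
  \<comment> \<open>The logarithm of the chosen probability is
    \<open>Smf X f v - ln (Z X M)\<close>, so entropy and energy cancel word by word.\<close>
  moreover have "H + (\<Sum>v\<in>S. pmf p v * (Smf X f v - V - B * real G)) = ln (Z X M) - V - B * real G"
  proof -
    have "H + (\<Sum>v\<in>S. pmf p v * (Smf X f v - V - B * real G))
        = (\<Sum>v\<in>S. pmf p v * (ln (Z X M) - V - B * real G))"
      unfolding H_def sum.distrib[symmetric]
    proof (rule sum.cong[OF refl])
      fix v assume "v \<in> S"
      then have "Smf X f v = ln (pmf p v) + ln (Z X M)" using Zp by (simp add: p pf_def ln_div)
      then show "- pmf p v * ln (pmf p v) + pmf p v * (Smf X f v - V - B * real G)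
          = pmf p v * (ln (Z X M) - V - B * real G)" by (simp add: algebra_simps)
    qed
    also have "\<dots> = (\<Sum>v\<in>S. pmf p v) * (ln (Z X M) - V - B * real G)" by (rule sum_distrib_right[symmetric])
    also have "(\<Sum>v\<in>S. pmf p v) = 1" using sum_pmf_eq_1[OF S(1) pS] .
    finally show ?thesis by simp
  qed
  ultimately have "ln (Z X M) - V - B * real G \<le> H + real L * (\<integral>x. h x \<partial>\<nu>)" by linarith
  then have "(ln (Z X M) - V - B * real G) / real L \<le> H / real L + (\<integral>x. h x \<partial>\<nu>)"
    using L divide_right_mono[of "ln (Z X M) - V - B * real G" "H + real L * (\<integral>x. h x \<partial>\<nu>)" "real L"]
    by (simp add: add_divide_distrib)
  then show ?thesis using that[OF inv] ks by (simp add: h_def L_def)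
qed

text \<open>An equilibrium state does at least as well as every horseshoe measure, and the cost per
  letter of gaps and distortion vanishes as M grows.\<close>

lemma equilibrium_ge_pressure:
  assumes fm: "(\<lambda>x. indicator X x * f x) \<in> borel_measurable FS"
    and eq: "equilibrium_state X f \<mu>"
  shows "prs \<le> ks_entropy \<mu> + (\<integral>x. indicator X x * f x \<partial>\<mu>)" (is "_ \<le> ?F")
proof -
  have le: "(real M * prs - V - B * real G) / real (M + G) \<le> ?F" if M: "M \<ge> max N0 1" for M
  proof -
    obtain \<nu> where \<nu>: "invariant_on X \<nu>"
      "(ln (Z X M) - V - B * real G) / real (M + G) \<le> ks_entropy \<nu> + (\<integral>x. indicator X x * f x \<partial>\<nu>)"
      using horseshoe_measure[OF fm, of M] M by auto
    have "prs * real M \<le> ln (Z X M)" using prs_le[of M] M by (simp add: field_simps)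
    then have "(real M * prs - V - B * real G) / real (M + G) \<le> (ln (Z X M) - V - B * real G) / real (M + G)"
      by (intro divide_right_mono) (auto simp: mult.commute)
    also note \<nu>(2)
    also have "ks_entropy \<nu> + (\<integral>x. indicator X x * f x \<partial>\<nu>) \<le> ?F"
      using eq \<nu>(1) by (simp add: equilibrium_state_def)
    finally show ?thesis .
  qed
  have "(\<lambda>M. (real M * prs - V - B * real G) / real (M + G)) \<longlonglongrightarrow> prs"
  proof -
    have "(\<lambda>M. prs - (real G * prs + V + B * real G) / real (M + G)) \<longlonglongrightarrow> prs - 0"
      by (intro tendsto_diff tendsto_const LIMSEQ_ignore_initial_segment[OF lim_const_over_n])
    then have "(\<lambda>M. prs - (real G * prs + V + B * real G) / real (M + G)) \<longlonglongrightarrow> prs" by simp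
    then show ?thesis
    proof (rule Lim_transform_eventually)
      show "\<forall>\<^sub>F M in sequentially. prs - (real G * prs + V + B * real G) / real (M + G)
          = (real M * prs - V - B * real G) / real (M + G)"
        by (rule eventually_sequentiallyI[of 1]) (simp add: field_simps)
    qed
  qed
  then show ?thesis
    by (rule tendsto_upperbound) (use le in \<open>auto intro!: eventually_sequentiallyI[of "max N0 1"]\<close>)
qed

text \<open>Penalising occurrences of \<open>u\<close> lowers the pressure by at least a constant times
  \<open>exp (Smf X f u - prs * m)\<close>, while by the finite variational principle it lowers the free energy of
  \<open>\<mu>\<close> by at most the measure of the cylinder of \<open>u\<close>.\<close>
lemma gibbs_lower_bound:
  assumes fm: "(\<lambda>x. indicator X x * f x) \<in> borel_measurable FS"
    and eq: "equilibrium_state X f \<mu>" and u: "u \<in> lang X m" and m: "m \<ge> 1"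
  shows "(1 - exp (-1)) * exp (Smf X f u - prs * real m) / CZ ^ 3 \<le> measure \<mu> (cyl X u)" (is "?q \<le> _")
proof -
  have inv: "invariant_on X \<mu>" using eq by (simp add: equilibrium_state_def)
  interpret stationary \<mu>
    using inv unfolding invariant_on_def stationary_def stationary_axioms_def process_def by auto
  have X1: "prob X = 1" and Xev: "X \<in> events"
    using inv by (auto simp: invariant_on_def measure_def sets_eq)
  have AEX: "AE x in \<mu>. x \<in> X" using prob_eq_1[OF Xev] X1 by simp
  define b where "b = G + m"
  have lu: "length u = m" using u lang_length by auto
  define occ where "occ = (\<lambda>j w. take m (drop (j * b + G) w) = u)"
  define q where "q = ?q"
  have q1: "q \<le> 1" using penalised_sum(2)[OF u] by (simp add: q_def)
  define pu where "pu = measure \<mu> (cyl X u)"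
  have pu: "prob {x. word x (int p) m = u} = pu" for p
  proof -
    have ev: "{x. word x 0 m = u} \<in> events" using word_set[of 0 m u] by (simp add: sets_eq)
    have "prob {x. word x (int p) m = u} = prob {x. word ((shift ^^ p) x) 0 m = u}"
      by (simp add: shift_funpow word_translate)
    also have "\<dots> = prob {x. word x 0 m = u}" by (rule prob_funpow[OF ev])
    also have "\<dots> = prob (X \<inter> {x. word x 0 m = u})"
    proof (rule finite_measure_eq_AE)
      show "AE x in \<mu>. x \<in> {x. word x 0 m = u} \<longleftrightarrow> x \<in> X \<inter> {x. word x 0 m = u}"
        using AEX by eventually_elim simp
    qed (use ev Xev in \<open>auto intro: sets.Int\<close>)
    also have "X \<inter> {x. word x 0 m = u} = cyl X u" by (auto simp: cyl_def lu)
    also have "prob (cyl X u) = pu" by (simp add: pu_def)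
    finally show ?thesis .
  qed
  define h where "h = (\<lambda>x. indicator X x * f x)"
  have hm: "h \<in> borel_measurable \<mu>" unfolding h_def using fm by (subst measurable_cong_sets[OF sets_eq refl])
  have hB: "\<bar>h x\<bar> \<le> B" for x using bound[of x] B_nonneg by (auto simp: h_def indicator_def)
  \<comment> \<open>Both the loss q of the penalised sum and the expected number of occurrences are
    linear in k; dividing by k and letting it grow removes the constant
    \<open>ln CZ\<close>.\<close>
  have main: "real k * q \<le> ln CZ + real k * pu" if k: "k \<ge> 1" for k
  proof -
    define n where "n = k * b"
    have n: "n \<ge> 1" using k m by (simp add: n_def b_def)
    define N where "N = (\<lambda>w. card {j. j < k \<and> occ j w})"
    define Z' where "Z' = (\<Sum>w\<in>lang X n. exp (Smf X f w - real (N w)))"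
    have Z'0: "Z' > 0" unfolding Z'_def by (intro sum_pos lang_nonempty nonempty) auto
    \<comment> \<open>The penalised finite Gibbs law serves as reference. Then -ln r is
      \<open>ln Z'\<close> minus the energy plus the number of occurrences of u in the k slots, and
      by stationarity the mean of that number is k times the cylinder measure.\<close>
    define r where "r = (\<lambda>w. if w \<in> lang X n then exp (Smf X f w - real (N w)) / Z' else 0)"
    let ?W = "\<lambda>x :: int \<Rightarrow> 'a. word x 0 n"
    note W = finite_rv_word[of 0 n]
    have "word_entropy n \<le> (\<integral>x. - ln (r (?W x)) \<partial>\<mu>)"
      unfolding word_entropy_def
    proof (rule gibbs_inequality[OF W])
      show "r v \<ge> 0" for v using Z'0 by (simp add: r_def)
      have "(\<Sum>v\<in>range ?W. r v) = (\<Sum>v\<in>range ?W \<inter> lang X n. exp (Smf X f v - real (N v)) / Z')"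
        unfolding r_def using finite_range_word by (subst sum.inter_restrict) auto
      also have "\<dots> \<le> (\<Sum>v\<in>lang X n. exp (Smf X f v - real (N v)) / Z')"
        using Z'0 by (intro sum_mono2) auto
      also have "\<dots> = 1" using Z'0 by (simp add: sum_divide_distrib[symmetric] Z'_def)
      finally show "(\<Sum>v\<in>?W ` space \<mu>. r v) \<le> 1" by simp
    next
      fix v assume v: "pr ?W v > 0"
      have "v \<in> lang X n"
      proof (rule ccontr)
        assume "v \<notin> lang X n"
        then have "AE x in \<mu>. x \<in> X \<longrightarrow> ?W x \<noteq> v" by (intro AE_I2) auto
        then have "AE x in \<mu>. ?W x \<noteq> v" using AEX by (rule AE_mp[rotated])
        then have "pr ?W v = 0" unfolding pr_def
          by (subst prob_eq_0) (use W in \<open>auto simp: finite_rv_def\<close>)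
        then show False using v by simp
      qed
      then show "r v > 0" using Z'0 by (simp add: r_def)
    qed
    also have "\<dots> \<le> (\<integral>x. ln Z' - (\<Sum>i<n. h ((shift ^^ i) x)) + (\<Sum>j<k. indicator {x. word x (int (j * b + G)) m = u} x) \<partial>\<mu>)"
    proof (rule integral_mono_AE)
      show "integrable \<mu> (\<lambda>x. - ln (r (?W x)))" by (rule finite_rv_integral(1)[OF W])
      have "integrable \<mu> (\<lambda>x. h ((shift ^^ i) x))" for i
        using hB measurable_compose[OF funpow_measurable hm] by (intro integrable_const_bound[where B = B]) auto
      moreover have "integrable \<mu> (indicator {x. word x i m = u} :: _ \<Rightarrow> real)" for i
        using word_set[of i m u] by (intro integrable_real_indicator) (auto simp: sets_eq less_top[symmetric])
      ultimately show "integrable \<mu> (\<lambda>x. ln Z' - (\<Sum>i<n. h ((shift ^^ i) x)) + (\<Sum>j<k. indicator {x. word x (int (j * b + G)) m = u} x))"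
        by auto
      show "AE x in \<mu>. - ln (r (?W x)) \<le> ln Z' - (\<Sum>i<n. h ((shift ^^ i) x)) + (\<Sum>j<k. indicator {x. word x (int (j * b + G)) m = u} x)"
        using AEX
      proof eventually_elim
        case (elim x)
        have "(\<Sum>i<n. h ((shift ^^ i) x)) = birkhoff f n x"
          unfolding birkhoff_def h_def shift_funpow using X_translate[OF elim] by simp
        also have "\<dots> \<le> Smf X f (?W x)" by (rule le_Smf[OF order_refl elim refl])
        finally have 1: "(\<Sum>i<n. h ((shift ^^ i) x)) \<le> Smf X f (?W x)" .
        have "occ j (?W x) \<longleftrightarrow> word x (int (j * b + G)) m = u" if j: "j < k" for j
        proof -
          have "Suc j * b \<le> k * b" using j by (intro mult_right_mono) auto
          then have "m \<le> n - (j * b + G)" by (simp add: n_def b_def)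
          then show ?thesis unfolding occ_def by (simp only: drop_word take_word) simp
        qed
        then have "{j. j < k \<and> occ j (?W x)} = {j\<in>{..<k}. word x (int (j * b + G)) m = u}" by auto
        then have 2: "real (N (?W x)) = (\<Sum>j<k. indicator {x. word x (int (j * b + G)) m = u} x)"
          unfolding N_def by (simp add: indicator_def sum.If_cases Int_def)
        have "ln (r (?W x)) = Smf X f (?W x) - real (N (?W x)) - ln Z'"
          using elim Z'0 word_in_lang[OF elim, of 0 n] by (simp add: r_def ln_div)
        then show ?case using 1 2 by simp
      qed
    qed
    also have "\<dots> = ln Z' - real n * (\<integral>x. h x \<partial>\<mu>) + real k * pu"
    proof -
      have i1: "integrable \<mu> (\<lambda>x. h ((shift ^^ i) x))" for i
        using hB measurable_compose[OF funpow_measurable hm] by (intro integrable_const_bound[where B = B]) auto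
      have i2: "integrable \<mu> (indicator {x. word x i m = u} :: _ \<Rightarrow> real)" for i
        using word_set[of i m u] by (intro integrable_real_indicator) (auto simp: sets_eq less_top[symmetric])
      have e1: "(\<integral>x. (\<Sum>i<n. h ((shift ^^ i) x)) \<partial>\<mu>) = real n * (\<integral>x. h x \<partial>\<mu>)"
        using i1 by (subst Bochner_Integration.integral_sum) (auto simp: integral_funpow[OF hm])
      have "(\<integral>x. (\<Sum>j<k. indicator {x. word x (int (j * b + G)) m = u} x) \<partial>\<mu>)
          = (\<Sum>j<k. prob {x. word x (int (j * b + G)) m = u})"
        using i2 by (subst Bochner_Integration.integral_sum) auto
      also have "\<dots> = real k * pu" by (simp only: pu) simp
      finally have e2: "(\<integral>x. (\<Sum>j<k. indicator {x. word x (int (j * b + G)) m = u} x) \<partial>\<mu>) = real k * pu" .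
      have "(\<integral>x. ln Z' - (\<Sum>i<n. h ((shift ^^ i) x)) + (\<Sum>j<k. indicator {x. word x (int (j * b + G)) m = u} x) \<partial>\<mu>)
          = (\<integral>x. ln Z' - (\<Sum>i<n. h ((shift ^^ i) x)) \<partial>\<mu>) + (\<integral>x. (\<Sum>j<k. indicator {x. word x (int (j * b + G)) m = u} x) \<partial>\<mu>)"
        using i1 i2 by (intro Bochner_Integration.integral_add) auto
      also have "(\<integral>x. ln Z' - (\<Sum>i<n. h ((shift ^^ i) x)) \<partial>\<mu>) = ln Z' - (\<integral>x. (\<Sum>i<n. h ((shift ^^ i) x)) \<partial>\<mu>)"
        using i1 by (subst Bochner_Integration.integral_diff) (auto simp: prob_space[unfolded space_eq])
      finally show ?thesis unfolding e1 e2 .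
    qed
    finally have up: "word_entropy n \<le> ln Z' - real n * (\<integral>x. h x \<partial>\<mu>) + real k * pu" .
    have "prs \<le> word_entropy n / real n + (\<integral>x. h x \<partial>\<mu>)"
      using equilibrium_ge_pressure[OF fm eq] ks_entropy_le(1)[OF n] by (simp add: h_def)
    then have "real n * prs \<le> word_entropy n + real n * (\<integral>x. h x \<partial>\<mu>)" using n by (simp add: field_simps)
    then have "real n * prs \<le> ln Z' + real k * pu" using up by linarith
    moreover have "ln Z' \<le> ln CZ + prs * real n - q * real k"
    proof -
      have "Z' \<le> Z X n * (1 - q) ^ k"
        using penalised_sum(1)[OF u, of k] unfolding Z'_def N_def n_def occ_def b_def q_def .
      also have "\<dots> \<le> (CZ * exp (prs * real n)) * exp (- q) ^ k"
        using q1 exp_ge_add_one_self[of "- q"] less_imp_le[OF Z_pos[OF nonempty]]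
        by (intro mult_mono Z_upper power_mono) (auto simp: order_trans[OF less_imp_le[OF Z_pos[OF nonempty]] Z_upper])
      also have "\<dots> = CZ * exp (prs * real n - q * real k)"
        by (simp add: exp_of_nat_mult[symmetric] exp_diff exp_minus field_simps)
      finally have "Z' \<le> CZ * exp (prs * real n - q * real k)" .
      then have "ln Z' \<le> ln (CZ * exp (prs * real n - q * real k))"
        using Z'0 CZ_ge1 by (subst ln_le_cancel_iff) auto
      then show ?thesis using CZ_ge1 by (simp add: ln_mult_pos)
    qed
    ultimately show ?thesis by (simp add: mult.commute)
  qed
  have "q \<le> ln CZ / real k + pu" if "k \<ge> 1" for k using main[OF that] that by (simp add: field_simps)
  moreover have "(\<lambda>k. ln CZ / real k + pu) \<longlonglongrightarrow> 0 + pu"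
    by (intro tendsto_intros lim_const_over_n)
  ultimately have "q \<le> 0 + pu"
    by (intro tendsto_lowerbound) (auto intro!: eventually_sequentiallyI[of 1])
  then show ?thesis by (simp add: q_def pu_def)
qed

end

section \<open>Words with few new windows\<close>

text \<open>The sequence is a function of the position and not a list, so that a word can also be
  read cyclically with windows wrapping round its end. Comparison is with all windows from position
  0 on, even where counting starts later.\<close>

definition new_at :: "nat \<Rightarrow> (nat \<Rightarrow> 'a) \<Rightarrow> nat \<Rightarrow> bool" where
  "new_at n x j \<longleftrightarrow> (\<forall>i<j. \<exists>k<n. x (i + k) \<noteq> x (j + k))"

definition new_count :: "nat \<Rightarrow> nat \<Rightarrow> nat \<Rightarrow> (nat \<Rightarrow> 'a) \<Rightarrow> nat" where
  "new_count n a e x = card {j. a \<le> j \<and> j < e \<and> new_at n x j}"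

lemma new_count_le_card:
  assumes D: "finite D" and sub: "\<And>j. j < e \<Longrightarrow> map (\<lambda>k. x (j + k)) [0..<n] \<in> D"
  shows "new_count n a e x \<le> card D"
proof -
  let ?J = "{j. a \<le> j \<and> j < e \<and> new_at n x j}"
  let ?w = "\<lambda>j. map (\<lambda>k. x (j + k)) [0..<n]"
  have "inj_on ?w ?J"
  proof (rule linorder_inj_onI)
    fix i j assume ij: "i < j" "i \<in> ?J" "j \<in> ?J"
    then obtain k where "k < n" "x (i + k) \<noteq> x (j + k)" by (auto simp: new_at_def)
    then show "?w i \<noteq> ?w j" by (auto simp: list_eq_iff_nth_eq)
  qed auto
  then show ?thesis unfolding new_count_def using D sub
    by (intro card_inj_on_le[of ?w]) auto
qed

lemma new_count_cong:
  assumes "\<And>k. k < e + n \<Longrightarrow> x k = y k"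
  shows "new_count n a e x = new_count n a e y"
proof -
  have "new_at n x j = new_at n y j" if "j < e" for j
  proof -
    have "x (i + k) = y (i + k)" if "i \<le> j" "k < n" for i k
      using assms that \<open>j < e\<close> by simp
    then show ?thesis by (simp add: new_at_def cong: conj_cong imp_cong)
  qed
  then show ?thesis unfolding new_count_def by (metis (lifting))
qed

lemma new_count_split:
  assumes "a \<le> c" "b \<le> c" "b \<le> e"
  shows "new_count n a b x + new_count n c e x \<le> new_count n a e x"
proof -
  have "new_count n a b x + new_count n c e x
      = card ({j. a \<le> j \<and> j < b \<and> new_at n x j} \<union> {j. c \<le> j \<and> j < e \<and> new_at n x j})"
    unfolding new_count_def using assms by (intro card_Un_disjoint[symmetric]) auto
  also have "\<dots> \<le> new_count n a e x"
    unfolding new_count_def using assms by (intro card_mono) auto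
  finally show ?thesis .
qed

lemma sum_prefix_split:
  fixes h :: "'a list \<Rightarrow> real"
  assumes "finite A" "\<And>w. w \<in> A \<Longrightarrow> k \<le> length w" "length v \<le> k"
  shows "(\<Sum>w\<in>{w\<in>A. take (length v) w = v}. h w)
    = (\<Sum>v'\<in>{v'\<in>take k ` A. take (length v) v' = v}. \<Sum>w\<in>{w\<in>A. take k w = v'}. h w)"
proof -
  let ?S = "{w\<in>A. take (length v) w = v}" and ?T = "{v'\<in>take k ` A. take (length v) v' = v}"
  have tt: "take (length v) (take k w) = take (length v) w" for w :: "'a list"
    using assms(3) by (simp add: min_def)
  have "(\<Sum>w\<in>?S. h w) = (\<Sum>v'\<in>?T. \<Sum>w\<in>{w\<in>?S. take k w = v'}. h w)"
    using assms(1) tt by (intro sum.group[symmetric]) auto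
  also have "\<dots> = (\<Sum>v'\<in>?T. \<Sum>w\<in>{w\<in>A. take k w = v'}. h w)"
  proof (rule sum.cong[OF refl])
    fix v' assume "v' \<in> ?T"
    then have "take (length v) w = v" if "take k w = v'" for w
      using tt[of w] that by (simp del: take_take)
    then have "{w\<in>?S. take k w = v'} = {w\<in>A. take k w = v'}" by auto
    then show "(\<Sum>w\<in>{w\<in>?S. take k w = v'}. h w) = (\<Sum>w\<in>{w\<in>A. take k w = v'}. h w)" by (simp only:)
  qed
  finally show ?thesis .
qed

lemma sum_Un_le:
  fixes h :: "'b \<Rightarrow> real"
  assumes "finite A" "finite B" "\<And>w. w \<in> A \<union> B \<Longrightarrow> h w \<ge> 0"
  shows "sum h (A \<union> B) \<le> sum h A + sum h B"
  using sum_nonneg[of "A \<inter> B" h] assms by (simp add: sum_Un)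

lemma sum_UN_le:
  fixes h :: "'b \<Rightarrow> real"
  assumes "finite I" "\<And>i. i \<in> I \<Longrightarrow> finite (B i)" "\<And>i w. i \<in> I \<Longrightarrow> w \<in> B i \<Longrightarrow> h w \<ge> 0"
  shows "sum h (\<Union>i\<in>I. B i) \<le> (\<Sum>i\<in>I. sum h (B i))"
  using assms
proof (induction I rule: finite_induct)
  case (insert i I)
  have "sum h (B i \<union> (\<Union>j\<in>I. B j)) \<le> sum h (B i) + sum h (\<Union>j\<in>I. B j)"
    using insert by (intro sum_Un_le) auto
  also have "sum h (\<Union>j\<in>I. B j) \<le> (\<Sum>j\<in>I. sum h (B j))" using insert by blast
  finally show ?case using insert by simp
qed simp

definition prefix_weight :: "'a list set \<Rightarrow> ('a list \<Rightarrow> real) \<Rightarrow> 'a list \<Rightarrow> real" where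
  "prefix_weight A g v = (\<Sum>w\<in>{w\<in>A. take (length v) w = v}. g w)"

text \<open>The power collects the repeats with a full copy, each admitting at most M sources at
  relative cost \<open>C * \<theta> ^ n\<close>, over at most M letters. The first factor pays for a
  copy cut off by the end, where fewer than n letters are gained.\<close>

definition repeat_loss :: "real \<Rightarrow> real \<Rightarrow> nat \<Rightarrow> nat \<Rightarrow> real" where
  "repeat_loss C \<theta> M n = (1 + real M * C * real n) * (1 + real M * C * \<theta> ^ n) ^ M"

text \<open>Read the letters from left to right. A position \<open>j\<close> whose \<open>n\<close>-window is new contributes the
  factor \<open>\<alpha>\<close>. A repeated window is a copy of one of at most \<open>M\<close> earlier windows, so the next
  \<open>n\<close> letters are determined, which costs \<open>C * \<gamma> ^ n\<close> and saves at most \<open>\<alpha> ^ n\<close>. A copy that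
  reaches beyond the end \<open>e\<close> happens at most once and is only estimated by \<open>M * C\<close>.\<close>
lemma new_window_sum:
  fixes A :: "'a list set" and g :: "'a list \<Rightarrow> real" and x :: "'a list \<Rightarrow> nat \<Rightarrow> 'a"
  assumes A: "finite A" "\<And>w. w \<in> A \<Longrightarrow> length w = M" and g: "\<And>w. w \<in> A \<Longrightarrow> g w \<ge> 0"
    and growth: "\<And>v u. length v + length u \<le> M \<Longrightarrow>
      prefix_weight A g (v @ u) \<le> C * \<gamma> ^ length u * prefix_weight A g v"
    and x: "\<And>w k. w \<in> A \<Longrightarrow> k < e \<Longrightarrow> x w k = w ! k"
    and e: "e \<le> M" and par: "0 < \<gamma>" "\<gamma> \<le> \<alpha>" "\<alpha> \<le> 1" "0 \<le> C" and n: "n \<ge> 1"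
    and v: "length v \<le> e"
  shows "(\<Sum>w\<in>{w\<in>A. take (length v) w = v}. g w * \<alpha> ^ new_count n (length v) e (x w))
    \<le> prefix_weight A g v * (\<alpha> ^ (e - length v) * repeat_loss C (\<gamma> / \<alpha>) M n)"
proof -
  define K where "K = real M * C"
  define \<theta> where "\<theta> = \<gamma> / \<alpha>"
  define \<beta> where "\<beta> = K * \<theta> ^ n"
  have \<alpha>: "\<alpha> > 0" using par by linarith
  have K0: "K \<ge> 0" using par by (simp add: K_def)
  have \<theta>: "0 < \<theta>" "\<theta> \<le> 1" using par \<alpha> by (auto simp: \<theta>_def)
  have \<beta>0: "\<beta> \<ge> 0" using K0 \<theta> by (simp add: \<beta>_def)
  have pw0: "prefix_weight A g v \<ge> 0" for v unfolding prefix_weight_def using g by (intro sum_nonneg) auto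
  \<comment> \<open>The loss allowed when r letters remain, shaped so that \<open>b_rec\<close>
    holds: for r below n a repeat is cut by the end and adds \<open>K\<close> linearly, afterwards
    it multiplies by 1 + \<open>\<beta>\<close>.\<close>
  define b where "b = (\<lambda>r. (1 + K * real (min n r)) * (1 + \<beta>) ^ r)"
  have b0: "b r \<ge> 0" for r using K0 \<beta>0 by (simp add: b_def)
  have \<beta>pow: "(1 + \<beta>) ^ r \<ge> 1" for r using \<beta>0 by (intro one_le_power) simp
  have b_rec: "b r + K * \<theta> ^ min n (Suc r) * b (Suc r - min n (Suc r)) \<le> b (Suc r)" for r
  proof (cases "Suc r \<le> n")
    case True
    have "b r + K * \<theta> ^ min n (Suc r) * b (Suc r - min n (Suc r)) \<le> b r + K * 1 * 1"
      using True K0 \<theta> by (intro add_left_mono mult_mono power_le_one) (auto simp: b_def)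
    also have "\<dots> \<le> (1 + K * real r) * (1 + \<beta>) ^ r + K * (1 + \<beta>) ^ r"
      using True K0 mult_left_mono[OF \<beta>pow[of r] K0] by (simp add: b_def)
    also have "\<dots> = (1 + K * real (Suc r)) * (1 + \<beta>) ^ r" by (simp add: algebra_simps)
    also have "\<dots> \<le> (1 + K * real (Suc r)) * (1 + \<beta>) ^ Suc r"
      using K0 \<beta>0 by (intro mult_left_mono power_increasing) auto
    finally show ?thesis using True by (simp add: b_def)
  next
    case False
    then have r: "min n r = n" "min n (Suc r) = n" by auto
    have "b (Suc r - n) \<le> (1 + K * real n) * (1 + \<beta>) ^ r"
      unfolding b_def using K0 \<beta>0 n by (intro mult_mono add_left_mono mult_left_mono power_increasing) auto
    then have "b r + K * \<theta> ^ n * b (Suc r - n) \<le> (1 + K * real n) * (1 + \<beta>) ^ r + \<beta> * ((1 + K * real n) * (1 + \<beta>) ^ r)"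
      using \<beta>0 r(1) by (intro add_mono) (auto simp: b_def \<beta>_def[symmetric] intro!: mult_left_mono)
    also have "\<dots> = (1 + K * real n) * (1 + \<beta>) ^ Suc r" by (simp add: algebra_simps)
    finally show ?thesis by (simp add: b_def r)
  qed
  have main: "(\<Sum>w\<in>{w\<in>A. take (length v) w = v}. g w * \<alpha> ^ new_count n (length v) e (x w))
      \<le> prefix_weight A g v * (\<alpha> ^ (e - length v) * b (e - length v))" if "length v \<le> e" for v
    using that
  proof (induction "e - length v" arbitrary: v rule: less_induct)
    case less
    define a where "a = length v"
    let ?S = "{w\<in>A. take a w = v}"
    let ?c = "\<lambda>a w. \<alpha> ^ new_count n a e (x w)"
    show ?case
    proof (cases "a = e")
      case True
      then have "new_count n a e (x w) = 0" for w by (auto simp: new_count_def)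
      then show ?thesis using True by (simp add: prefix_weight_def b_def a_def[symmetric])
    next
      case False
      then have ae: "a < e" using less.prems by (simp add: a_def)
      define r where "r = e - Suc a"
      have ea: "e - a = Suc r" using ae by (simp add: r_def)
      \<comment> \<open>The number of letters that a repeat at position a determines before the end
        e.\<close>
      define l where "l = min n (Suc r)"
      have l: "1 \<le> l" "a + l \<le> e" using n ea ae by (auto simp: l_def)
      define New where "New = {w\<in>?S. new_at n (x w) a}"
      define Rep where "Rep = (\<lambda>i. {w\<in>?S. \<forall>k<n. x w (i + k) = x w (a + k)})"
      have S: "?S = New \<union> (\<Union>i<a. Rep i)"
        unfolding New_def Rep_def new_at_def by auto
      have fin: "finite ?S" "finite New" "\<And>i. finite (Rep i)" using A(1) by (auto simp: New_def Rep_def)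
      have g0: "w \<in> ?S \<Longrightarrow> g w \<ge> 0" for w using g by simp
      have new: "(\<Sum>w\<in>New. g w * ?c a w) \<le> prefix_weight A g v * (\<alpha> ^ Suc r * b r)"
      proof -
        have "?c a w = \<alpha> * ?c (Suc a) w" if "w \<in> New" for w
        proof -
          have "{j. a \<le> j \<and> j < e \<and> new_at n (x w) j} = insert a {j. Suc a \<le> j \<and> j < e \<and> new_at n (x w) j}"
            using that ae by (auto simp: New_def Suc_le_eq le_less)
          then have "new_count n a e (x w) = Suc (new_count n (Suc a) e (x w))"
            by (simp add: new_count_def)
          then show ?thesis by simp
        qed
        then have "(\<Sum>w\<in>New. g w * ?c a w) = \<alpha> * (\<Sum>w\<in>New. g w * ?c (Suc a) w)"
          by (simp add: sum_distrib_left mult_ac)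
        also have "\<dots> \<le> \<alpha> * (\<Sum>w\<in>?S. g w * ?c (Suc a) w)"
          using fin g0 \<alpha> by (intro mult_left_mono sum_mono2) (auto simp: New_def)
        also have "(\<Sum>w\<in>?S. g w * ?c (Suc a) w)
            = (\<Sum>v'\<in>{v'\<in>take (Suc a) ` A. take (length v) v' = v}. \<Sum>w\<in>{w\<in>A. take (Suc a) w = v'}. g w * ?c (Suc a) w)"
          using sum_prefix_split[OF A(1), of "Suc a" v "\<lambda>w. g w * ?c (Suc a) w"] A(2) ae e by (simp add: a_def)
        also have "\<dots> \<le> (\<Sum>v'\<in>{v'\<in>take (Suc a) ` A. take (length v) v' = v}. prefix_weight A g v' * (\<alpha> ^ r * b r))"
        proof (rule sum_mono)
          fix v' assume "v' \<in> {v'\<in>take (Suc a) ` A. take (length v) v' = v}"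
          then have lv: "length v' = Suc a" using A(2) ae e by auto
          show "(\<Sum>w\<in>{w\<in>A. take (Suc a) w = v'}. g w * ?c (Suc a) w) \<le> prefix_weight A g v' * (\<alpha> ^ r * b r)"
            using less.hyps[of v'] lv ae by (simp add: r_def a_def[symmetric])
        qed
        also have "\<dots> = prefix_weight A g v * (\<alpha> ^ r * b r)"
        proof -
          have "prefix_weight A g v = (\<Sum>v'\<in>{v'\<in>take (Suc a) ` A. take (length v) v' = v}. \<Sum>w\<in>{w\<in>A. take (Suc a) w = v'}. g w)"
            unfolding prefix_weight_def by (rule sum_prefix_split[OF A(1)]) (use A(2) ae e in \<open>auto simp: a_def\<close>)
          also have "\<dots> = (\<Sum>v'\<in>{v'\<in>take (Suc a) ` A. take (length v) v' = v}. prefix_weight A g v')"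
          proof (rule sum.cong[OF refl])
            fix v' assume "v' \<in> {v'\<in>take (Suc a) ` A. take (length v) v' = v}"
            then have "length v' = Suc a" using A(2) ae e by auto
            then show "(\<Sum>w\<in>{w\<in>A. take (Suc a) w = v'}. g w) = prefix_weight A g v'"
              by (simp add: prefix_weight_def)
          qed
          finally show ?thesis by (simp only: sum_distrib_right)
        qed
        finally show ?thesis using \<alpha> by (simp add: mult_ac)
      qed
      have rep: "(\<Sum>w\<in>Rep i. g w * ?c a w) \<le> C * \<gamma> ^ l * prefix_weight A g v * (\<alpha> ^ (e - (a + l)) * b (e - (a + l)))"
        if i: "i < a" for i
      proof (cases "Rep i = {}")
        case True
        then show ?thesis using pw0[of v] par \<alpha> b0 by simp
      next
        case False
        then obtain w0 where w0: "w0 \<in> Rep i" by auto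
        define u where "u = drop a (take (a + l) w0)"
        have w0A: "w0 \<in> A" "take a w0 = v" "length w0 = M" using w0 A(2) by (auto simp: Rep_def)
        have vu: "take (a + l) w0 = v @ u"
          using append_take_drop_id[of a "take (a + l) w0"] w0A(2) by (simp add: u_def min_def)
        have lu: "length u = l" "length (v @ u) = a + l" using w0A(3) l e by (auto simp: u_def a_def[symmetric])
        \<comment> \<open>Source and copy may overlap, so the source may itself contain letters not
          yet known. They are determined one after another from the left, hence the strong
          induction.\<close>
        have same: "take (a + l) w = v @ u" if w: "w \<in> Rep i" for w
        proof -
          have wA: "w \<in> A" "take a w = v" "length w = M" using w A(2) by (auto simp: Rep_def)
          have eqk: "w ! k = w0 ! k" if "k < a + l" for k
            using that
          proof (induction k rule: less_induct)
            case (less k)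
            show ?case
            proof (cases "k < a")
              case True
              then show ?thesis using wA(2) w0A(2) by (metis nth_take)
            next
              case False
              define t where "t = k - a"
              have t: "k = a + t" "t < n" "t < l" "i + t < k" "k < e"
                using False less.prems i l by (auto simp: t_def l_def)
              have "w ! (a + t) = w ! (i + t)" "w0 ! (a + t) = w0 ! (i + t)"
                using w w0 t x[OF wA(1)] x[OF w0A(1)] by (auto simp: Rep_def)
              then show ?thesis using less.IH[of "i + t"] t less.prems by simp
            qed
          qed
          have "take (a + l) w = take (a + l) w0"
            using wA(3) w0A(3) l e eqk by (intro nth_equalityI) auto
          then show ?thesis using vu by simp
        qed
        \<comment> \<open>New windows among the determined letters are no longer counted. This is
          allowed since \<open>\<alpha>\<close> \<le> 1, and it is the saving set against the factor
          \<open>\<gamma> ^ l\<close>.\<close>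
        have "(\<Sum>w\<in>Rep i. g w * ?c a w) \<le> (\<Sum>w\<in>Rep i. g w * ?c (a + l) w)"
        proof (intro sum_mono mult_left_mono power_decreasing)
          fix w assume "w \<in> Rep i"
          then show "g w \<ge> 0" using g by (simp add: Rep_def)
          show "new_count n (a + l) e (x w) \<le> new_count n a e (x w)"
            unfolding new_count_def by (intro card_mono) auto
        qed (use \<alpha> par in auto)
        also have "\<dots> \<le> (\<Sum>w\<in>{w\<in>A. take (length (v @ u)) w = v @ u}. g w * ?c (length (v @ u)) w)"
          using A(1) g same lu \<alpha> by (simp only: lu) (intro sum_mono2, auto simp: Rep_def)
        also have "\<dots> \<le> prefix_weight A g (v @ u) * (\<alpha> ^ (e - (a + l)) * b (e - (a + l)))"
          using less.hyps[of "v @ u"] lu l ae a_def by (simp only: lu)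
        also have "\<dots> \<le> C * \<gamma> ^ l * prefix_weight A g v * (\<alpha> ^ (e - (a + l)) * b (e - (a + l)))"
          using growth[of v u] lu l e \<alpha> b0 by (intro mult_right_mono) (auto simp: a_def)
        finally show ?thesis .
      qed
      have "(\<Sum>w\<in>?S. g w * ?c a w) \<le> (\<Sum>w\<in>New. g w * ?c a w) + (\<Sum>w\<in>(\<Union>i<a. Rep i). g w * ?c a w)"
        unfolding S using fin g0 \<alpha> by (intro sum_Un_le) (auto simp: New_def Rep_def g)
      also have "(\<Sum>w\<in>(\<Union>i<a. Rep i). g w * ?c a w) \<le> (\<Sum>i<a. \<Sum>w\<in>Rep i. g w * ?c a w)"
        using fin g \<alpha> by (intro sum_UN_le) (auto simp: Rep_def)
      also have "(\<Sum>i<a. \<Sum>w\<in>Rep i. g w * ?c a w)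
          \<le> (\<Sum>i<a. C * \<gamma> ^ l * prefix_weight A g v * (\<alpha> ^ (e - (a + l)) * b (e - (a + l))))"
        using rep by (intro sum_mono) auto
      also have "\<dots> \<le> real M * (C * \<gamma> ^ l * prefix_weight A g v * (\<alpha> ^ (e - (a + l)) * b (e - (a + l))))"
        using ae e par \<alpha> pw0 b0 by (simp add: mult_right_mono)
      also have "\<dots> = prefix_weight A g v * (\<alpha> ^ Suc r * (K * \<theta> ^ l * b (Suc r - l)))"
      proof -
        have "\<alpha> ^ Suc r = \<alpha> ^ l * \<alpha> ^ (e - (a + l))"
          using ea l by (simp add: power_add[symmetric])
        moreover have "Suc r - l = e - (a + l)" using ea by simp
        moreover have "\<gamma> ^ l = \<theta> ^ l * \<alpha> ^ l" using \<alpha> by (simp add: \<theta>_def power_divide)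
        ultimately show ?thesis by (simp add: K_def mult_ac)
      qed
      finally have "(\<Sum>w\<in>?S. g w * ?c a w)
          \<le> prefix_weight A g v * (\<alpha> ^ Suc r * b r) + prefix_weight A g v * (\<alpha> ^ Suc r * (K * \<theta> ^ l * b (Suc r - l)))"
        using new by simp
      also have "\<dots> = prefix_weight A g v * (\<alpha> ^ Suc r * (b r + K * \<theta> ^ l * b (Suc r - l)))"
        by (simp add: algebra_simps)
      also have "\<dots> \<le> prefix_weight A g v * (\<alpha> ^ Suc r * b (Suc r))"
        using pw0 \<alpha> b_rec[of r] by (intro mult_left_mono) (auto simp: l_def)
      finally show ?thesis using ea by (simp add: a_def)
    qed
  qed
  have "b (e - length v) \<le> repeat_loss C \<theta> M n"
    unfolding b_def repeat_loss_def K_def[symmetric] \<beta>_def[symmetric] using K0 \<beta>0 e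
    by (intro mult_mono add_left_mono mult_left_mono power_increasing) auto
  then have "prefix_weight A g v * (\<alpha> ^ (e - length v) * b (e - length v))
      \<le> prefix_weight A g v * (\<alpha> ^ (e - length v) * repeat_loss C (\<gamma> / \<alpha>) M n)"
    using pw0 \<alpha> by (intro mult_left_mono) (auto simp: \<theta>_def)
  with main[OF v] show ?thesis by linarith
qed

section \<open>Periodic points and moment bounds\<close>

definition subwords :: "nat \<Rightarrow> 'a list \<Rightarrow> 'a list set" where
  "subwords n w = (\<lambda>j. take n (drop j w)) ` {j. j + n \<le> length w}"

lemma finite_subwords: "finite (subwords n w)"
proof -
  have "{j. j + n \<le> length w} \<subseteq> {..length w}" by auto
  then show ?thesis unfolding subwords_def using finite_subset by blast
qed

definition orbit_words :: "nat \<Rightarrow> (int \<Rightarrow> 'a) \<Rightarrow> 'a list set" where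
  "orbit_words n x = range (\<lambda>i. word x i n)"

lemma orbit_words_translate: "orbit_words n (\<lambda>i. x (i + p)) = orbit_words n x"
proof -
  have "word x i n \<in> range (\<lambda>i. word x (i + p) n)" for i
    by (rule image_eqI[of _ _ "i - p"]) auto
  then have "range (\<lambda>i. word x (i + p) n) = range (\<lambda>i. word x i n)" by auto
  then show ?thesis by (simp add: orbit_words_def word_translate)
qed

definition periodic :: "nat \<Rightarrow> (int \<Rightarrow> 'a) \<Rightarrow> bool" where
  "periodic m x \<longleftrightarrow> (\<forall>i. x (i + int m) = x i)"

lemma periodic_mod:
  assumes "periodic m x"
  shows "x (i mod int m) = x i"
proof -
  have up: "x (i + int m * int q) = x i" for i q
  proof (induction q)
    case (Suc q)
    have "x (i + int m * int (Suc q)) = x ((i + int m * int q) + int m)" by (simp add: algebra_simps)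
    then show ?case using assms Suc by (simp only: periodic_def)
  qed simp
  have "x (i + int m * q) = x i" for q
  proof (cases "q \<ge> 0")
    case True
    then show ?thesis using up[of i "nat q"] by simp
  next
    case False
    then show ?thesis using up[of "i + int m * q" "nat (- q)"] by (simp add: algebra_simps)
  qed
  from this[of "- (i div int m)"] show ?thesis
    by (simp add: minus_div_mult_eq_mod[symmetric] algebra_simps)
qed

lemma periodic_translate: "periodic m x \<Longrightarrow> periodic m (\<lambda>i. x (i + p))"
  unfolding periodic_def by (metis add.assoc add.commute)

lemma periodic_eqI:
  assumes "periodic m x" "periodic m y" "m > 0" "word x 0 m = word y 0 m"
  shows "x = y"
proof
  fix i
  have "x (i mod int m) = y (i mod int m)"
    using assms(3,4) unfolding word_eq_iff
    by (metis add_0 pos_mod_bound pos_mod_sign of_nat_0_less_iff zero_le_imp_eq_int of_nat_less_iff)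
  then show "x i = y i" using periodic_mod assms(1,2) by metis
qed

lemma orbit_words_periodic:
  assumes "periodic m x" "m > 0"
  shows "orbit_words n x = (\<lambda>j. word x (int j) n) ` {..<m}"
proof -
  have "word x i n = word x (int (nat (i mod int m))) n" for i
  proof -
    have "x (i + int k) = x (i mod int m + int k)" for k
      using periodic_mod[OF assms(1), of "i + int k"] periodic_mod[OF assms(1), of "i mod int m + int k"]
      by (metis mod_add_left_eq)
    then show ?thesis using assms(2) by (simp add: word_eq_iff)
  qed
  moreover have "nat (i mod int m) < m" for i using assms(2) by (simp add: nat_less_iff)
  ultimately have "word x i n \<in> (\<lambda>j. word x (int j) n) ` {..<m}" for i by blast
  then show ?thesis by (auto simp: orbit_words_def)
qed

text \<open>Moving the origin by one drops a term at one end and adds an equal one at the other; an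
  arbitrary translation is reduced modulo the period.\<close>

lemma birkhoff_periodic_translate:
  assumes "periodic m x" "m > 0"
  shows "birkhoff f m (\<lambda>i. x (i + p)) = birkhoff f m x"
proof -
  have one: "birkhoff f m (\<lambda>i. y (i + 1)) = birkhoff f m y" if "periodic m y" for y
  proof -
    have "birkhoff f 1 y + birkhoff f m (\<lambda>i. y (i + 1)) = birkhoff f (1 + m) y"
      using birkhoff_add[of f 1 m y] by simp
    also have "\<dots> = birkhoff f m y + birkhoff f 1 (\<lambda>i. y (i + int m))"
      using birkhoff_add[of f m 1 y] by simp
    also have "(\<lambda>i. y (i + int m)) = y" using that by (auto simp: periodic_def)
    finally show ?thesis by simp
  qed
  have nat: "birkhoff f m (\<lambda>i. x (i + int k)) = birkhoff f m x" for k
  proof (induction k)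
    case (Suc k)
    have "birkhoff f m (\<lambda>i. x (i + int (Suc k))) = birkhoff f m (\<lambda>i. (\<lambda>i. x (i + int k)) (i + 1))"
      by (simp add: algebra_simps)
    also have "\<dots> = birkhoff f m (\<lambda>i. x (i + int k))" by (rule one[OF periodic_translate[OF assms(1)]])
    finally show ?case using Suc by simp
  qed simp
  have "x (i + p) = x (i + int (nat (p mod int m)))" for i
    using periodic_mod[OF assms(1), of "i + p"] periodic_mod[OF assms(1), of "i + p mod int m"] assms(2)
    by (simp add: mod_add_right_eq)
  then have "(\<lambda>i. x (i + p)) = (\<lambda>i. x (i + int (nat (p mod int m))))" by (rule ext)
  then show ?thesis using nat[of "nat (p mod int m)"] by (simp only:)
qed

context sft_system
begin

definition per :: "nat \<Rightarrow> (int \<Rightarrow> 'a) set" where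
  "per m = {x\<in>X. periodic m x}"

lemma per_translate: "x \<in> per m \<Longrightarrow> (\<lambda>i. x (i + p)) \<in> per m"
  by (simp add: per_def X_translate periodic_translate)

lemma inj_per_word: "m > 0 \<Longrightarrow> inj_on (\<lambda>x. word x 0 m) (per m)"
  by (intro inj_onI) (auto simp: per_def intro: periodic_eqI)

lemma finite_per: "m > 0 \<Longrightarrow> finite (per m)"
  using inj_per_word finite_imageD[of "\<lambda>x. word x 0 m" "per m"] finite_words[of m]
  by (metis (mono_tags, lifting) finite_subset image_subsetI length_word mem_Collect_eq)

text \<open>Gluing a point containing v behind itself produces a point with v at 0 and again at k +
  G. Repeating its first period stays in X: a k-window crossing the seam reads the second copy of v,
  just as in the glued point.\<close>

lemma word_in_periodic:
  assumes "v \<in> lang X k" "k \<ge> N0"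
  obtains x where "x \<in> per (k + G)" "word x 0 k = v"
proof -
  define m where "m = k + G"
  obtain y where y: "y \<in> X" "word y 0 k = v" using lang_obtain[OF X_inv assms(1)] .
  obtain z where z: "z \<in> X" "\<And>i. i < 0 \<Longrightarrow> z i = y (i + int k)" "\<And>i. i \<ge> 0 \<Longrightarrow> z (i + int G) = y i"
    using glue[OF X_translate[OF y(1), of "int k"] y(1)] by auto
  define w where "w = (\<lambda>i. z (i - int k))"
  have w: "w \<in> X" unfolding w_def using X_translate[OF z(1), of "- int k"] by simp
  have w1: "w i = y i" if "i < int k" for i using z(2)[of "i - int k"] that by (simp add: w_def)
  have w2: "w (i + int m) = y i" if "i \<ge> 0" for i using z(3)[of i] that by (simp add: w_def m_def algebra_simps)
  show ?thesis
  proof (cases "m = 0")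
    \<comment> \<open>Here k = G = 0, and every point has period 0.\<close>
    case True
    then have "y \<in> per (k + G)" using y by (simp add: per_def periodic_def m_def)
    then show ?thesis using y that by blast
  next
    case False
    define x where "x = (\<lambda>i. w (i mod int m))"
    have "x \<in> X"
    proof (rule window[OF assms(2)])
      fix i
      have "x (i + int t) = w (i mod int m + int t)" if t: "t < k" for t
      proof (cases "i mod int m + int t < int m")
        case True
        then show ?thesis using div_mod_int_add_less[of "int t" i "int m"] False by (simp add: x_def)
      next
        case f: False
        have lt: "i mod int m < int m" using False by simp
        have "(i + int t) mod int m = i mod int m + int t - int m"
        proof (rule div_mod_int_add_ge(2))
          have "int t < int m" using t by (simp add: m_def)
          then show "i mod int m + int t < 2 * int m" using lt by linarith
        qed (use f False in auto)
        then have "x (i + int t) = w (i mod int m + int t - int m)" by (simp add: x_def)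
        also have "\<dots> = y (i mod int m + int t - int m)" using lt t by (intro w1) simp
        also have "\<dots> = w (i mod int m + int t)" using w2[of "i mod int m + int t - int m"] f by simp
        finally show ?thesis .
      qed
      then show "\<exists>x'\<in>X. \<exists>j. \<forall>t<k. x (i + int t) = x' (j + int t)" using w by blast
    qed
    moreover have "periodic m x" by (simp add: periodic_def x_def)
    moreover have "word x 0 k = v"
      unfolding y(2)[symmetric] word_eq_iff x_def using w1 by (auto simp: m_def)
    ultimately show ?thesis using that by (auto simp: per_def m_def)
  qed
qed

text \<open>Distortion, the energy of the gap, and the replacement of the length m - G by m in the
  exponent.\<close>

definition CP :: real where "CP = exp (- V - B * real G - \<bar>prs\<bar> * real G)"

lemma CP_pos: "CP > 0"
  by (simp add: CP_def)

text \<open>Each word of length m - G closes up to a periodic point which still shows that word, so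
  different words give different points.\<close>

lemma periodic_sum_lower:
  assumes "m \<ge> N0 + G" "m > 0"
  shows "CP * exp (prs * real m) \<le> (\<Sum>x\<in>per m. exp (birkhoff f m x))"
proof -
  define k where "k = m - G"
  have k: "m = k + G" "k \<ge> N0" using assms by (auto simp: k_def)
  have "\<exists>x. x \<in> per m \<and> word x 0 k = v" if v: "v \<in> lang X k" for v
  proof -
    obtain x where "x \<in> per (k + G)" "word x 0 k = v" using word_in_periodic[OF v k(2)] .
    then show ?thesis using k(1) by auto
  qed
  then obtain pt where pt: "\<And>v. v \<in> lang X k \<Longrightarrow> pt v \<in> per m" "\<And>v. v \<in> lang X k \<Longrightarrow> word (pt v) 0 k = v"
    by metis
  have inj: "inj_on pt (lang X k)" by (rule inj_on_inverseI[of _ "\<lambda>x. word x 0 k"]) (rule pt(2))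
  have "CP * exp (prs * real m) = exp (- V - B * real G) * (exp (- \<bar>prs\<bar> * real G) * exp (prs * real G)) * exp (prs * real k)"
    unfolding CP_def exp_add[symmetric] k(1) by (simp add: algebra_simps)
  also have "\<dots> \<le> exp (- V - B * real G) * 1 * exp (prs * real k)"
  proof -
    have "exp (- \<bar>prs\<bar> * real G) * exp (prs * real G) = exp ((prs - \<bar>prs\<bar>) * real G)"
      by (simp add: exp_add[symmetric] algebra_simps)
    also have "\<dots> \<le> 1" by (simp add: mult_nonpos_nonneg)
    finally show ?thesis by (intro mult_right_mono mult_left_mono) auto
  qed
  also have "\<dots> \<le> exp (- V - B * real G) * Z X k"
    using mult_left_mono[OF Z_lower[of k], of "exp (- V - B * real G)"] by simp
  also have "\<dots> = (\<Sum>v\<in>lang X k. exp (Smf X f v - V - B * real G))"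
    unfolding Z_def sum_distrib_left exp_add[symmetric] by (simp add: algebra_simps)
  also have "\<dots> \<le> (\<Sum>v\<in>lang X k. exp (birkhoff f m (pt v)))"
  proof (rule sum_mono)
    fix v assume v: "v \<in> lang X k"
    have x: "pt v \<in> X" using pt(1)[OF v] by (simp add: per_def)
    have "Smf X f v \<le> birkhoff f k (pt v) + V" by (rule Smf_le_birkhoff[OF x pt(2)[OF v]])
    moreover have "- (B * real G) \<le> birkhoff f G (\<lambda>i. pt v (i + int k))"
      using birkhoff_bound[OF X_translate[OF x], of G "int k"] by (simp add: abs_le_iff)
    ultimately show "exp (Smf X f v - V - B * real G) \<le> exp (birkhoff f m (pt v))"
      unfolding k(1) birkhoff_add by simp
  qed
  also have "\<dots> = (\<Sum>x\<in>pt ` lang X k. exp (birkhoff f m x))" by (simp add: sum.reindex[OF inj])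
  also have "\<dots> \<le> (\<Sum>x\<in>per m. exp (birkhoff f m x))"
    using pt(1) finite_per[OF assms(2)] by (intro sum_mono2) auto
  finally show ?thesis .
qed

end

text \<open>\<open>decay\<close> is all that the equilibrium state contributes to the probabilistic
  part. \<open>C0\<close> makes it valid for short words too, and \<open>\<gamma>\<close> is
  strictly below \<open>\<alpha>\<close> so that repeated windows cost more weight than they save in
  probability.\<close>

locale gibbs_decay = sft_system +
  fixes \<gamma> \<alpha> C0 :: real
  assumes par: "0 < \<gamma>" "\<gamma> < \<alpha>" "\<alpha> \<le> 1" "1 \<le> C0"
    and decay: "\<And>u k. u \<in> lang X k \<Longrightarrow> exp (Smf X f u - prs * real k) \<le> C0 * \<gamma> ^ k"
begin

definition CC :: real where "CC = CZ\<^sup>2 * C0"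

abbreviation loss :: "nat \<Rightarrow> nat \<Rightarrow> real" where
  "loss \<equiv> repeat_loss CC (\<gamma> / \<alpha>)"

lemma CC_ge1: "CC \<ge> 1"
proof -
  have "1 * 1 \<le> CZ\<^sup>2 * C0" using CZ_ge1 par by (intro mult_mono one_le_power) auto
  then show ?thesis by (simp add: CC_def)
qed

lemma alpha_pos: "\<alpha> > 0" using par by linarith

lemma loss_ge1: "loss M n \<ge> 1"
proof -
  have "1 * 1 \<le> loss M n" unfolding repeat_loss_def using CC_ge1 par alpha_pos
    by (intro mult_mono one_le_power) auto
  then show ?thesis by simp
qed

lemma prefix_weight_tree: "prefix_weight (lang X M) (\<lambda>w. exp (Smf X f w)) v = tree M v"
  by (simp add: prefix_weight_def tree_def)

lemma tree_growth:
  assumes "length v + length u \<le> M"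
  shows "tree M (v @ u) \<le> CC * \<gamma> ^ length u * tree M v"
proof (cases "u \<in> lang X (length u)")
  case True
  have "tree M (v @ u) \<le> CZ\<^sup>2 * exp (Smf X f u - prs * real (length u)) * tree M v"
    by (rule tree_append_le[OF assms])
  also have "\<dots> \<le> CZ\<^sup>2 * (C0 * \<gamma> ^ length u) * tree M v"
    using decay[OF True] tree_nonneg by (intro mult_right_mono mult_left_mono) auto
  finally show ?thesis by (simp add: CC_def mult.assoc)
next
  case False
  then have "v @ u \<notin> lang X (length (v @ u))" using lang_appendD(2) by blast
  then have "tree M (v @ u) = 0" using assms by (intro tree_eq_0) auto
  then show ?thesis using CC_ge1 par tree_nonneg[of M v] by simp
qed

lemma window_sum:
  assumes x: "\<And>w k. w \<in> lang X M \<Longrightarrow> k < e \<Longrightarrow> x w k = w ! k"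
    and e: "e \<le> M" and n: "n \<ge> 1" and v: "length v \<le> e"
  shows "(\<Sum>w\<in>{w\<in>lang X M. take (length v) w = v}. exp (Smf X f w) * \<alpha> ^ new_count n (length v) e (x w))
    \<le> tree M v * (\<alpha> ^ (e - length v) * loss M n)"
  unfolding prefix_weight_tree[symmetric]
proof (rule new_window_sum)
  show "prefix_weight (lang X M) (\<lambda>w. exp (Smf X f w)) (v @ u)
      \<le> CC * \<gamma> ^ length u * prefix_weight (lang X M) (\<lambda>w. exp (Smf X f w)) v"
    if "length v + length u \<le> M" for v u
    unfolding prefix_weight_tree by (rule tree_growth[OF that])
qed (use assms par CC_ge1 in \<open>auto dest: lang_length\<close>)

text \<open>A word has at least as many distinct n-subwords as new windows, and it has M + 1 - n
  window positions.\<close>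

lemma first_moment:
  assumes n: "n \<ge> 1" "n \<le> M"
  shows "(\<Sum>w\<in>lang X M. exp (Smf X f w) * \<alpha> ^ card (subwords n w))
    \<le> Z X M * (\<alpha> ^ (M + 1 - n) * loss M n)"
proof -
  have "(\<Sum>w\<in>lang X M. exp (Smf X f w) * \<alpha> ^ card (subwords n w))
      \<le> (\<Sum>w\<in>lang X M. exp (Smf X f w) * \<alpha> ^ new_count n 0 (M + 1 - n) ((!) w))"
  proof (intro sum_mono mult_left_mono power_decreasing)
    fix w assume "w \<in> lang X M"
    then have lw: "length w = M" by (rule lang_length)
    show "new_count n 0 (M + 1 - n) ((!) w) \<le> card (subwords n w)"
    proof (rule new_count_le_card[OF finite_subwords])
      fix j assume j: "j < M + 1 - n"
      then have jn: "j + n \<le> length w" using lw n by linarith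
      then have "map (\<lambda>k. w ! (j + k)) [0..<n] = take n (drop j w)"
        by (intro nth_equalityI) auto
      then show "map (\<lambda>k. w ! (j + k)) [0..<n] \<in> subwords n w" using jn by (auto simp: subwords_def)
    qed
  qed (use par alpha_pos in auto)
  also have "\<dots> \<le> Z X M * (\<alpha> ^ (M + 1 - n) * loss M n)"
    using window_sum[of M "M + 1 - n" "(!)" n "[]"] n by (simp add: tree_Nil)
  finally show ?thesis .
qed

text \<open>Words whose two halves begin with the same n-word, read cyclically. That word at place m
  is prescribed, which costs \<open>\<gamma> ^ n\<close>; the n windows starting inside it are not
  counted, which loses \<open>\<alpha>\<close> to the power -n. The two ranges that remain are
  summed separately, whence the squared loss.\<close>

lemma pair_moment:
  assumes n: "n \<ge> 1" "n \<le> m"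
  shows "(\<Sum>w\<in>{w\<in>lang X (2 * m). take n (drop m w) = take n w}.
      exp (Smf X f w) * \<alpha> ^ new_count n 0 (2 * m) (\<lambda>k. w ! (k mod (2 * m))))
    \<le> Z X (2 * m) * (CC * (\<gamma> / \<alpha>) ^ n * \<alpha> ^ (2 * m) * (loss (2 * m) n)\<^sup>2)"
proof -
  define M where "M = 2 * m"
  define \<Lambda> where "\<Lambda> = {w\<in>lang X M. take n (drop m w) = take n w}"
  define x2 where "x2 = (\<lambda>w k. w ! (k mod M) :: 'a)"
  \<comment> \<open>The first half read with period m. A window starting before m ends before m + n,
    where the common prefix makes this reading agree with that of the whole word; its count
    therefore depends on the first half alone and factors out.\<close>
  define x1 where "x1 = (\<lambda>w k. w ! (k mod m) :: 'a)"
  define n1 where "n1 = (\<lambda>w. \<alpha> ^ new_count n 0 m (x1 w))"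
  define n2 where "n2 = (\<lambda>w. \<alpha> ^ new_count n (m + n) M (x2 w))"
  define R where "R = loss M n"
  have m: "m > 0" using n by simp
  have R0: "R \<ge> 0" using loss_ge1[of M n] by (simp add: R_def)
  have len: "length w = M" if "w \<in> lang X M" for w using that by (rule lang_length)
  have n10: "n1 w \<ge> 0" for w using alpha_pos by (simp add: n1_def)
  have x12: "x1 w k = x2 w k" if w: "w \<in> \<Lambda>" and k: "k < m + n" for w k
  proof (cases "k < m")
    case True
    then show ?thesis by (simp add: x1_def x2_def M_def)
  next
    case False
    define t where "t = k - m"
    have t: "k = m + t" "t < n" "t < m" using False k n by (auto simp: t_def)
    have "take n (drop m w) ! t = take n w ! t" using w by (simp add: \<Lambda>_def)
    then have "w ! (m + t) = w ! t" using t w len[of w] n by (simp add: \<Lambda>_def M_def)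
    then show ?thesis using t by (simp add: x1_def x2_def M_def)
  qed
  have "(\<Sum>w\<in>\<Lambda>. exp (Smf X f w) * \<alpha> ^ new_count n 0 M (x2 w))
      \<le> (\<Sum>w\<in>\<Lambda>. exp (Smf X f w) * (n1 w * n2 w))"
  proof (intro sum_mono mult_left_mono)
    fix w assume w: "w \<in> \<Lambda>"
    have "new_count n 0 m (x1 w) + new_count n (m + n) M (x2 w) \<le> new_count n 0 M (x2 w)"
      using new_count_split[of 0 "m + n" m M n "x2 w"] new_count_cong[of m n "x1 w" "x2 w" 0] x12[OF w]
      by (simp add: M_def)
    then show "\<alpha> ^ new_count n 0 M (x2 w) \<le> n1 w * n2 w"
      unfolding n1_def n2_def power_add[symmetric] using par alpha_pos by (intro power_decreasing) auto
  qed simp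
  also have "\<dots> = (\<Sum>v\<in>take m ` \<Lambda>. \<Sum>w\<in>{w\<in>\<Lambda>. take m w = v}. exp (Smf X f w) * (n1 w * n2 w))"
    by (rule sum.group[symmetric]) (auto simp: \<Lambda>_def)
  also have "\<dots> \<le> (\<Sum>v\<in>take m ` \<Lambda>. n1 v * (CC * \<gamma> ^ n * \<alpha> ^ (m - n) * R) * tree M v)"
  proof (rule sum_mono)
    fix v assume "v \<in> take m ` \<Lambda>"
    then have lv: "length v = m" using len by (auto simp: \<Lambda>_def M_def)
    define u where "u = take n v"
    have lu: "length u = n" "length (v @ u) = m + n" using lv n by (auto simp: u_def)
    have n1v: "n1 w = n1 v" if "take m w = v" for w
    proof -
      have "x1 w k = x1 v k" for k
        unfolding x1_def using that m by (metis nth_take mod_less_divisor)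
      then have "x1 w = x1 v" by (rule ext)
      then show ?thesis by (simp add: n1_def)
    qed
    have "(\<Sum>w\<in>{w\<in>\<Lambda>. take m w = v}. exp (Smf X f w) * (n1 w * n2 w))
        = n1 v * (\<Sum>w\<in>{w\<in>\<Lambda>. take m w = v}. exp (Smf X f w) * n2 w)"
      unfolding sum_distrib_left using n1v by (intro sum.cong) (auto simp: mult_ac)
    also have "\<dots> \<le> n1 v * (\<Sum>w\<in>{w\<in>lang X M. take (length (v @ u)) w = v @ u}. exp (Smf X f w) * n2 w)"
    proof (intro mult_left_mono sum_mono2)
      show "{w\<in>\<Lambda>. take m w = v} \<subseteq> {w\<in>lang X M. take (length (v @ u)) w = v @ u}"
      proof
        fix w assume w: "w \<in> {w\<in>\<Lambda>. take m w = v}"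
        have "take (m + n) w = take m w @ take n (drop m w)" by (simp add: take_add)
        also have "\<dots> = v @ take n w" using w by (auto simp: \<Lambda>_def)
        also have "take n w = u" using w n by (auto simp: u_def min_def)
        finally show "w \<in> {w\<in>lang X M. take (length (v @ u)) w = v @ u}" using w lu by (simp add: \<Lambda>_def)
      qed
    qed (use alpha_pos n10 in \<open>auto simp: n2_def\<close>)
    also have "\<dots> \<le> n1 v * (tree M (v @ u) * (\<alpha> ^ (M - length (v @ u)) * R))"
      using window_sum[of M M x2 n "v @ u"] lu n n10[of v]
      by (intro mult_left_mono) (auto simp: n2_def x2_def R_def M_def)
    also have "\<dots> \<le> n1 v * ((CC * \<gamma> ^ n * tree M v) * (\<alpha> ^ (m - n) * R))"
      using tree_growth[of v u M] lu lv n alpha_pos n10[of v] R0 CC_ge1 par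
      by (intro mult_left_mono mult_mono) (auto simp: M_def tree_nonneg)
    finally show "(\<Sum>w\<in>{w\<in>\<Lambda>. take m w = v}. exp (Smf X f w) * (n1 w * n2 w))
        \<le> n1 v * (CC * \<gamma> ^ n * \<alpha> ^ (m - n) * R) * tree M v" by (simp add: mult_ac)
  qed
  also have "\<dots> \<le> (\<Sum>v\<in>take m ` lang X M. n1 v * (CC * \<gamma> ^ n * \<alpha> ^ (m - n) * R) * tree M v)"
    using n10 CC_ge1 par alpha_pos R0 tree_nonneg by (intro sum_mono2) (auto simp: \<Lambda>_def)
  also have "\<dots> = (CC * \<gamma> ^ n * \<alpha> ^ (m - n) * R) * (\<Sum>v\<in>take m ` lang X M. n1 v * tree M v)"
    by (simp add: sum_distrib_left mult_ac)
  also have "(\<Sum>v\<in>take m ` lang X M. n1 v * tree M v) = (\<Sum>w\<in>lang X M. exp (Smf X f w) * n1 w)"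
  proof -
    have "(\<Sum>w\<in>lang X M. exp (Smf X f w) * n1 w)
        = (\<Sum>v\<in>take m ` lang X M. \<Sum>w\<in>{w\<in>lang X M. take m w = v}. exp (Smf X f w) * n1 w)"
      by (rule sum.group[symmetric]) auto
    also have "\<dots> = (\<Sum>v\<in>take m ` lang X M. n1 v * tree M v)"
    proof (rule sum.cong[OF refl])
      fix v assume "v \<in> take m ` lang X M"
      then have lv: "length v = m" using len by (auto simp: M_def)
      have n1v: "n1 w = n1 v" if "take m w = v" for w
      proof -
        have "x1 w k = x1 v k" for k
          unfolding x1_def using that m by (metis nth_take mod_less_divisor)
        then have "x1 w = x1 v" by (rule ext)
        then show ?thesis by (simp add: n1_def)
      qed
      show "(\<Sum>w\<in>{w\<in>lang X M. take m w = v}. exp (Smf X f w) * n1 w) = n1 v * tree M v"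
        unfolding tree_def sum_distrib_left lv using n1v by (intro sum.cong) (auto simp: mult_ac)
    qed
    finally show ?thesis by simp
  qed
  also have "(\<Sum>w\<in>lang X M. exp (Smf X f w) * n1 w) \<le> Z X M * (\<alpha> ^ m * R)"
    using window_sum[of M m x1 n "[]"] n by (simp add: tree_Nil n1_def x1_def M_def R_def)
  also have "CC * \<gamma> ^ n * \<alpha> ^ (m - n) * R * (Z X M * (\<alpha> ^ m * R))
      = Z X M * (CC * (\<gamma> / \<alpha>) ^ n * \<alpha> ^ M * R\<^sup>2)"
  proof -
    have "\<alpha> ^ M = \<alpha> ^ n * \<alpha> ^ (m - n) * \<alpha> ^ m"
      using n by (simp add: power_add[symmetric] M_def mult_2)
    then show ?thesis using alpha_pos by (simp add: power_divide power2_eq_square)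
  qed
  finally show ?thesis
    using CC_ge1 par alpha_pos R0 by (simp add: \<Lambda>_def x2_def M_def R_def mult_left_mono)
qed

end

section \<open>Concatenation of periodic points\<close>

text \<open>Each entry is evaluated at i itself and not at i mod m: for entries of period m, every
  block displays one full period either way.\<close>

definition concat_per :: "nat \<Rightarrow> (int \<Rightarrow> 'a) list \<Rightarrow> int \<Rightarrow> 'a" where
  "concat_per m zs i = (zs ! nat ((i div int m) mod int (length zs))) i"

lemma concat_per_index:
  assumes "zs \<noteq> []"
  shows "nat (q mod int (length zs)) < length zs"
  using assms by (simp add: nat_less_iff)

text \<open>A window of length at most m that crosses a seam sees only the first n letters of the
  next block. All entries share these, so the window already occurs in the orbit of the entry before
  the seam, and concatenation creates no new n-words.\<close>

lemma concat_per_window: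
  assumes m: "m > 0" "n \<le> m" and zs: "zs \<noteq> []" "\<And>z. z \<in> set zs \<Longrightarrow> periodic m z"
    and a: "\<And>z. z \<in> set zs \<Longrightarrow> word z 0 n = a"
  shows "\<exists>z\<in>set zs. \<forall>t<n. concat_per m zs (i + int t) = z (i + int t)"
proof -
  define Z where "Z = (\<lambda>q. zs ! nat (q mod int (length zs)))"
  have Z: "Z q \<in> set zs" for q unfolding Z_def by (rule nth_mem[OF concat_per_index[OF zs(1)]])
  have cz: "concat_per m zs i = Z (i div int m) i" for i by (simp add: concat_per_def Z_def)
  have "concat_per m zs (i + int t) = Z (i div int m) (i + int t)" if t: "t < n" for t
  proof (cases "i mod int m + int t < int m")
    case True
    then have "(i + int t) div int m = i div int m"
      using div_mod_int_add_less(1)[of "int t" i "int m"] m by simp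
    then show ?thesis by (simp add: cz)
  next
    case False
    have lt: "i mod int m < int m" using m by simp
    have d: "(i + int t) div int m = i div int m + 1"
      "(i + int t) mod int m = i mod int m + int t - int m"
      using div_mod_int_add_ge[of "int m" i "int t"] False lt t m by auto
    define s where "s = nat ((i + int t) mod int m)"
    have ss: "int s = i mod int m + int t - int m" using False by (simp add: s_def d(2))
    have s: "int s = (i + int t) mod int m" using ss d(2) by simp
    have "s < n" using ss lt t by linarith
    note s = s this
    have val: "z (i + int t) = a ! s" if z: "z \<in> set zs" for z
    proof -
      have "z (i + int t) = z (int s)" using periodic_mod[OF zs(2)[OF z], of "i + int t"] s(1) by simp
      also have "\<dots> = word z 0 n ! s" using s(2) by simp
      finally show ?thesis using a[OF z] by simp
    qed
    show ?thesis using val[OF Z, of "i div int m + 1"] val[OF Z, of "i div int m"] by (simp add: cz d)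
  qed
  then show ?thesis using Z by blast
qed

lemma concat_per_block:
  assumes m: "m > 0" and zs: "\<And>z. z \<in> set zs \<Longrightarrow> periodic m z" and j: "j < length zs" and t: "t < m"
  shows "concat_per m zs (int (j * m) + int t) = (zs ! j) (int t)"
proof -
  have "(int (j * m) + int t) div int m = int j"
    using m t by (simp add: div_mult_self3 add.commute[of "int j * int m"])
  then have "concat_per m zs (int (j * m) + int t) = (zs ! j) (int (j * m) + int t)"
    using j by (simp add: concat_per_def)
  also have "\<dots> = (zs ! j) ((int (j * m) + int t) mod int m)"
    by (rule periodic_mod[OF zs[OF nth_mem[OF j]], symmetric])
  also have "(int (j * m) + int t) mod int m = int t" using t by simp
  finally show ?thesis .
qed

lemma concat_per_periodic:
  assumes "m > 0" and "\<And>z. z \<in> set zs \<Longrightarrow> periodic m z" "zs \<noteq> []"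
  shows "periodic (length zs * m) (concat_per m zs)"
  unfolding periodic_def
proof
  fix i
  have "(i + int (length zs * m)) div int m = i div int m + int (length zs)" using assms(1) by simp
  then have "concat_per m zs (i + int (length zs * m))
      = (zs ! nat ((i div int m) mod int (length zs))) (i + int (length zs * m))"
    by (simp add: concat_per_def)
  also have "\<dots> = (zs ! nat ((i div int m) mod int (length zs))) i"
    using periodic_mod[OF assms(2)[OF nth_mem[OF concat_per_index[OF assms(3)]]]]
    by (metis mod_mult_self1 of_nat_mult)
  finally show "concat_per m zs (i + int (length zs * m)) = concat_per m zs i"
    by (simp add: concat_per_def)
qed

context sft_system
begin

lemma concat_per_birkhoff:
  assumes m: "m > 0" and zs: "\<And>z. z \<in> set zs \<Longrightarrow> z \<in> per m" and X: "concat_per m zs \<in> X"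
    and k: "k \<le> length zs"
  shows "(\<Sum>j<k. birkhoff f m (zs ! j) - V) \<le> birkhoff f (k * m) (concat_per m zs)"
  using k
proof (induction k)
  case 0
  show ?case by (simp add: birkhoff_def)
next
  case (Suc k)
  then have k: "k < length zs" by simp
  have p: "\<And>z. z \<in> set zs \<Longrightarrow> periodic m z" using zs by (simp add: per_def)
  have z: "zs ! k \<in> X" using zs[OF nth_mem[OF k]] by (simp add: per_def)
  have "\<bar>birkhoff f m (\<lambda>i. concat_per m zs (i + int (k * m))) - birkhoff f m (zs ! k)\<bar> \<le> V"
    using concat_per_block[OF m p k] by (intro distort X_translate[OF X] z) (simp add: add.commute)
  moreover have "birkhoff f (Suc k * m) (concat_per m zs)
      = birkhoff f (k * m) (concat_per m zs) + birkhoff f m (\<lambda>i. concat_per m zs (i + int (k * m)))"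
    using birkhoff_add[of f "k * m" m "concat_per m zs"] by (simp add: add.commute)
  ultimately show ?case using Suc by simp
qed

text \<open>The points of Q act as the letters of a full shift inside Y: any k of them may be
  concatenated, and the result determines them. This bounds \<open>Z Y (k * m)\<close> below by a
  k-th power, with one distortion \<open>V\<close> per block.\<close>

lemma concat_pressure:
  assumes Y: "translation_invariant Y" "Y \<subseteq> X"
    and win: "\<And>z. (\<And>i. \<exists>x\<in>Y. \<exists>j. \<forall>k<n. z (i + int k) = x (j + int k)) \<Longrightarrow> z \<in> Y"
    and m: "m > 0" "n \<le> m" and Q: "Q \<subseteq> per m \<inter> Y" "Q \<noteq> {}"
    and a: "\<And>x. x \<in> Q \<Longrightarrow> word x 0 n = a"
  shows "ereal ((ln (\<Sum>x\<in>Q. exp (birkhoff f m x)) - V) / real m) \<le> pressure Y f"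
proof -
  have Yne: "Y \<noteq> {}" using Q by auto
  have finQ: "finite Q" using Q finite_per[OF m(1)] finite_subset by blast
  define s where "s = (\<Sum>x\<in>Q. exp (birkhoff f m x - V))"
  have s0: "s > 0" unfolding s_def using finQ Q by (intro sum_pos) auto
  have "s ^ k \<le> Z Y (k * m)" if k: "k \<ge> 1" for k
  proof -
    let ?L = "{zs. set zs \<subseteq> Q \<and> length zs = k}"
    have fin: "finite ?L" by (rule finite_lists_length_eq[OF finQ])
    have p: "\<And>z. z \<in> set zs \<Longrightarrow> periodic m z" "\<And>z. z \<in> set zs \<Longrightarrow> z \<in> per m" "zs \<noteq> []"
      if "zs \<in> ?L" for zs using that Q k by (auto simp: per_def)
    have inY: "concat_per m zs \<in> Y" if zs: "zs \<in> ?L" for zs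
    proof (rule win)
      fix i
      have "\<exists>z\<in>set zs. \<forall>t<n. concat_per m zs (i + int t) = z (i + int t)"
        using p[OF zs] a zs by (intro concat_per_window[OF m]) auto
      then show "\<exists>x\<in>Y. \<exists>j. \<forall>k<n. concat_per m zs (i + int k) = x (j + int k)"
        using zs Q by blast
    qed
    define W :: "(int \<Rightarrow> 'a) list \<Rightarrow> 'a list" where "W = (\<lambda>zs. word (concat_per m zs) 0 (k * m))"
    have inj: "inj_on W ?L"
    proof (rule inj_onI)
      fix zs ys assume zs: "zs \<in> ?L" and ys: "ys \<in> ?L" and eq: "W zs = W ys"
      show "zs = ys"
      proof (rule nth_equalityI)
        fix j assume j: "j < length zs"
        then have jk: "j < k" "j < length ys" using zs ys by auto
        have "(zs ! j) (int t) = (ys ! j) (int t)" if t: "t < m" for t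
        proof -
          have "j * m + t < Suc j * m" using t by simp
          also have "\<dots> \<le> k * m" using jk by (intro mult_right_mono) auto
          finally have "concat_per m zs (int (j * m) + int t) = concat_per m ys (int (j * m) + int t)"
            using eq unfolding W_def word_eq_iff by (metis add_0 of_nat_add)
          then show ?thesis
            using concat_per_block[OF m(1) p(1)[OF zs] j t] concat_per_block[OF m(1) p(1)[OF ys] jk(2) t] by simp
        qed
        then have "word (zs ! j) 0 m = word (ys ! j) 0 m" by (simp add: word_eq_iff)
        moreover have "zs ! j \<in> set zs" "ys ! j \<in> set ys" using j jk by auto
        ultimately show "zs ! j = ys ! j"
          using p(1)[OF zs] p(1)[OF ys] periodic_eqI[OF _ _ m(1)] by blast
      qed (use zs ys in auto)
    qed
    have "s ^ k = (\<Prod>j<k. \<Sum>x\<in>Q. exp (birkhoff f m x - V))" by (simp add: s_def)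
    also have "\<dots> = (\<Sum>zs\<in>?L. \<Prod>j<k. exp (birkhoff f m (zs ! j) - V))"
      by (rule sum_lists_prod[OF finQ, symmetric])
    also have "\<dots> \<le> (\<Sum>zs\<in>?L. exp (Smf Y f (W zs)))"
    proof (rule sum_mono)
      fix zs assume zs: "zs \<in> ?L"
      have "(\<Sum>j<k. birkhoff f m (zs ! j) - V) \<le> birkhoff f (k * m) (concat_per m zs)"
        using concat_per_birkhoff[OF m(1) p(2)[OF zs], where k = k] inY[OF zs] Y zs by auto
      also have "\<dots> \<le> Smf Y f (W zs)" by (rule le_Smf[OF Y(2) inY[OF zs]]) (simp add: W_def)
      finally show "(\<Prod>j<k. exp (birkhoff f m (zs ! j) - V)) \<le> exp (Smf Y f (W zs))"
        by (simp add: exp_sum[symmetric])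
    qed
    also have "\<dots> = (\<Sum>w\<in>W ` ?L. exp (Smf Y f w))" by (simp add: sum.reindex[OF inj])
    also have "\<dots> \<le> Z Y (k * m)"
      unfolding Z_def W_def using inY by (intro sum_mono2) auto
    finally show ?thesis .
  qed
  note pow = this
  obtain L where L: "pressure Y f = ereal L" "(\<lambda>m. ln (Z Y m) / real m) \<longlonglongrightarrow> L"
    using pressure_props[OF Y Yne] by metis
  have "strict_mono (\<lambda>k. k * m)" using m by (intro strict_monoI) simp
  then have "(\<lambda>k. ln (Z Y (k * m)) / real (k * m)) \<longlonglongrightarrow> L"
    using LIMSEQ_subseq_LIMSEQ[OF L(2), of "\<lambda>k. k * m"] by (simp add: o_def)
  moreover have "ln s / real m \<le> ln (Z Y (k * m)) / real (k * m)" if k: "k \<ge> 1" for k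
  proof -
    have "real k * ln s = ln (s ^ k)" using s0 by (simp add: ln_realpow)
    also have "\<dots> \<le> ln (Z Y (k * m))" using pow[OF k] s0 Z_pos[OF Yne, of "k * m"] by simp
    finally have "real k * ln s / real (k * m) \<le> ln (Z Y (k * m)) / real (k * m)"
      by (intro divide_right_mono) auto
    then show ?thesis using k by simp
  qed
  ultimately have "ln s / real m \<le> L"
    by (intro tendsto_lowerbound) (auto intro!: eventually_sequentiallyI[of 1])
  moreover have "ln s = ln (\<Sum>x\<in>Q. exp (birkhoff f m x)) - V"
  proof -
    have "s = (\<Sum>x\<in>Q. exp (birkhoff f m x)) / exp V" by (simp add: s_def exp_diff sum_divide_distrib)
    moreover have "(\<Sum>x\<in>Q. exp (birkhoff f m x)) > 0" using finQ Q by (intro sum_pos) auto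
    ultimately show ?thesis by (simp add: ln_div)
  qed
  ultimately show ?thesis by (simp add: L(1))
qed

text \<open>Points are sorted by their first n letters; by pigeonhole one class carries at least the
  average weight, and that class can be concatenated.\<close>

lemma periodic_pressure:
  assumes Y: "translation_invariant Y" "Y \<subseteq> X"
    and win: "\<And>z. (\<And>i. \<exists>x\<in>Y. \<exists>j. \<forall>k<n. z (i + int k) = x (j + int k)) \<Longrightarrow> z \<in> Y"
    and m: "m > 0" "n \<le> m" and ne: "per m \<inter> Y \<noteq> {}"
  shows "ereal ((ln (\<Sum>x\<in>per m \<inter> Y. exp (birkhoff f m x)) - real n * ln (real CARD('a)) - V) / real m)
    \<le> pressure Y f"
proof -
  let ?S = "per m \<inter> Y" and ?W = "{w :: 'a list. length w = n}"
  define N where "N = (\<Sum>x\<in>?S. exp (birkhoff f m x))"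
  have fin: "finite ?S" using finite_per[OF m(1)] by simp
  have N0: "N > 0" unfolding N_def using fin ne by (intro sum_pos) auto
  have cardW: "real (card ?W) = real CARD('a) ^ n"
    using card_lists_length_eq[of "UNIV :: 'a set" n] by simp
  have A: "real CARD('a) > 0" by simp
  define Q where "Q = (\<lambda>a. {x\<in>?S. word x 0 n = a})"
  have "\<exists>a\<in>?W. N / real CARD('a) ^ n \<le> (\<Sum>x\<in>Q a. exp (birkhoff f m x))"
  proof (rule ccontr)
    assume neg: "\<not> ?thesis"
    have Wne: "?W \<noteq> {}" by (auto intro: exI[of _ "replicate n undefined"])
    have "N = (\<Sum>a\<in>?W. \<Sum>x\<in>Q a. exp (birkhoff f m x))"
      unfolding N_def Q_def by (rule sum.group[symmetric]) (use fin finite_words in auto)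
    also have "\<dots> < (\<Sum>a\<in>?W. N / real CARD('a) ^ n)"
      using neg finite_words Wne by (intro sum_strict_mono) auto
    also have "\<dots> = N" using A by (simp add: cardW)
    finally show False by simp
  qed
  then obtain a where a: "N / real CARD('a) ^ n \<le> (\<Sum>x\<in>Q a. exp (birkhoff f m x))" by blast
  have pos: "N / real CARD('a) ^ n > 0" using N0 A by simp
  have "Q a \<noteq> {}" using a pos by auto
  then have "ereal ((ln (\<Sum>x\<in>Q a. exp (birkhoff f m x)) - V) / real m) \<le> pressure Y f"
    by (intro concat_pressure[OF Y win m]) (auto simp: Q_def)
  moreover have "ln N - real n * ln (real CARD('a)) \<le> ln (\<Sum>x\<in>Q a. exp (birkhoff f m x))"
  proof -
    have "ln N - real n * ln (real CARD('a)) = ln (N / real CARD('a) ^ n)"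
      using N0 A by (simp add: ln_div ln_realpow)
    also have "\<dots> \<le> ln (\<Sum>x\<in>Q a. exp (birkhoff f m x))" using a pos by simp
    finally show ?thesis .
  qed
  ultimately show ?thesis
    unfolding N_def by (elim order_trans[rotated]) (simp add: divide_right_mono)
qed

end

section \<open>Correlated pairs of periodic orbits\<close>

context gibbs_decay
begin

definition pair_weight :: "nat \<Rightarrow> nat \<Rightarrow> (int \<Rightarrow> 'a) \<times> (int \<Rightarrow> 'a) \<Rightarrow> real" where
  "pair_weight m n = (\<lambda>(x, y). exp (birkhoff f m x) * exp (birkhoff f m y)
    * \<alpha> ^ card (orbit_words n x \<union> orbit_words n y))"

lemma pair_weight_nonneg: "pair_weight m n p \<ge> 0"
  using alpha_pos by (simp add: pair_weight_def case_prod_beta)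

text \<open>Two periodic points with a common prefix are joined to one point of period 2 m. Its
  n-words all come from the two orbits, so its new windows number at most the cardinality of the
  union, and a sum over pairs becomes a sum over single words.\<close>

lemma common_prefix_pairs:
  assumes n: "n \<ge> 1" "n \<ge> N0" "n \<le> m"
  shows "(\<Sum>p\<in>{(x, y)\<in>per m \<times> per m. word x 0 n = word y 0 n}. pair_weight m n p)
    \<le> exp (2 * V) * (Z X (2 * m) * (CC * (\<gamma> / \<alpha>) ^ n * \<alpha> ^ (2 * m) * (loss (2 * m) n)\<^sup>2))"
proof -
  have m: "m > 0" using n by simp
  let ?A = "{(x, y)\<in>per m \<times> per m. word x 0 n = word y 0 n}"
  let ?B = "{w\<in>lang X (2 * m). take n (drop m w) = take n w}"
  define W where "W = (\<lambda>(x, y). word x 0 m @ word y 0 m :: 'a list)"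
  define g where "g = (\<lambda>w. exp (Smf X f w) * \<alpha> ^ new_count n 0 (2 * m) (\<lambda>k. w ! (k mod (2 * m))))"
  have g0: "g w \<ge> 0" for w using alpha_pos by (simp add: g_def)
  have inj: "inj_on W ?A"
    unfolding W_def by (intro inj_onI) (auto simp: per_def intro!: periodic_eqI[OF _ _ m])
  have step: "W (x, y) \<in> ?B \<and> pair_weight m n (x, y) \<le> exp (2 * V) * g (W (x, y))" if xy: "(x, y) \<in> ?A" for x y
  proof -
    define z where "z = concat_per m [x, y]"
    have p: "\<And>u. u \<in> set [x, y] \<Longrightarrow> periodic m u" "\<And>u. u \<in> set [x, y] \<Longrightarrow> u \<in> per m"
      using xy by (auto simp: per_def)
    have win: "\<exists>u\<in>set [x, y]. \<forall>t<n. z (i + int t) = u (i + int t)" for i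
      unfolding z_def using p xy by (intro concat_per_window[OF m n(3)]) auto
    have zX: "z \<in> X"
    proof (rule window[OF n(2)])
      fix i
      obtain u where "u \<in> set [x, y]" "\<forall>t<n. z (i + int t) = u (i + int t)" using win by blast
      then show "\<exists>x\<in>X. \<exists>j. \<forall>k<n. z (i + int k) = x (j + int k)" using p(2) unfolding per_def by blast
    qed
    have b0: "word z 0 m = word x 0 m" and b1: "word z (int m) m = word y 0 m"
      using concat_per_block[OF m p(1), of "[x, y]" 0] concat_per_block[OF m p(1), of "[x, y]" 1]
      by (auto simp: z_def word_eq_iff)
    have zW: "word z 0 (2 * m) = W (x, y)"
      using word_add[of z 0 m m] b0 b1 by (simp add: W_def mult_2)
    have mem: "W (x, y) \<in> ?B"
    proof -
      have "take n (drop m (W (x, y))) = word y 0 n" "take n (W (x, y)) = word x 0 n"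
        using n by (auto simp: W_def take_word)
      then show ?thesis using xy word_in_lang[OF zX, of 0 "2 * m"] zW by auto
    qed
    have per2: "periodic (2 * m) z" using concat_per_periodic[OF m p(1), of "[x, y]"] by (simp add: z_def mult_2)
    have nth: "W (x, y) ! (k mod (2 * m)) = z (int k)" for k
    proof -
      have "W (x, y) ! (k mod (2 * m)) = z (int (k mod (2 * m)))"
        unfolding zW[symmetric] using m by (subst nth_word) auto
      also have "\<dots> = z (int k)" using periodic_mod[OF per2, of "int k"] by (simp add: zmod_int)
      finally show ?thesis .
    qed
    have "new_count n 0 (2 * m) (\<lambda>k. W (x, y) ! (k mod (2 * m))) \<le> card (orbit_words n x \<union> orbit_words n y)"
    proof (rule new_count_le_card)
      show "finite (orbit_words n x \<union> orbit_words n y)"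
      proof -
        have "periodic m x" "periodic m y" using xy by (auto simp: per_def)
        then show ?thesis using m by (simp add: orbit_words_periodic)
      qed
      fix j
      obtain u where u: "u \<in> set [x, y]" "\<forall>t<n. z (int j + int t) = u (int j + int t)" using win by blast
      have "map (\<lambda>k. W (x, y) ! ((j + k) mod (2 * m))) [0..<n] = word u (int j) n"
        using u(2) by (intro nth_equalityI) (auto simp: nth)
      then show "map (\<lambda>k. W (x, y) ! ((j + k) mod (2 * m))) [0..<n] \<in> orbit_words n x \<union> orbit_words n y"
        using u(1) by (auto simp: orbit_words_def)
    qed
    then have "\<alpha> ^ card (orbit_words n x \<union> orbit_words n y)
        \<le> \<alpha> ^ new_count n 0 (2 * m) (\<lambda>k. W (x, y) ! (k mod (2 * m)))"
      using alpha_pos par by (intro power_decreasing) auto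
    moreover have "exp (birkhoff f m x) * exp (birkhoff f m y) \<le> exp (2 * V) * exp (Smf X f (W (x, y)))"
    proof -
      have "(\<Sum>j<2. birkhoff f m ([x, y] ! j) - V) \<le> birkhoff f (2 * m) z"
        unfolding z_def using zX p(2) by (intro concat_per_birkhoff[OF m]) (auto simp: z_def)
      also have "\<dots> \<le> Smf X f (W (x, y))" by (rule le_Smf[OF order_refl zX zW])
      finally show ?thesis by (simp add: exp_add[symmetric] numeral_2_eq_2)
    qed
    ultimately have "exp (birkhoff f m x) * exp (birkhoff f m y) * \<alpha> ^ card (orbit_words n x \<union> orbit_words n y)
        \<le> exp (2 * V) * exp (Smf X f (W (x, y))) * \<alpha> ^ new_count n 0 (2 * m) (\<lambda>k. W (x, y) ! (k mod (2 * m)))"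
      by - (rule mult_mono, assumption+, use alpha_pos in auto)
    then show ?thesis using mem by (simp add: pair_weight_def g_def mult.assoc)
  qed
  have "(\<Sum>p\<in>?A. pair_weight m n p) \<le> (\<Sum>p\<in>?A. exp (2 * V) * g (W p))"
    using step by (intro sum_mono) blast
  also have "\<dots> = exp (2 * V) * (\<Sum>w\<in>W ` ?A. g w)"
    unfolding sum_distrib_left by (subst sum.reindex[OF inj]) (simp only: o_def)
  also have "\<dots> \<le> exp (2 * V) * (\<Sum>w\<in>?B. g w)"
  proof (intro mult_left_mono sum_mono2)
    show "W ` ?A \<subseteq> ?B" using step by blast
  qed (use g0 in auto)
  also have "\<dots> \<le> exp (2 * V) * (Z X (2 * m) * (CC * (\<gamma> / \<alpha>) ^ n * \<alpha> ^ (2 * m) * (loss (2 * m) n)\<^sup>2))"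
    unfolding g_def using pair_moment[OF n(1,3)] by (intro mult_left_mono) auto
  finally show ?thesis .
qed

text \<open>A pair of orbits sharing a word is rotated so that the common word sits at the origin of both.\<close>
lemma sharing_pairs:
  assumes n: "n \<ge> 1" "n \<ge> N0" "n \<le> m"
  shows "(\<Sum>p\<in>{(x, y)\<in>per m \<times> per m. orbit_words n x \<inter> orbit_words n y \<noteq> {}}. pair_weight m n p)
    \<le> (real m)\<^sup>2 * exp (2 * V) * (Z X (2 * m) * (CC * (\<gamma> / \<alpha>) ^ n * \<alpha> ^ (2 * m) * (loss (2 * m) n)\<^sup>2))"
proof -
  have m: "m > 0" using n by simp
  define A where "A = (\<lambda>(i, j). {(x, y)\<in>per m \<times> per m. word x (int i) n = word y (int j) n})"
  let ?S = "{(x, y)\<in>per m \<times> per m. orbit_words n x \<inter> orbit_words n y \<noteq> {}}"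
  have finP: "finite (per m \<times> per m)" using finite_per[OF m] by simp
  have finA: "finite (A q)" for q by (rule finite_subset[OF _ finP]) (auto simp: A_def)
  have sub: "?S \<subseteq> (\<Union>q\<in>{..<m} \<times> {..<m}. A q)"
  proof
    fix p assume "p \<in> ?S"
    then obtain x y where p: "p = (x, y)" "x \<in> per m" "y \<in> per m" "orbit_words n x \<inter> orbit_words n y \<noteq> {}" by auto
    then obtain w where w: "w \<in> orbit_words n x" "w \<in> orbit_words n y" by blast
    have "periodic m x" "periodic m y" using p by (auto simp: per_def)
    then obtain i j where "i < m" "w = word x (int i) n" "j < m" "w = word y (int j) n"
      using w orbit_words_periodic[OF _ m, of x n] orbit_words_periodic[OF _ m, of y n] by auto
    then have "p \<in> A (i, j)" "(i, j) \<in> {..<m} \<times> {..<m}" using p by (auto simp: A_def)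
    then show "p \<in> (\<Union>q\<in>{..<m} \<times> {..<m}. A q)" by blast
  qed
  \<comment> \<open>Neither the orbit words nor the Birkhoff sum over a period changes under
    translation, so rotating both points keeps the weight of the pair.\<close>
  have each: "(\<Sum>p\<in>A q. pair_weight m n p) \<le> (\<Sum>p\<in>A (0, 0). pair_weight m n p)" for q
  proof -
    obtain i j where q: "q = (i, j)" by (cases q)
    define \<phi> where "\<phi> = (\<lambda>(x, y). (\<lambda>k. x (k + int i), \<lambda>k. y (k + int j)) :: (int \<Rightarrow> 'a) \<times> (int \<Rightarrow> 'a))"
    have inj: "inj_on \<phi> (A q)"
    proof (rule inj_on_inverseI[of _ "\<lambda>(x, y). (\<lambda>k. x (k - int i), \<lambda>k. y (k - int j))"])
    qed (auto simp: \<phi>_def)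
    have "(\<Sum>p\<in>A q. pair_weight m n p) = (\<Sum>p\<in>A q. pair_weight m n (\<phi> p))"
      by (intro sum.cong refl)
        (auto simp: A_def q \<phi>_def pair_weight_def per_def orbit_words_translate birkhoff_periodic_translate[OF _ m])
    also have "\<dots> = (\<Sum>p\<in>\<phi> ` A q. pair_weight m n p)" by (simp add: sum.reindex[OF inj])
    also have "\<dots> \<le> (\<Sum>p\<in>A (0, 0). pair_weight m n p)"
    proof (rule sum_mono2)
      show "finite (A (0, 0))" by (rule finA)
      show "\<phi> ` A q \<subseteq> A (0, 0)" by (auto simp: A_def q \<phi>_def per_translate word_translate)
    qed (rule pair_weight_nonneg)
    finally show ?thesis .
  qed
  have "(\<Sum>p\<in>?S. pair_weight m n p) \<le> (\<Sum>p\<in>(\<Union>q\<in>{..<m} \<times> {..<m}. A q). pair_weight m n p)"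
    using sub finA pair_weight_nonneg by (intro sum_mono2) auto
  also have "\<dots> \<le> (\<Sum>q\<in>{..<m} \<times> {..<m}. \<Sum>p\<in>A q. pair_weight m n p)"
    using finA pair_weight_nonneg by (intro sum_UN_le) auto
  also have "\<dots> \<le> (\<Sum>q\<in>{..<m} \<times> {..<m}. \<Sum>p\<in>A (0, 0). pair_weight m n p)"
    using each by (intro sum_mono) auto
  also have "\<dots> = (real m)\<^sup>2 * (\<Sum>p\<in>A (0, 0). pair_weight m n p)" by (simp add: power2_eq_square)
  also have "(\<Sum>p\<in>A (0, 0). pair_weight m n p)
      \<le> exp (2 * V) * (Z X (2 * m) * (CC * (\<gamma> / \<alpha>) ^ n * \<alpha> ^ (2 * m) * (loss (2 * m) n)\<^sup>2))"
    using common_prefix_pairs[OF n] by (simp add: A_def)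
  finally show ?thesis by (simp add: mult.assoc mult_left_mono)
qed

end

section \<open>Tail estimates\<close>

lemma rand_forbidden_avoids:
  assumes \<alpha>: "0 \<le> \<alpha>" "\<alpha> \<le> 1" and D: "D \<subseteq> lang (X :: (int \<Rightarrow> 'a::finite) set) n"
  shows "measure_pmf.prob (rand_forbidden X \<alpha> n) {F. F \<inter> D = {}} = \<alpha> ^ card D"
proof -
  let ?L = "lang X n" and ?p = "\<lambda>_. bernoulli_pmf (1 - \<alpha>)"
  let ?B = "\<lambda>w. if w \<in> D then {False} else UNIV"
  have "(\<lambda>b. {w\<in>?L. b w}) -` {F. F \<inter> D = {}} = Pi ?L ?B"
    using D by (auto simp: Pi_def)
  then have "measure_pmf.prob (rand_forbidden X \<alpha> n) {F. F \<inter> D = {}}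
      = measure_pmf.prob (Pi_pmf ?L False ?p) (Pi ?L ?B)"
    unfolding rand_forbidden_def by (simp add: measure_map_pmf)
  also have "\<dots> = (\<Prod>w\<in>?L. measure_pmf.prob (bernoulli_pmf (1 - \<alpha>)) (?B w))"
    by (rule measure_Pi_pmf_Pi) simp
  also have "\<dots> = (\<Prod>w\<in>?L. if w \<in> D then \<alpha> else 1)"
    using \<alpha> by (intro prod.cong) (auto simp: measure_pmf_single)
  also have "\<dots> = \<alpha> ^ card D"
    using D by (simp add: prod.If_cases Int_absorb1)
  finally show ?thesis .
qed

lemma finite_rand_forbidden: "finite (set_pmf (rand_forbidden (X :: (int \<Rightarrow> 'a::finite) set) \<alpha> n))"
  by (rule finite_subset[of _ "Pow (lang X n)"]) (auto simp: rand_forbidden_def)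

text \<open>The weight surviving the random deletion. It is applied to words with their subwords for
  the upper tail, and to periodic points with their orbit words for the lower tail.\<close>

definition avoid_sum :: "('i \<Rightarrow> real) \<Rightarrow> ('i \<Rightarrow> 'b set) \<Rightarrow> 'i set \<Rightarrow> 'b set \<Rightarrow> real" where
  "avoid_sum c D I F = (\<Sum>i\<in>I. c i * of_bool (F \<inter> D i = {}))"

context
  fixes p :: "'b set pmf" and U :: "'b set" and \<alpha> :: real
    and c :: "'i \<Rightarrow> real" and D :: "'i \<Rightarrow> 'b set" and I :: "'i set"
  assumes fin: "finite (set_pmf p)"
    and avoid: "\<And>D. D \<subseteq> U \<Longrightarrow> measure_pmf.prob p {F. F \<inter> D = {}} = \<alpha> ^ card D"
    and I: "finite I" and c: "\<And>i. i \<in> I \<Longrightarrow> c i \<ge> 0"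
    and D: "\<And>i. i \<in> I \<Longrightarrow> D i \<subseteq> U" "\<And>i. i \<in> I \<Longrightarrow> finite (D i)" and \<alpha>: "0 < \<alpha>"
begin

lemma avoid_integrable: "integrable (measure_pmf p) (g :: 'b set \<Rightarrow> real)"
  by (rule integrable_measure_pmf_finite[OF fin])

lemma avoid_expectation_of_bool:
  assumes "E \<subseteq> U"
  shows "measure_pmf.expectation p (\<lambda>F. of_bool (F \<inter> E = {})) = \<alpha> ^ card E"
proof -
  have "(\<lambda>F. of_bool (F \<inter> E = {}) :: real) = indicator {F. F \<inter> E = {}}"
    by (auto simp: indicator_def)
  then show ?thesis using avoid[OF assms] by simp
qed

lemma avoid_expectation:
  "measure_pmf.expectation p (avoid_sum c D I) = (\<Sum>i\<in>I. c i * \<alpha> ^ card (D i))"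
  unfolding avoid_sum_def
  by (subst Bochner_Integration.integral_sum[OF avoid_integrable])
    (auto intro!: sum.cong simp: avoid_expectation_of_bool D(1))

lemma avoid_markov:
  assumes "t > 0"
  shows "measure_pmf.prob p {F. avoid_sum c D I F \<ge> t} \<le> (\<Sum>i\<in>I. c i * \<alpha> ^ card (D i)) / t"
proof -
  have "measure_pmf.prob p {F\<in>space (measure_pmf p). avoid_sum c D I F \<ge> t}
      \<le> measure_pmf.expectation p (avoid_sum c D I) / t"
    using assms c
    by (intro integral_Markov_inequality_measure[where A = "UNIV"])
      (auto simp: avoid_integrable avoid_sum_def intro!: AE_I2 sum_nonneg)
  then show ?thesis by (simp add: avoid_expectation)
qed

text \<open>Disjoint sets have independent survival, since cardinalities add, so only intersecting
  pairs contribute to the variance bound. Falling to half the mean accounts for the factor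
  4.\<close>

lemma avoid_chebyshev:
  defines "E \<equiv> (\<Sum>i\<in>I. c i * \<alpha> ^ card (D i))"
  assumes E: "E > 0"
  shows "measure_pmf.prob p {F. avoid_sum c D I F \<le> E / 2}
    \<le> 4 * (\<Sum>(i, j)\<in>{(i, j)\<in>I \<times> I. D i \<inter> D j \<noteq> {}}. c i * c j * \<alpha> ^ card (D i \<union> D j)) / E\<^sup>2"
proof -
  let ?N = "avoid_sum c D I"
  let ?S = "{(i, j)\<in>I \<times> I. D i \<inter> D j \<noteq> {}}"
  have EN: "measure_pmf.expectation p ?N = E" unfolding E_def by (rule avoid_expectation)
  have sq: "(?N F)\<^sup>2 = (\<Sum>(i, j)\<in>I \<times> I. c i * c j * of_bool (F \<inter> (D i \<union> D j) = {}))" for F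
    unfolding avoid_sum_def power2_eq_square sum_product sum.cartesian_product
    by (intro sum.cong refl) (auto simp: of_bool_def)
  have "measure_pmf.expectation p (\<lambda>F. (?N F)\<^sup>2)
      = (\<Sum>q\<in>I \<times> I. measure_pmf.expectation p (\<lambda>F. c (fst q) * c (snd q) * of_bool (F \<inter> (D (fst q) \<union> D (snd q)) = {})))"
    unfolding sq case_prod_beta by (rule Bochner_Integration.integral_sum[OF avoid_integrable])
  also have "\<dots> = (\<Sum>q\<in>I \<times> I. c (fst q) * c (snd q) * \<alpha> ^ card (D (fst q) \<union> D (snd q)))"
  proof (rule sum.cong[OF refl])
    fix q assume "q \<in> I \<times> I"
    then have "D (fst q) \<union> D (snd q) \<subseteq> U"
      using D(1)[of "fst q"] D(1)[of "snd q"] by (simp add: mem_Times_iff)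
    then show "measure_pmf.expectation p (\<lambda>F. c (fst q) * c (snd q) * of_bool (F \<inter> (D (fst q) \<union> D (snd q)) = {}))
        = c (fst q) * c (snd q) * \<alpha> ^ card (D (fst q) \<union> D (snd q))"
      by (simp only: integral_mult_right_zero avoid_expectation_of_bool)
  qed
  also have "\<dots> \<le> (\<Sum>q\<in>I \<times> I. c (fst q) * c (snd q) * (\<alpha> ^ card (D (fst q)) * \<alpha> ^ card (D (snd q)))
      + (if q \<in> ?S then c (fst q) * c (snd q) * \<alpha> ^ card (D (fst q) \<union> D (snd q)) else 0))"
  proof (rule sum_mono)
    fix q assume q: "q \<in> I \<times> I"
    then have c0: "c (fst q) * c (snd q) \<ge> 0" using c by auto
    show "c (fst q) * c (snd q) * \<alpha> ^ card (D (fst q) \<union> D (snd q))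
        \<le> c (fst q) * c (snd q) * (\<alpha> ^ card (D (fst q)) * \<alpha> ^ card (D (snd q)))
        + (if q \<in> ?S then c (fst q) * c (snd q) * \<alpha> ^ card (D (fst q) \<union> D (snd q)) else 0)"
    proof (cases "q \<in> ?S")
      case True
      then show ?thesis using c0 \<alpha> by simp
    next
      case False
      then have "D (fst q) \<inter> D (snd q) = {}" using q by auto
      then have "card (D (fst q) \<union> D (snd q)) = card (D (fst q)) + card (D (snd q))"
        using q D(2) by (intro card_Un_disjoint) auto
      then show ?thesis using False by (simp add: power_add)
    qed
  qed
  also have "\<dots> = E\<^sup>2 + (\<Sum>q\<in>?S. c (fst q) * c (snd q) * \<alpha> ^ card (D (fst q) \<union> D (snd q)))"
  proof -
    have "(\<Sum>q\<in>I \<times> I. c (fst q) * c (snd q) * (\<alpha> ^ card (D (fst q)) * \<alpha> ^ card (D (snd q)))) = E\<^sup>2"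
      unfolding E_def power2_eq_square sum_product sum.cartesian_product
      by (intro sum.cong refl) (auto simp: case_prod_beta)
    moreover have "(\<Sum>q\<in>I \<times> I. if q \<in> ?S then c (fst q) * c (snd q) * \<alpha> ^ card (D (fst q) \<union> D (snd q)) else 0)
        = (\<Sum>q\<in>?S. c (fst q) * c (snd q) * \<alpha> ^ card (D (fst q) \<union> D (snd q)))"
    proof -
      have fin: "finite (I \<times> I)" and S: "(I \<times> I) \<inter> ?S = ?S" using I by auto
      have "(\<Sum>q\<in>(I \<times> I) \<inter> ?S. c (fst q) * c (snd q) * \<alpha> ^ card (D (fst q) \<union> D (snd q)))
          = (\<Sum>q\<in>I \<times> I. if q \<in> ?S then c (fst q) * c (snd q) * \<alpha> ^ card (D (fst q) \<union> D (snd q)) else 0)"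
        by (rule sum.inter_restrict[OF fin])
      then show ?thesis unfolding S by (rule sym)
    qed
    ultimately show ?thesis by (simp only: sum.distrib)
  qed
  finally have var: "measure_pmf.variance p ?N \<le> (\<Sum>(i, j)\<in>?S. c i * c j * \<alpha> ^ card (D i \<union> D j))"
    using measure_pmf.variance_eq[OF avoid_integrable avoid_integrable, of ?N]
    by (simp add: EN case_prod_beta)
  have "measure_pmf.prob p {F. ?N F \<le> E / 2} \<le> measure_pmf.prob p {F\<in>space (measure_pmf p). \<bar>?N F - measure_pmf.expectation p ?N\<bar> \<ge> E / 2}"
    unfolding EN by (intro measure_pmf.finite_measure_mono) (auto simp: abs_if)
  also have "\<dots> \<le> measure_pmf.variance p ?N / (E / 2)\<^sup>2"
    using E by (intro measure_pmf.Chebyshev_inequality avoid_integrable) auto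
  also have "\<dots> \<le> (\<Sum>(i, j)\<in>?S. c i * c j * \<alpha> ^ card (D i \<union> D j)) / (E / 2)\<^sup>2"
    using var by (intro divide_right_mono) auto
  also have "\<dots> = 4 * (\<Sum>(i, j)\<in>?S. c i * c j * \<alpha> ^ card (D i \<union> D j)) / E\<^sup>2"
  proof -
    have "T / (E / 2)\<^sup>2 = 4 * T / E\<^sup>2" for T by (simp add: power_divide)
    then show ?thesis .
  qed
  finally show ?thesis .
qed

end

text \<open>With M proportional to n, the large power in \<open>repeat_loss\<close> is at most the
  exponential of a quantity tending to 0, since n^2 \<open>\<theta> ^ n\<close> does. Only a
  quadratic factor survives, and any exponential beats it.\<close>

lemma repeat_loss_tendsto:
  assumes C: "C \<ge> 0" and \<theta>: "0 < \<theta>" "\<theta> < 1" and d: "d > 0"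
  shows "(\<lambda>n. repeat_loss C \<theta> (q * n) n * exp (- d * real n)) \<longlonglongrightarrow> 0"
proof (rule tendsto_sandwich)
  define a where "a = - ln \<theta>"
  have a: "a > 0" using \<theta> by (simp add: a_def)
  have \<theta>n: "\<theta> ^ n = exp (- a * real n)" for n
    using \<theta> by (simp add: a_def exp_of_nat2_mult)
  define K where "K = real q * C"
  have K: "K \<ge> 0" using C by (simp add: K_def)
  show "\<forall>\<^sub>F n in sequentially. 0 \<le> repeat_loss C \<theta> (q * n) n * exp (- d * real n)"
    using C \<theta> by (auto simp: repeat_loss_def)
  show "\<forall>\<^sub>F n in sequentially. repeat_loss C \<theta> (q * n) n * exp (- d * real n)
      \<le> (1 + K * (real n)\<^sup>2) * exp (- d * real n) * exp (real q * K * ((real n)\<^sup>2 * exp (- a * real n)))"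
  proof (rule always_eventually, rule allI)
    fix n
    define y where "y = real (q * n) * C * \<theta> ^ n"
    have y: "y \<ge> 0" using C \<theta> by (simp add: y_def)
    have "(1 + y) ^ (q * n) \<le> exp y ^ (q * n)"
      using y by (intro power_mono exp_ge_add_one_self) auto
    also have "\<dots> = exp (real q * K * ((real n)\<^sup>2 * exp (- a * real n)))"
      by (simp add: exp_of_nat_mult[symmetric] y_def \<theta>n K_def power2_eq_square mult_ac)
    finally have 1: "(1 + y) ^ (q * n) \<le> exp (real q * K * ((real n)\<^sup>2 * exp (- a * real n)))" .
    have "repeat_loss C \<theta> (q * n) n = (1 + K * (real n)\<^sup>2) * (1 + y) ^ (q * n)"
      by (simp add: repeat_loss_def K_def y_def power2_eq_square mult_ac)
    also have "\<dots> \<le> (1 + K * (real n)\<^sup>2) * exp (real q * K * ((real n)\<^sup>2 * exp (- a * real n)))"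
      using K by (intro mult_left_mono 1) auto
    finally show "repeat_loss C \<theta> (q * n) n * exp (- d * real n)
      \<le> (1 + K * (real n)\<^sup>2) * exp (- d * real n) * exp (real q * K * ((real n)\<^sup>2 * exp (- a * real n)))"
      by (simp add: mult_ac)
  qed
  have "(\<lambda>n. (1 + K * (real n)\<^sup>2) * exp (- d * real n)) \<longlonglongrightarrow> 0"
  proof -
    have "(\<lambda>n::nat. exp (- d * real n)) \<longlonglongrightarrow> 0" "(\<lambda>n::nat. (real n)\<^sup>2 * exp (- d * real n)) \<longlonglongrightarrow> 0"
      using d by real_asymp+
    then have "(\<lambda>n::nat. exp (- d * real n) + K * ((real n)\<^sup>2 * exp (- d * real n))) \<longlonglongrightarrow> 0 + K * 0"
      by (intro tendsto_intros)
    then show ?thesis by (simp add: algebra_simps)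
  qed
  moreover have "(\<lambda>n::nat. exp (real q * K * ((real n)\<^sup>2 * exp (- a * real n)))) \<longlonglongrightarrow> exp (real q * K * 0)"
  proof -
    have "(\<lambda>n::nat. (real n)\<^sup>2 * exp (- a * real n)) \<longlonglongrightarrow> 0" using a by real_asymp
    then show ?thesis by (intro tendsto_intros)
  qed
  ultimately show "(\<lambda>n. (1 + K * (real n)\<^sup>2) * exp (- d * real n) * exp (real q * K * ((real n)\<^sup>2 * exp (- a * real n)))) \<longlonglongrightarrow> 0"
    using tendsto_mult by fastforce
qed simp

lemma Yn_translation_invariant:
  assumes "translation_invariant X"
  shows "translation_invariant (Yn X n F)"
  using assms unfolding translation_invariant_def Yn_def by (auto simp: word_translate)

context sft_system
begin

lemma Yn_window:
  assumes n: "n \<ge> N0" and z: "\<And>i. \<exists>x\<in>Yn X n F. \<exists>j. \<forall>k<n. z (i + int k) = x (j + int k)"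
  shows "z \<in> Yn X n F"
proof -
  have "z \<in> X"
  proof (rule window[OF n])
    fix i
    show "\<exists>x\<in>X. \<exists>j. \<forall>k<n. z (i + int k) = x (j + int k)" using z[of i] unfolding Yn_def by blast
  qed
  moreover have "word z i n \<notin> F" for i
  proof -
    obtain x j where "x \<in> Yn X n F" "\<forall>k<n. z (i + int k) = x (j + int k)" using z[of i] by blast
    then show ?thesis using word_eq_iff[of z i n x j] by (auto simp: Yn_def)
  qed
  ultimately show ?thesis by (simp add: Yn_def)
qed

lemma Yn_iff: "x \<in> X \<Longrightarrow> x \<in> Yn X n F \<longleftrightarrow> F \<inter> orbit_words n x = {}"
  by (auto simp: Yn_def orbit_words_def)

lemma orbit_words_lang: "x \<in> X \<Longrightarrow> orbit_words n x \<subseteq> lang X n"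
  by (auto simp: orbit_words_def)

lemma subwords_lang: "w \<in> lang X m \<Longrightarrow> subwords n w \<subseteq> lang X n"
proof -
  assume w: "w \<in> lang X m"
  have "take n (drop j w) \<in> lang X n" if "j + n \<le> length w" for j
    using take_in_lang[OF drop_in_lang[OF w, of j], of n] that lang_length[OF w] by simp
  then show ?thesis by (auto simp: subwords_def)
qed

end

context gibbs_decay
begin

text \<open>Pressure is at most \<open>ln (Z Y m) / m\<close> for this one m, so a large pressure
  forces a large surviving partition function, and Markov's inequality applies. The term with
  \<open>real n * ln \<alpha>\<close> is the price of the positions near the end where no n-window
  starts.\<close>

lemma upper_tail:
  assumes n: "n \<ge> 1" "n \<le> m" and \<epsilon>: "\<epsilon> > 0"
  shows "measure_pmf.prob (rand_forbidden X \<alpha> n)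
      {F. pressure (Yn X n F) f \<ge> ereal (prs + ln \<alpha> + \<epsilon>)}
    \<le> CZ * loss m n * exp (- real n * ln \<alpha> - real m * \<epsilon>)"
proof -
  let ?p = "rand_forbidden X \<alpha> n"
  let ?N = "avoid_sum (\<lambda>w. exp (Smf X f w)) (subwords n) (lang X m)"
  define t where "t = exp (real m * (prs + ln \<alpha> + \<epsilon>))"
  have sub: "{F. pressure (Yn X n F) f \<ge> ereal (prs + ln \<alpha> + \<epsilon>)} \<subseteq> {F. ?N F \<ge> t}"
  proof
    fix F assume F: "F \<in> {F. pressure (Yn X n F) f \<ge> ereal (prs + ln \<alpha> + \<epsilon>)}"
    define Y where "Y = Yn X n F"
    have ne: "Y \<noteq> {}"
    proof
      assume "Y = {}"
      then have "pressure Y f = - \<infinity>" by (simp add: pressure_def)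
      then show False using F by (simp add: Y_def)
    qed
    have Y: "translation_invariant Y" "Y \<subseteq> X"
      unfolding Y_def using Yn_translation_invariant[OF X_inv] by (auto simp: Yn_def)
    obtain L where L: "pressure Y f = ereal L" "L \<le> ln (Z Y m) / real m"
      using pressure_props[OF Y ne] n by (metis le_trans)
    have "prs + ln \<alpha> + \<epsilon> \<le> ln (Z Y m) / real m" using F L by (simp add: Y_def)
    then have "real m * (prs + ln \<alpha> + \<epsilon>) \<le> ln (Z Y m)" using n by (simp add: field_simps)
    then have "t \<le> Z Y m" unfolding t_def using Z_pos[OF ne, of m] by (simp add: ln_ge_iff)
    also have "\<dots> \<le> (\<Sum>w\<in>lang Y m. exp (Smf X f w) * of_bool (F \<inter> subwords n w = {}))"
      unfolding Z_def
    proof (rule sum_mono)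
      fix w assume w: "w \<in> lang Y m"
      then obtain x i where x: "x \<in> Y" "w = word x i m" by (auto simp: lang_def)
      have "take n (drop j w) \<notin> F" if "j + n \<le> length w" for j
      proof -
        have "take n (drop j w) = word x (i + int j) n" using that x(2) by (simp add: drop_word take_word)
        then show ?thesis using x(1) by (auto simp: Y_def Yn_def)
      qed
      then have "F \<inter> subwords n w = {}" by (auto simp: subwords_def)
      then show "exp (Smf Y f w) \<le> exp (Smf X f w) * of_bool (F \<inter> subwords n w = {})"
        using Smf_mono[OF Y w] by simp
    qed
    also have "\<dots> \<le> ?N F"
      unfolding avoid_sum_def using lang_mono[OF Y(2)] by (intro sum_mono2) auto
    finally show "F \<in> {F. ?N F \<ge> t}" by simp
  qed
  have "measure_pmf.prob ?p {F. pressure (Yn X n F) f \<ge> ereal (prs + ln \<alpha> + \<epsilon>)}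
      \<le> measure_pmf.prob ?p {F. ?N F \<ge> t}"
    by (intro measure_pmf.finite_measure_mono sub) simp
  also have "\<dots> \<le> (\<Sum>w\<in>lang X m. exp (Smf X f w) * \<alpha> ^ card (subwords n w)) / t"
    using par alpha_pos subwords_lang
    by (intro avoid_markov[where U = "lang X n"] finite_rand_forbidden rand_forbidden_avoids)
      (auto simp: t_def finite_subwords)
  also have "\<dots> \<le> (CZ * exp (prs * real m) * (\<alpha> ^ (m - n) * loss m n)) / t"
  proof (intro divide_right_mono)
    have "(\<Sum>w\<in>lang X m. exp (Smf X f w) * \<alpha> ^ card (subwords n w)) \<le> Z X m * (\<alpha> ^ (m + 1 - n) * loss m n)"
      by (rule first_moment[OF n])
    also have "\<dots> \<le> CZ * exp (prs * real m) * (\<alpha> ^ (m - n) * loss m n)"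
      using par alpha_pos loss_ge1[of m n] CZ_ge1
      by (intro mult_mono Z_upper power_decreasing) (auto intro!: mult_nonneg_nonneg)
    finally show "(\<Sum>w\<in>lang X m. exp (Smf X f w) * \<alpha> ^ card (subwords n w))
      \<le> CZ * exp (prs * real m) * (\<alpha> ^ (m - n) * loss m n)" .
  qed (simp add: t_def)
  also have "\<dots> = CZ * loss m n * exp (- real n * ln \<alpha> - real m * \<epsilon>)"
  proof -
    have "\<alpha> ^ (m - n) = exp ((real m - real n) * ln \<alpha>)"
      using alpha_pos n by (simp add: of_nat_diff[symmetric] exp_of_nat_mult del: of_nat_diff)
    then have eq: "exp (prs * real m) * \<alpha> ^ (m - n) / t = exp (- real n * ln \<alpha> - real m * \<epsilon>)"
      unfolding t_def by (simp add: exp_add[symmetric] exp_diff[symmetric] algebra_simps)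
    have "CZ * exp (prs * real m) * (\<alpha> ^ (m - n) * loss m n) / t
        = CZ * loss m n * (exp (prs * real m) * \<alpha> ^ (m - n) / t)" by simp
    then show ?thesis unfolding eq .
  qed
  finally show ?thesis .
qed

text \<open>If at least half of the mean weight of periodic points survives, concatenation yields a
  large pressure. The last hypothesis says that m times the tolerance absorbs the distortion, the
  constant \<open>CP / 2\<close> and the choice of a common prefix.\<close>

lemma lower_tail:
  assumes n: "n \<ge> 1" "n \<ge> N0" "n \<le> m" and m: "m \<ge> N0 + G"
    and \<epsilon>: "V - ln (CP / 2) + real n * ln (real CARD('a)) < real m * \<epsilon>"
  shows "measure_pmf.prob (rand_forbidden X \<alpha> n)
      {F. pressure (Yn X n F) f \<le> ereal (prs + ln \<alpha> - \<epsilon>)}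
    \<le> (4 * exp (2 * V) * CZ * CC / CP\<^sup>2) * (real m)\<^sup>2 * (\<gamma> / \<alpha>) ^ n * (loss (2 * m) n)\<^sup>2"
proof -
  let ?p = "rand_forbidden X \<alpha> n"
  let ?c = "\<lambda>x. exp (birkhoff f m x)"
  let ?N = "avoid_sum ?c (orbit_words n) (per m)"
  have m0: "m > 0" using n by simp
  define E where "E = (\<Sum>x\<in>per m. ?c x * \<alpha> ^ card (orbit_words n x))"
  have fin_orb: "finite (orbit_words n x)" "card (orbit_words n x) \<le> m" if "x \<in> per m" for x
    using that orbit_words_periodic[of m x n] m0 card_image_le[of "{..<m}" "\<lambda>j. word x (int j) n"]
    by (auto simp: per_def)
  \<comment> \<open>A lower bound for the mean with explicit exponents: an orbit of period m has at
    most m distinct n-words.\<close>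
  define e where "e = CP * (\<alpha> ^ m * exp (prs * real m))"
  have e0: "e > 0" using CP_pos alpha_pos by (simp add: e_def)
  have Ee: "e \<le> E"
  proof -
    have "e \<le> \<alpha> ^ m * (\<Sum>x\<in>per m. ?c x)"
      unfolding e_def using periodic_sum_lower[OF m m0] alpha_pos
      by (simp add: mult.left_commute[of CP])
    also have "\<dots> = (\<Sum>x\<in>per m. ?c x * \<alpha> ^ m)" by (simp add: sum_distrib_left mult.commute)
    also have "\<dots> \<le> E" unfolding E_def using fin_orb alpha_pos par
      by (intro sum_mono mult_left_mono power_decreasing) auto
    finally show ?thesis .
  qed
  have E0: "E > 0" using Ee e0 by simp
  have sub: "{F. pressure (Yn X n F) f \<le> ereal (prs + ln \<alpha> - \<epsilon>)} \<subseteq> {F. ?N F \<le> E / 2}"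
  proof (rule subsetI, rule ccontr)
    fix F assume F: "F \<in> {F. pressure (Yn X n F) f \<le> ereal (prs + ln \<alpha> - \<epsilon>)}"
      and "F \<notin> {F. ?N F \<le> E / 2}"
    then have NF: "?N F > E / 2" by simp
    define Y where "Y = Yn X n F"
    have Y: "translation_invariant Y" "Y \<subseteq> X"
      unfolding Y_def using Yn_translation_invariant[OF X_inv] by (auto simp: Yn_def)
    define S where "S = (\<Sum>x\<in>per m \<inter> Y. ?c x)"
    have "?N F = (\<Sum>x\<in>per m. if x \<in> Y then ?c x else 0)"
      unfolding avoid_sum_def Y_def by (intro sum.cong) (auto simp: per_def Yn_iff)
    also have "\<dots> = S" unfolding S_def using finite_per[OF m0] by (simp add: sum.inter_restrict)
    finally have S: "S > e / 2" using NF Ee by simp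
    then have ne: "per m \<inter> Y \<noteq> {}" using e0 by (auto simp: S_def)
    have "ereal ((ln S - real n * ln (real CARD('a)) - V) / real m) \<le> pressure Y f"
      unfolding S_def
    proof (rule periodic_pressure[OF Y _ m0 n(3) ne])
      show "z \<in> Y" if "\<And>i. \<exists>x\<in>Y. \<exists>j. \<forall>k<n. z (i + int k) = x (j + int k)" for z
        using that unfolding Y_def by (rule Yn_window[OF n(2)])
    qed
    also have "\<dots> \<le> ereal (prs + ln \<alpha> - \<epsilon>)" using F by (simp add: Y_def)
    finally have "ln S - real n * ln (real CARD('a)) - V \<le> real m * (prs + ln \<alpha> - \<epsilon>)"
      using m0 by (simp add: field_simps)
    moreover have "ln S > ln (CP / 2) + real m * ln \<alpha> + prs * real m"
    proof -
      have "ln (CP / 2) + real m * ln \<alpha> + prs * real m = ln (e / 2)"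
        using CP_pos alpha_pos by (simp add: e_def ln_div ln_mult_pos ln_realpow)
      also have "\<dots> < ln S" using S e0 by (subst ln_less_cancel_iff) auto
      finally show ?thesis .
    qed
    ultimately show False using \<epsilon> by (simp add: algebra_simps)
  qed
  have "measure_pmf.prob ?p {F. pressure (Yn X n F) f \<le> ereal (prs + ln \<alpha> - \<epsilon>)}
      \<le> measure_pmf.prob ?p {F. ?N F \<le> E / 2}"
    by (intro measure_pmf.finite_measure_mono sub) simp
  also have "\<dots> \<le> 4 * (\<Sum>(x, y)\<in>{(x, y)\<in>per m \<times> per m. orbit_words n x \<inter> orbit_words n y \<noteq> {}}.
      ?c x * ?c y * \<alpha> ^ card (orbit_words n x \<union> orbit_words n y)) / E\<^sup>2"
    unfolding E_def
  proof (rule avoid_chebyshev[where U = "lang X n"])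
    show "measure_pmf.prob ?p {F. F \<inter> D = {}} = \<alpha> ^ card D" if "D \<subseteq> lang X n" for D
      using par alpha_pos that by (intro rand_forbidden_avoids) auto
    show "0 < (\<Sum>i\<in>per m. exp (birkhoff f m i) * \<alpha> ^ card (orbit_words n i))" using E0 by (simp add: E_def)
  qed (use alpha_pos fin_orb finite_per[OF m0] orbit_words_lang finite_rand_forbidden in \<open>auto simp: per_def\<close>)
  also have "\<dots> = 4 * (\<Sum>q\<in>{(x, y)\<in>per m \<times> per m. orbit_words n x \<inter> orbit_words n y \<noteq> {}}. pair_weight m n q) / E\<^sup>2"
    by (simp add: pair_weight_def)
  also have "\<dots> \<le> 4 * ((real m)\<^sup>2 * exp (2 * V) * (Z X (2 * m) * (CC * (\<gamma> / \<alpha>) ^ n * \<alpha> ^ (2 * m) * (loss (2 * m) n)\<^sup>2))) / e\<^sup>2"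
  proof (intro frac_le mult_left_mono sharing_pairs n)
    show "e\<^sup>2 \<le> E\<^sup>2" using Ee e0 by (intro power_mono) auto
    show "0 \<le> 4 * ((real m)\<^sup>2 * exp (2 * V) * (Z X (2 * m) * (CC * (\<gamma> / \<alpha>) ^ n * \<alpha> ^ (2 * m) * (loss (2 * m) n)\<^sup>2)))"
      using CC_ge1 par alpha_pos less_imp_le[OF Z_pos[OF nonempty]] by (intro mult_nonneg_nonneg) auto
  qed (use e0 in auto)
  also have "\<dots> \<le> 4 * ((real m)\<^sup>2 * exp (2 * V) * ((CZ * exp (prs * real (2 * m))) * (CC * (\<gamma> / \<alpha>) ^ n * \<alpha> ^ (2 * m) * (loss (2 * m) n)\<^sup>2))) / e\<^sup>2"
    using CC_ge1 par alpha_pos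
    by (intro divide_right_mono mult_left_mono mult_right_mono Z_upper) auto
  also have "\<dots> = (4 * exp (2 * V) * CZ * CC / CP\<^sup>2) * (real m)\<^sup>2 * (\<gamma> / \<alpha>) ^ n * (loss (2 * m) n)\<^sup>2"
  proof -
    have "e\<^sup>2 = CP\<^sup>2 * (\<alpha> ^ (2 * m) * exp (prs * real (2 * m)))"
      unfolding e_def power_mult_distrib by (simp add: power_mult[symmetric] exp_of_nat_mult[symmetric] mult_ac exp_double[symmetric])
    moreover have "\<alpha> ^ (2 * m) * exp (prs * real (2 * m)) > 0" using alpha_pos by simp
    ultimately show ?thesis using CP_pos alpha_pos by (simp add: field_simps)
  qed
  finally show ?thesis .
qed

end

section \<open>Concentration of the pressure\<close>

context gibbs_decay
begin

theorem pressure_concentration: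
  assumes \<epsilon>: "\<epsilon> > 0"
  shows "\<exists>\<rho>>0. \<exists>N. \<forall>n\<ge>N. measure_pmf.prob (rand_forbidden X \<alpha> n)
    {F. \<bar>pressure (Yn X n F) f - (pressure X f + ereal (ln \<alpha>))\<bar> \<ge> ereal \<epsilon>} < exp (- \<rho> * real n)"
proof -
  define lA where "lA = ln (real CARD('a))"
  \<comment> \<open>The first term pays for \<open>\<alpha>\<close> to the power -n in the upper
    tail and leaves exp (-n). The second pays for the number of prefixes in the lower tail and
    leaves n to absorb the constants.\<close>
  obtain Q :: nat where Q: "max (1 - ln \<alpha>) (lA + 1) / \<epsilon> + 1 \<le> real Q"
    using real_arch_simple by blast
  have Q\<epsilon>: "1 - ln \<alpha> \<le> real Q * \<epsilon>" "lA + 1 \<le> real Q * \<epsilon>"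
  proof -
    have "max (1 - ln \<alpha>) (lA + 1) / \<epsilon> \<le> real Q" using Q by linarith
    then have "max (1 - ln \<alpha>) (lA + 1) \<le> real Q * \<epsilon>" using \<epsilon> by (simp add: pos_divide_le_eq)
    then show "1 - ln \<alpha> \<le> real Q * \<epsilon>" "lA + 1 \<le> real Q * \<epsilon>" by auto
  qed
  have lA: "lA \<ge> 0" unfolding lA_def by (simp add: Suc_leI)
  have Q1: "Q \<ge> 1"
  proof (rule ccontr)
    assume "\<not> Q \<ge> 1"
    then have "Q = 0" by simp
    then show False using Q\<epsilon>(2) lA by simp
  qed
  define \<theta> where "\<theta> = \<gamma> / \<alpha>"
  have \<theta>: "0 < \<theta>" "\<theta> < 1" using par alpha_pos by (auto simp: \<theta>_def)
  define a where "a = - ln \<theta>"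
  have a: "a > 0" using \<theta> by (simp add: a_def)
  have \<theta>n: "\<theta> ^ n = exp (- a * real n)" for n using \<theta> by (simp add: a_def exp_of_nat2_mult)
  \<comment> \<open>In the lower tail three factors exp (-d n) tame the quadratic term and the two
    losses, and a fourth is the rate; this needs 4 d \<le> a. The upper tail needs 2 d \<le>
    1.\<close>
  define d where "d = min 1 a / 8"
  have d: "d > 0" "d - 1 \<le> - d" "3 * d - a \<le> - d" using a by (auto simp: d_def min_def)
  define Kc where "Kc = 4 * exp (2 * V) * CZ * CC / CP\<^sup>2"
  have Kc: "Kc \<ge> 0" using CZ_ge1 CC_ge1 by (simp add: Kc_def)
  define l1 where "l1 = (\<lambda>n. loss (Q * n) n * exp (- d * real n))"
  define l2 where "l2 = (\<lambda>n. loss (2 * Q * n) n * exp (- d * real n))"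
  define s where "s = (\<lambda>n::nat. (real n)\<^sup>2 * exp (- d * real n))"
  \<comment> \<open>The common prefactor of both tails. It tends to 0, so it is eventually below 1
    and the final inequality is strict.\<close>
  define u where "u = (\<lambda>n. CZ * l1 n + Kc * (real Q)\<^sup>2 * s n * (l2 n)\<^sup>2)"
  have CC0: "CC \<ge> 0" using CC_ge1 by simp
  have "l1 \<longlonglongrightarrow> 0" "l2 \<longlonglongrightarrow> 0"
    unfolding l1_def l2_def \<theta>_def[symmetric] by (rule repeat_loss_tendsto[OF CC0 \<theta> d(1)])+
  moreover have "s \<longlonglongrightarrow> 0" unfolding s_def using d(1) by real_asymp
  ultimately have "u \<longlonglongrightarrow> CZ * 0 + Kc * (real Q)\<^sup>2 * 0 * 0\<^sup>2"
    unfolding u_def by (intro tendsto_intros)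
  then have "eventually (\<lambda>n. u n < 1) sequentially" by (intro order_tendstoD) auto
  then obtain n1 where n1: "\<And>n. n \<ge> n1 \<Longrightarrow> u n < 1" by (auto simp: eventually_sequentially)
  obtain n2 :: nat where n2: "V - ln (CP / 2) + 1 \<le> real n2" using real_arch_simple by blast
  show ?thesis
  proof (intro exI conjI allI impI)
    show "d > 0" by fact
    fix n assume n: "max (max n1 n2) (max 1 (N0 + G)) \<le> n"
    define m where "m = Q * n"
    let ?P = "measure_pmf.prob (rand_forbidden X \<alpha> n)"
    have m: "n \<le> m" "real m = real Q * real n" using Q1 by (auto simp: m_def)
    have up: "?P {F. pressure (Yn X n F) f \<ge> ereal (prs + ln \<alpha> + \<epsilon>)} \<le> CZ * l1 n * exp (- d * real n)"
    proof -
      have "?P {F. pressure (Yn X n F) f \<ge> ereal (prs + ln \<alpha> + \<epsilon>)} \<le> CZ * loss m n * exp (- real n * ln \<alpha> - real m * \<epsilon>)"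
        using n m \<epsilon> by (intro upper_tail) auto
      also have "\<dots> \<le> CZ * loss m n * exp (- d * real n + - d * real n)"
      proof (intro mult_left_mono)
        have "real n * (1 - ln \<alpha>) \<le> real n * (real Q * \<epsilon>)" using Q\<epsilon>(1) by (intro mult_left_mono) auto
        moreover have "real n * (d - 1) \<le> real n * - d" using d(2) by (intro mult_left_mono) auto
        ultimately show "exp (- real n * ln \<alpha> - real m * \<epsilon>) \<le> exp (- d * real n + - d * real n)"
          by (simp add: m(2) algebra_simps)
        show "0 \<le> CZ * loss m n" using CZ_ge1 loss_ge1[of m n] by simp
      qed
      also have "\<dots> = CZ * l1 n * exp (- d * real n)"
        unfolding l1_def m_def exp_add by (simp only: mult_ac)
      finally show ?thesis .
    qed
    have low: "?P {F. pressure (Yn X n F) f \<le> ereal (prs + ln \<alpha> - \<epsilon>)}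
        \<le> Kc * (real Q)\<^sup>2 * s n * (l2 n)\<^sup>2 * exp (- d * real n)"
    proof -
      have "?P {F. pressure (Yn X n F) f \<le> ereal (prs + ln \<alpha> - \<epsilon>)} \<le> Kc * (real m)\<^sup>2 * \<theta> ^ n * (loss (2 * m) n)\<^sup>2"
        unfolding Kc_def \<theta>_def
      proof (rule lower_tail)
        have "real n * (lA + 1) \<le> real n * (real Q * \<epsilon>)" using Q\<epsilon>(2) by (intro mult_left_mono) auto
        moreover have "real n2 \<le> real n" using n by simp
        ultimately show "V - ln (CP / 2) + real n * ln (real CARD('a)) < real m * \<epsilon>"
          using n2 by (simp add: lA_def[symmetric] m(2) algebra_simps)
      qed (use n m(1) in auto)
      also have "\<dots> = Kc * (real Q)\<^sup>2 * s n * (l2 n)\<^sup>2 * exp (3 * d * real n - a * real n)"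
      proof -
        have e: "exp (3 * d * real n - a * real n) * (exp (- d * real n) * (exp (- d * real n))\<^sup>2) = \<theta> ^ n"
          by (simp add: \<theta>n exp_double[symmetric] exp_add[symmetric])
        have "loss (2 * m) n = loss (2 * Q * n) n" by (simp add: m_def mult.assoc)
        then have "Kc * (real Q)\<^sup>2 * s n * (l2 n)\<^sup>2 * exp (3 * d * real n - a * real n)
            = Kc * (real m)\<^sup>2 * (exp (3 * d * real n - a * real n) * (exp (- d * real n) * (exp (- d * real n))\<^sup>2)) * (loss (2 * m) n)\<^sup>2"
          unfolding l2_def s_def m(2) power_mult_distrib by (simp only: mult_ac)
        then show ?thesis unfolding e by (rule sym)
      qed
      also have "\<dots> \<le> Kc * (real Q)\<^sup>2 * s n * (l2 n)\<^sup>2 * exp (- d * real n)"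
      proof (rule mult_left_mono)
        have "real n * (3 * d - a) \<le> real n * - d" using d(3) by (intro mult_left_mono) auto
        then show "exp (3 * d * real n - a * real n) \<le> exp (- d * real n)" by (simp add: algebra_simps)
        show "0 \<le> Kc * (real Q)\<^sup>2 * s n * (l2 n)\<^sup>2" using Kc by (simp add: s_def)
      qed
      finally show ?thesis .
    qed
    have sub: "{F. \<bar>pressure (Yn X n F) f - (pressure X f + ereal (ln \<alpha>))\<bar> \<ge> ereal \<epsilon>}
        \<subseteq> {F. pressure (Yn X n F) f \<ge> ereal (prs + ln \<alpha> + \<epsilon>)} \<union> {F. pressure (Yn X n F) f \<le> ereal (prs + ln \<alpha> - \<epsilon>)}"
    proof
      fix F assume "F \<in> {F. \<bar>pressure (Yn X n F) f - (pressure X f + ereal (ln \<alpha>))\<bar> \<ge> ereal \<epsilon>}"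
      then show "F \<in> {F. pressure (Yn X n F) f \<ge> ereal (prs + ln \<alpha> + \<epsilon>)} \<union> {F. pressure (Yn X n F) f \<le> ereal (prs + ln \<alpha> - \<epsilon>)}"
        \<comment> \<open>The case distinction includes the value minus infinity: an empty subshift
          counts as a downward deviation.\<close>
        unfolding pressure_X by (cases "pressure (Yn X n F) f") (auto simp: abs_if split: if_splits)
    qed
    have "?P {F. \<bar>pressure (Yn X n F) f - (pressure X f + ereal (ln \<alpha>))\<bar> \<ge> ereal \<epsilon>}
        \<le> ?P ({F. pressure (Yn X n F) f \<ge> ereal (prs + ln \<alpha> + \<epsilon>)} \<union> {F. pressure (Yn X n F) f \<le> ereal (prs + ln \<alpha> - \<epsilon>)})"
      by (intro measure_pmf.finite_measure_mono sub) simp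
    also have "\<dots> \<le> ?P {F. pressure (Yn X n F) f \<ge> ereal (prs + ln \<alpha> + \<epsilon>)} + ?P {F. pressure (Yn X n F) f \<le> ereal (prs + ln \<alpha> - \<epsilon>)}"
      by (rule measure_Un_le) auto
    also have "\<dots> \<le> u n * exp (- d * real n)" using up low by (simp add: u_def distrib_right)
    also have "\<dots> < 1 * exp (- d * real n)" using n1[of n] n by (intro mult_strict_right_mono) auto
    finally show "?P {F. \<bar>pressure (Yn X n F) f - (pressure X f + ereal (ln \<alpha>))\<bar> \<ge> ereal \<epsilon>} < exp (- d * real n)" by simp
  qed
qed

end

section \<open>From a mixing SFT with a Hoelder potential to the abstract setting\<close>

lemma shift_dist_le:
  assumes "\<And>i. nat \<bar>i\<bar> < k \<Longrightarrow> x i = y i"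
  shows "shift_dist x y \<le> (1 / 2) ^ k"
proof (cases "x = y")
  case False
  then obtain i where i: "x i \<noteq> y i" by auto
  define l where "l = (LEAST k. \<exists>i. nat \<bar>i\<bar> = k \<and> x i \<noteq> y i)"
  have "\<exists>i. nat \<bar>i\<bar> = l \<and> x i \<noteq> y i" unfolding l_def by (rule LeastI_ex) (use i in blast)
  then have "k \<le> l" using assms by (metis not_le)
  then have "(1 / 2 :: real) ^ l \<le> (1 / 2) ^ k" by (intro power_decreasing) auto
  then show ?thesis using False by (simp add: shift_dist_def l_def)
qed (simp add: shift_dist_def)

lemma holder_on_geometric:
  assumes "holder_on X f"
  obtains C r where "C \<ge> 0" "0 < r" "r < 1"
    "\<And>x y k. x \<in> X \<Longrightarrow> y \<in> X \<Longrightarrow> (\<And>i. nat \<bar>i\<bar> < k \<Longrightarrow> x i = y i) \<Longrightarrow> \<bar>f x - f y\<bar> \<le> C * r ^ k"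
proof -
  obtain C \<theta> where h: "\<theta> > 0" "\<And>x y. x \<in> X \<Longrightarrow> y \<in> X \<Longrightarrow> \<bar>f x - f y\<bar> \<le> C * shift_dist x y powr \<theta>"
    using assms unfolding holder_on_def by blast
  define r where "r = (1 / 2 :: real) powr \<theta>"
  have r: "0 < r" "r < 1" using powr_less_mono2[OF h(1), of "1 / 2" 1] by (auto simp: r_def)
  have "\<bar>f x - f y\<bar> \<le> max C 0 * r ^ k" if "x \<in> X" "y \<in> X" "\<And>i. nat \<bar>i\<bar> < k \<Longrightarrow> x i = y i" for x y k
  proof -
    have sd: "shift_dist x y \<ge> 0" by (simp add: shift_dist_def)
    have "shift_dist x y powr \<theta> \<le> ((1 / 2) ^ k) powr \<theta>"
      using shift_dist_le[of k x y] that(3) sd h(1) by (intro powr_mono2) auto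
    also have "\<dots> = r ^ k"
      by (simp add: r_def powr_power powr_realpow[symmetric] powr_powr mult.commute)
    finally have sd2: "shift_dist x y powr \<theta> \<le> r ^ k" .
    have "\<bar>f x - f y\<bar> \<le> C * shift_dist x y powr \<theta>" by (rule h(2)[OF that(1,2)])
    also have "\<dots> \<le> max C 0 * r ^ k" using sd2 by (intro mult_mono) auto
    finally show ?thesis .
  qed
  then show ?thesis using that[of "max C 0" r] r by auto
qed

lemma SFT_window:
  assumes X: "X = {x. \<forall>i. word x i N \<notin> F}" and n: "N \<le> n"
    and z: "\<And>i. \<exists>x\<in>X. \<exists>j. \<forall>k<n. z (i + int k) = x (j + int k)"
  shows "z \<in> X"
proof -
  have "word z i N \<notin> F" for i
  proof -
    obtain x j where x: "x \<in> X" "\<forall>k<n. z (i + int k) = x (j + int k)" using z[of i] by blast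
    then have "word z i N = word x j N" using n by (auto simp: word_eq_iff)
    then show ?thesis using x(1) by (simp add: X)
  qed
  then show ?thesis by (simp add: X)
qed

text \<open>Mixing yields a waiting time for each pair of N-words, and finitely many pairs have a
  common bound. The connecting point overlaps each half-line in N letters, so every N-window of the
  glued sequence lies inside one of three points of X.\<close>

lemma SFT_glue:
  assumes X: "X = {x :: int \<Rightarrow> 'a::finite. \<forall>i. word x i N \<notin> F}" and mix: "top_mixing X"
  obtains G where "\<And>x y. x \<in> X \<Longrightarrow> y \<in> X \<Longrightarrow> \<exists>z\<in>X. (\<forall>i<0. z i = x i) \<and> (\<forall>i\<ge>0. z (i + int G) = y i)"
proof -
  have "\<exists>M. \<forall>n\<ge>M. \<exists>x\<in>X. word x 0 N = u \<and> word x (int n) N = v"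
    if uv: "u \<in> lang X N" "v \<in> lang X N" for u v
  proof -
    have l: "length u = N" "length v = N" using uv lang_length by auto
    have "u \<in> lang X (length u)" "v \<in> lang X (length v)" using uv l by auto
    then show ?thesis using mix unfolding top_mixing_def by (metis l)
  qed
  then obtain M where M: "\<And>u v n. u \<in> lang X N \<Longrightarrow> v \<in> lang X N \<Longrightarrow> n \<ge> M u v \<Longrightarrow>
      \<exists>x\<in>X. word x 0 N = u \<and> word x (int n) N = v"
    by metis
  \<comment> \<open>A sum of natural numbers dominates each summand, so it serves as a uniform bound
    without a maximum.\<close>
  define G where "G = (\<Sum>u\<in>lang X N. \<Sum>v\<in>lang X N. M u v)"
  have MG: "M u v \<le> N + G" if "u \<in> lang X N" "v \<in> lang X N" for u v
  proof -
    have "M u v \<le> (\<Sum>v\<in>lang X N. M u v)" using that by (intro member_le_sum) auto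
    also have "\<dots> \<le> G" unfolding G_def using that by (intro member_le_sum) auto
    finally show ?thesis by simp
  qed
  have "\<exists>z\<in>X. (\<forall>i<0. z i = x i) \<and> (\<forall>i\<ge>0. z (i + int G) = y i)" if x: "x \<in> X" and y: "y \<in> X" for x y
  proof -
    have "word x (- int N) N \<in> lang X N" "word y 0 N \<in> lang X N" using x y by auto
    then obtain w where w: "w \<in> X" "word w 0 N = word x (- int N) N" "word w (int (N + G)) N = word y 0 N"
      using M MG by blast
    define z where "z = (\<lambda>i. if i < 0 then x i else if i < int G then w (i + int N) else y (i - int G))"
    have z1: "z i = x i" if "i < 0" for i using that by (simp add: z_def)
    have z3: "z i = y (i - int G)" if "i \<ge> int G" for i using that by (simp add: z_def)
    have z2: "z i = w (i + int N)" if "- int N \<le> i" "i < int (N + G)" for i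
    proof (cases "i < 0")
      case True
      have "nat (i + int N) < N" using True that by auto
      then have "w (0 + int (nat (i + int N))) = x (- int N + int (nat (i + int N)))"
        using w(2) unfolding word_eq_iff by blast
      then show ?thesis using True that by (simp add: z1)
    next
      case False
      show ?thesis
      proof (cases "i < int G")
        case True
        then show ?thesis using False by (simp add: z_def)
      next
        case f: False
        have "nat (i - int G) < N" using f that by auto
        then have "w (int (N + G) + int (nat (i - int G))) = y (0 + int (nat (i - int G)))"
          using w(3) unfolding word_eq_iff by blast
        then show ?thesis using f by (simp add: z3 algebra_simps)
      qed
    qed
    have "z \<in> X"
    proof (rule SFT_window[OF X order_refl])
      fix i
      \<comment> \<open>In the last case the window may protrude beyond the gap on both sides, but
        by fewer than N letters, where the connecting point agrees with x or y.\<close>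
      consider "i + int N \<le> 0" | "i \<ge> int G" | "- int N < i" "i < int G" by linarith
      then show "\<exists>x\<in>X. \<exists>j. \<forall>k<N. z (i + int k) = x (j + int k)"
      proof cases
        case 1
        then have "\<forall>k<N. z (i + int k) = x (i + int k)" using z1 by simp
        then show ?thesis using x by blast
      next
        case 2
        then have "\<forall>k<N. z (i + int k) = y (i - int G + int k)" using z3 by (simp add: algebra_simps)
        then show ?thesis using y by blast
      next
        case 3
        then have "\<forall>k<N. z (i + int k) = w (i + int N + int k)" using z2 by (simp add: algebra_simps)
        then show ?thesis using w(1) by blast
      qed
    qed
    moreover have "\<forall>i\<ge>0. z (i + int G) = y i" using z3 by simp
    ultimately show ?thesis using z1 by blast
  qed
  then show ?thesis using that by blast
qed

lemma geometric_partial_sum: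
  assumes "0 < r" "r < (1 :: real)"
  shows "(\<Sum>i<k. r ^ i) \<le> 1 / (1 - r)"
proof -
  have "(\<Sum>i<k. r ^ i) = (1 - r ^ k) / (1 - r)" using assms by (simp add: sum_gp_strict)
  also have "\<dots> \<le> 1 / (1 - r)" using assms by (intro divide_right_mono) auto
  finally show ?thesis .
qed

lemma SFT_sft_system:
  fixes X :: "(int \<Rightarrow> 'a::finite) set"
  assumes "is_SFT X" "nontrivial X" "top_mixing X" "holder_on X f"
  obtains N0 G V B where "sft_system X f N0 G V B"
proof -
  obtain N F where X: "X = {x :: int \<Rightarrow> 'a. \<forall>i. word x i N \<notin> F}"
    using assms(1) unfolding is_SFT_def by blast
  obtain G where G: "\<And>x y. x \<in> X \<Longrightarrow> y \<in> X \<Longrightarrow> \<exists>z\<in>X. (\<forall>i<0. z i = x i) \<and> (\<forall>i\<ge>0. z (i + int G) = y i)"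
    using SFT_glue[OF X assms(3)] by blast
  obtain C r where h: "C \<ge> 0" "0 < r" "r < 1"
    "\<And>x y k. x \<in> X \<Longrightarrow> y \<in> X \<Longrightarrow> (\<And>i. nat \<bar>i\<bar> < k \<Longrightarrow> x i = y i) \<Longrightarrow> \<bar>f x - f y\<bar> \<le> C * r ^ k"
    using holder_on_geometric[OF assms(4)] by metis
  obtain x0 where x0: "x0 \<in> X" using assms(2) by (auto simp: nontrivial_def)
  have inv: "(\<lambda>i. x (i + p)) \<in> X" if "x \<in> X" for x p
    using that by (simp add: X word_translate)
  \<comment> \<open>The distortion is twice a geometric series: at time i the two points agree up to
    distance about i on the left and k - i on the right, and each side contributes at most C / (1 -
    r).\<close>
  have "sft_system X f N G (2 * C / (1 - r)) (\<bar>f x0\<bar> + C)"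
  proof
    show "z \<in> X" if "N \<le> n" "\<And>i. \<exists>x\<in>X. \<exists>j. \<forall>k<n. z (i + int k) = x (j + int k)" for n z
      by (rule SFT_window[OF X that])
    show "\<exists>z\<in>X. (\<forall>i<0. z i = x i) \<and> (\<forall>i\<ge>0. z (i + int G) = y i)" if "x \<in> X" "y \<in> X" for x y
      by (rule G[OF that])
    show "X \<noteq> {}" using x0 by auto
    show "\<bar>f x\<bar> \<le> \<bar>f x0\<bar> + C" if "x \<in> X" for x
      using h(4)[OF that x0, of 0] by simp
  next
    fix x y k assume xy: "x \<in> X" "y \<in> X" and eq: "\<And>i. i < k \<Longrightarrow> x (int i) = y (int i)"
    have each: "\<bar>f (\<lambda>j. x (j + int i)) - f (\<lambda>j. y (j + int i))\<bar> \<le> C * (r ^ i + r ^ (k - Suc i))" if i: "i < k" for i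
    proof -
      have "\<bar>f (\<lambda>j. x (j + int i)) - f (\<lambda>j. y (j + int i))\<bar> \<le> C * r ^ min i (k - Suc i)"
      proof (rule h(4)[OF inv[OF xy(1)] inv[OF xy(2)]])
        fix j assume "nat \<bar>j\<bar> < min i (k - Suc i)"
        then have j: "0 \<le> j + int i" "j + int i < int k" using i by auto
        then show "x (j + int i) = y (j + int i)" using eq[of "nat (j + int i)"] by auto
      qed
      also have "\<dots> \<le> C * (r ^ i + r ^ (k - Suc i))"
        using h by (intro mult_left_mono) (auto simp: min_def)
      finally show ?thesis .
    qed
    have "\<bar>birkhoff f k x - birkhoff f k y\<bar> \<le> (\<Sum>i<k. \<bar>f (\<lambda>j. x (j + int i)) - f (\<lambda>j. y (j + int i))\<bar>)"
      unfolding birkhoff_alt sum_subtractf[symmetric] by (rule sum_abs)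
    also have "\<dots> \<le> (\<Sum>i<k. C * (r ^ i + r ^ (k - Suc i)))" using each by (intro sum_mono) auto
    also have "\<dots> = C * ((\<Sum>i<k. r ^ i) + (\<Sum>i<k. r ^ (k - Suc i)))"
      by (simp add: sum_distrib_left[symmetric] sum.distrib)
    also have "(\<Sum>i<k. r ^ (k - Suc i)) = (\<Sum>i<k. r ^ i)" by (rule sum.nat_diff_reindex)
    also have "C * ((\<Sum>i<k. r ^ i) + (\<Sum>i<k. r ^ i)) \<le> C * (1 / (1 - r) + 1 / (1 - r))"
      using h geometric_partial_sum[OF h(2,3), of k] by (intro mult_left_mono add_mono) auto
    finally show "\<bar>birkhoff f k x - birkhoff f k y\<bar> \<le> 2 * C / (1 - r)" by (simp add: mult.commute)
  qed
  then show ?thesis using that by blast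
qed

text \<open>On X the potential is the pointwise limit of functions of a finite window, obtained by
  evaluating f at a chosen point with the same window. Off X nothing is known about f, hence the
  indicator.\<close>

lemma holder_measurable:
  fixes X :: "(int \<Rightarrow> 'a::finite) set"
  assumes X: "X \<in> sets FS" and h: "holder_on X f"
  shows "(\<lambda>x. indicator X x * f x) \<in> borel_measurable FS"
proof -
  obtain C r where h: "C \<ge> 0" "0 < r" "r < 1"
    "\<And>x y k. x \<in> X \<Longrightarrow> y \<in> X \<Longrightarrow> (\<And>i. nat \<bar>i\<bar> < k \<Longrightarrow> x i = y i) \<Longrightarrow> \<bar>f x - f y\<bar> \<le> C * r ^ k"
    using holder_on_geometric[OF h] by metis
  define w where "w = (\<lambda>n (x :: int \<Rightarrow> 'a). word x (- int n) (2 * n + 1))"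
  define rep where "rep = (\<lambda>n v. SOME y. y \<in> X \<and> w n y = v)"
  have rep: "rep n (w n x) \<in> X \<and> w n (rep n (w n x)) = w n x" if "x \<in> X" for x n
    unfolding rep_def by (rule someI[of _ x]) (use that in simp)
  define g where "g = (\<lambda>n x. indicator X x * f (rep n (w n x)))"
  have wm: "w n \<in> measurable FS (count_space UNIV)" for n
    unfolding w_def using word_set by (subst measurable_count_space_eq2_countable) (auto simp: vimage_def)
  have gm: "g n \<in> borel_measurable FS" for n
  proof -
    have "(\<lambda>x. f (rep n (w n x))) \<in> borel_measurable FS"
      by (rule measurable_compose[OF wm, of "\<lambda>v. f (rep n v)"]) simp
    then show ?thesis unfolding g_def using X by (intro borel_measurable_times borel_measurable_indicator) auto
  qed
  show ?thesis
  proof (rule borel_measurable_LIMSEQ_real[OF _ gm])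
    fix x :: "int \<Rightarrow> 'a"
    show "(\<lambda>n. g n x) \<longlonglongrightarrow> indicator X x * f x"
    proof (cases "x \<in> X")
      case True
      have le: "\<bar>g n x - f x\<bar> \<le> C * r ^ n" for n
      proof -
        have "\<bar>f (rep n (w n x)) - f x\<bar> \<le> C * r ^ n"
        proof (rule h(4))
          show "rep n (w n x) \<in> X" using rep[OF True] by blast
          fix i :: int assume i: "nat \<bar>i\<bar> < n"
          have "nat (i + int n) < 2 * n + 1" "- int n + int (nat (i + int n)) = i" using i by auto
          then show "rep n (w n x) i = x i"
            using rep[OF True, of n] unfolding w_def word_eq_iff by metis
        qed (rule True)
        then show ?thesis using True by (simp add: g_def)
      qed
      have "(\<lambda>n. C * r ^ n) \<longlonglongrightarrow> C * 0"
        using h(2,3) by (intro tendsto_mult tendsto_const LIMSEQ_power_zero) auto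
      then have "(\<lambda>n. C * r ^ n) \<longlonglongrightarrow> 0" by simp
      then have "(\<lambda>n. g n x - f x) \<longlonglongrightarrow> 0"
        by (rule Lim_null_comparison[rotated]) (simp add: le)
      then show ?thesis using True by (simp add: LIM_zero_iff)
    next
      case False
      then show ?thesis by (simp add: g_def)
    qed
  qed
qed

theorem theorem1p1:
  fixes X :: "(int \<Rightarrow> 'a::finite) set"
    and f :: "(int \<Rightarrow> 'a) \<Rightarrow> real"
    and \<mu> :: "(int \<Rightarrow> 'a) measure"
    and \<alpha> \<epsilon> :: real
  assumes "is_SFT X" and "nontrivial X" and "top_mixing X"
    and "holder_on X f"
    and "equilibrium_state X f \<mu>"
    and "gamma0 X \<mu> < \<alpha>" and "\<alpha> \<le> 1"
    and "\<epsilon> > 0"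
  shows "\<exists>\<rho>>0. \<exists>N. \<forall>n\<ge>N.
    measure_pmf.prob (rand_forbidden X \<alpha> n)
      {F. \<bar>pressure (Yn X n F) f - (pressure X f + ereal (ln \<alpha>))\<bar> \<ge> ereal \<epsilon>}
    < exp (- \<rho> * real n)"
proof -
  obtain N0 G V B where "sft_system X f N0 G V B"
    using SFT_sft_system[OF assms(1-4)] by blast
  then interpret sft_system X f N0 G V B .
  have fm: "(\<lambda>x. indicator X x * f x) \<in> borel_measurable FS"
    by (rule holder_measurable[OF X_sets assms(4)])
  let ?S = "{\<gamma>. \<gamma> > 0 \<and> (\<exists>n0. \<forall>m\<ge>n0. \<forall>u\<in>lang X m. measure \<mu> (cyl X u) \<le> \<gamma> ^ m)}"
  have "prob_space \<mu>" using assms(5) by (simp add: equilibrium_state_def invariant_on_def)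
  \<comment> \<open>The set defining \<open>gamma0\<close> must be nonempty before an element below
    \<open>\<alpha>\<close> can be extracted from its infimum.\<close>
  then have "1 \<in> ?S" using prob_space.prob_le_1 by (auto intro!: exI[of _ 0])
  then obtain \<gamma> where "\<gamma> \<in> ?S" and \<gamma>\<alpha>: "\<gamma> < \<alpha>"
    using cInf_lessD[of ?S \<alpha>] assms(6) unfolding gamma0_def by blast
  then obtain n0 where \<gamma>: "\<gamma> > 0" and n0: "\<And>m u. m \<ge> n0 \<Longrightarrow> u \<in> lang X m \<Longrightarrow> measure \<mu> (cyl X u) \<le> \<gamma> ^ m"
    by blast
  \<comment> \<open>At least 1, because the lower Gibbs bound is stated for nonempty words.\<close>
  define n1 where "n1 = max n0 1"
  define K where "K = CZ ^ 3 / (1 - exp (- 1 :: real))"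
  have e1: "(1 - exp (- 1 :: real)) > 0" by simp
  have CZ: "CZ > 0" using CZ_ge1 by linarith
  have K0: "K > 0" using CZ e1 by (simp add: K_def)
  \<comment> \<open>\<open>K\<close> inverts the constant of the lower Gibbs bound and serves the
    long words; the last term serves the finitely many lengths below \<open>n1\<close>, where the
    weight is at most \<open>CZ\<close>.\<close>
  define C0 where "C0 = 1 + K + CZ / \<gamma> ^ n1"
  have "gibbs_decay X f N0 G V B \<gamma> \<alpha> C0"
  proof
    show "0 < \<gamma>" "\<gamma> < \<alpha>" "\<alpha> \<le> 1" using \<gamma> \<gamma>\<alpha> assms(7) by auto
    show "1 \<le> C0" using K0 CZ \<gamma> by (simp add: C0_def)
    fix u k assume u: "u \<in> lang X k"
    show "exp (Smf X f u - prs * real k) \<le> C0 * \<gamma> ^ k"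
    proof (cases "k \<ge> n1")
      case True
      have "(1 - exp (-1)) * exp (Smf X f u - prs * real k) / CZ ^ 3 \<le> measure \<mu> (cyl X u)"
        using True by (intro gibbs_lower_bound[OF fm assms(5) u]) (simp add: n1_def)
      also have "\<dots> \<le> \<gamma> ^ k" using True u by (intro n0) (auto simp: n1_def)
      finally have "exp (Smf X f u - prs * real k) \<le> K * \<gamma> ^ k"
        using CZ e1 by (simp add: K_def field_simps)
      also have "\<dots> \<le> C0 * \<gamma> ^ k" using CZ \<gamma> by (intro mult_right_mono) (auto simp: C0_def)
      finally show ?thesis .
    next
      case False
      have "exp (Smf X f u - prs * real k) \<le> CZ"
        using exp_Smf_le[OF u] by (simp add: exp_diff divide_le_eq)
      also have "\<dots> \<le> CZ / \<gamma> ^ n1 * \<gamma> ^ k"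
        using False CZ \<gamma> power_decreasing[of k n1 \<gamma>] \<gamma>\<alpha> assms(7) by (simp add: field_simps)
      also have "\<dots> \<le> C0 * \<gamma> ^ k" using K0 \<gamma> by (intro mult_right_mono) (auto simp: C0_def)
      finally show ?thesis .
    qed
  qed
  then show ?thesis using assms(8) by (rule gibbs_decay.pressure_concentration)
qed

end
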